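(* Let $G \sim G_{n,1/2}$. There is a constant $c>0$ such that for any sequence of integers $g(n)$ satisfying \[ \mathbf{P}\big(\chi(G) - \zeta(G) \le g(n)\big) > 0.999 \quad \text{for all } n, \] there is a sequence of integers $n^*$ such that \[ g(n^* ) > c\, \frac{\sqrt{n^*}\, \log\log n^*}{\log^3 n^*}. \]
   Context: $G_{n,1/2}$ denotes the Erdős–Rényi random graph on $n$ vertices in which each of the $\binom{n}{2}$ possible edges is present independently with probability $1/2$. $\chi(G)$ is the chromatic number of $G$. The cochromatic number $\zeta(G)$ is the minimum number of colours in a vertex colouring of $G$ in which every colour class is either an independent set or a clique. *)

theory Defs
  imports Complex_Main
begin

definition all_edges :: "nat \<Rightarrow> nat set set" where
  "all_edges n = {e. \<exists>i j. i < j \<and> j < n \<and> e = {i, j}}"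

definition graphs :: "nat \<Rightarrow> nat set set set" where
  "graphs n = Pow (all_edges n)"

definition prob_Gn_half :: "nat \<Rightarrow> (nat set set \<Rightarrow> bool) \<Rightarrow> real" where
  "prob_Gn_half n P = real (card {E \<in> graphs n. P E}) / real (card (graphs n))"

definition chromatic_number :: "nat \<Rightarrow> nat set set \<Rightarrow> nat" where
  "chromatic_number n E = (LEAST k. \<exists>f :: nat \<Rightarrow> nat.
      (\<forall>v<n. f v < k) \<and> (\<forall>u<n. \<forall>v<n. {u, v} \<in> E \<longrightarrow> f u \<noteq> f v))"

definition independent_set :: "nat set set \<Rightarrow> nat set \<Rightarrow> bool" where
  "independent_set E S = (\<forall>u\<in>S. \<forall>v\<in>S. u \<noteq> v \<longrightarrow> {u, v} \<notin> E)"

definition is_clique :: "nat set set \<Rightarrow> nat set \<Rightarrow> bool" where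
  "is_clique E S = (\<forall>u\<in>S. \<forall>v\<in>S. u \<noteq> v \<longrightarrow> {u, v} \<in> E)"

definition cochromatic_number :: "nat \<Rightarrow> nat set set \<Rightarrow> nat" where
  "cochromatic_number n E = (LEAST k. \<exists>f :: nat \<Rightarrow> nat.
      (\<forall>v<n. f v < k) \<and>
      (\<forall>c<k. independent_set E {v. v < n \<and> f v = c} \<or> is_clique E {v. v < n \<and> f v = c}))"

end

theory Submission
  imports Defs "HOL-Library.FuncSet" "HOL-Analysis.Harmonic_Numbers" "HOL-Combinatorics.Permutations" "HOL-Real_Asymp.Real_Asymp"
begin

text \<open>Let \<open>n\<close> be such that the expected number of independent sets of size \<open>a\<close>, slightly more than the
  typical size of a colour class, is of order \<open>n / a\<^sup>2\<close>. Suppose that the gap were at most \<open>s\<close> with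
  high probability for all sizes near \<open>n\<close>. By Harris' inequality applied to the graph and its
  complement, \<open>\<chi>\<close> would then satisfy a zero-one law: if \<open>k\<close> colours suffice with probability
  bounded below, then \<open>k + s\<close> colours suffice with probability close to \<open>1\<close>. Planting about
  \<open>\<surd>n / a\<close> disjoint independent sets of size \<open>a\<close> changes the distribution of the random graph only
  by a bounded second-moment factor, so every addition of \<open>r \<approx> \<surd>n / (10 a)\<close> such sets costs
  \<open>r + s\<close> colours. After about \<open>10 \<surd>n / a\<close> rounds, the graph has about \<open>n / a\<close> more vertices and is
  coloured with \<open>n / a\<^sup>2\<close> additional colours up to an error of \<open>10 s \<surd>n / a\<close>. Starting from a
  colouring at \<open>n\<close> that is optimal up to \<open>O(n / a ^ 5)\<close> colours (second moment method for colourings of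
  almost all vertices, together with Azuma's inequality), one
  would obtain a colouring as good as if it used nearly \<open>n / a\<^sup>2\<close> classes of size \<open>a\<close>. The enlarged graph
  has at most about half as many independent sets of that size, and by the first moment bound this
  makes at least order \<open>n log a / a ^ 4\<close> further colours necessary. Hence \<open>s\<close> is at least of order
  \<open>\<surd>n log a / a\<^sup>3\<close>.\<close>

section \<open>Averages over the subsets of a finite set\<close>

text \<open>The factor log log n comes from a shortage of large classes. An optimal colouring would
  like to use about \<open>K\<close> classes of size \<open>a\<close>, a number of order n / a, but
  only about \<open>mu\<close>, of order n / a^2, independent sets of that size exist. In the first
  moment a class of size \<open>a\<close> is therefore worth a factor of order 1 / a, that is -log a
  in the exponent, whereas one additional colour is worth at most a^2 / 2. A surplus of order n /
  a^2 planted classes over the available sets thus has to be paid for with n log a / a^4 colours.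
  Planting proceeds in portions because \<open>r\<close> sets can be planted at bounded cost only
  while r^2 is at most \<open>mu\<close>; after each portion the probability, which has fallen from
  1/2 to 1/36, is restored at the price of \<open>s\<close> colours. The obstacle is the starting
  point: its error must be of smaller order than n log a / a^4. The second moment method is
  therefore applied to one explicit profile of class sizes below \<open>a\<close>. It yields only a
  probability exp (- 4 n / a^10), but Azuma's inequality turns this into 1/2 for about 4 n / a^5
  further colours, which is still negligible.\<close>

definition av :: "'a set \<Rightarrow> ('a set \<Rightarrow> real) \<Rightarrow> real" where
  "av X f = (\<Sum>E\<in>Pow X. f E) / 2 ^ card X"

lemma av_empty [simp]: "av {} f = f {}"
  by (simp add: av_def)

lemma av_insert:
  assumes "finite X" "x \<notin> X"
  shows "av (insert x X) f = (av X f + av X (\<lambda>E. f (insert x E))) / 2"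
proof -
  have inj: "inj_on (insert x) (Pow X)"
    using assms(2) by (auto simp: inj_on_def)
  have "(\<Sum>E\<in>Pow (insert x X). f E) = (\<Sum>E\<in>Pow X. f E) + (\<Sum>E\<in>insert x ` Pow X. f E)"
    unfolding Pow_insert using assms by (intro sum.union_disjoint) auto
  also have "(\<Sum>E\<in>insert x ` Pow X. f E) = (\<Sum>E\<in>Pow X. f (insert x E))"
    using inj by (simp add: sum.reindex)
  finally show ?thesis using assms by (simp add: av_def field_simps)
qed

lemma av_const [simp]: "finite X \<Longrightarrow> av X (\<lambda>E. c) = c"
  by (simp add: av_def card_Pow)

lemma av_add: "av X (\<lambda>E. f E + g E) = av X f + av X g"
  by (simp add: av_def sum.distrib add_divide_distrib)

lemma av_diff: "av X (\<lambda>E. f E - g E) = av X f - av X g"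
  by (simp add: av_def sum_subtractf diff_divide_distrib)

lemma av_cmult: "av X (\<lambda>E. c * f E) = c * av X f"
  by (simp add: av_def sum_distrib_left)

lemma av_cmult_right: "av X (\<lambda>E. f E * c) = av X f * c"
  by (simp add: av_def sum_distrib_right)

lemma av_sum: "av X (\<lambda>E. \<Sum>i\<in>I. f i E) = (\<Sum>i\<in>I. av X (f i))"
  unfolding av_def by (subst sum.swap) (simp add: sum_divide_distrib)

lemma av_mono: "(\<And>E. E \<subseteq> X \<Longrightarrow> f E \<le> g E) \<Longrightarrow> av X f \<le> av X g"
  unfolding av_def by (intro divide_right_mono sum_mono) auto

lemma av_cong: "(\<And>E. E \<subseteq> X \<Longrightarrow> f E = g E) \<Longrightarrow> av X f = av X g"
  unfolding av_def by (auto intro!: sum.cong arg_cong2[where f="(/)"])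

lemma av_nonneg: "(\<And>E. E \<subseteq> X \<Longrightarrow> 0 \<le> f E) \<Longrightarrow> 0 \<le> av X f"
  unfolding av_def by (intro divide_nonneg_nonneg sum_nonneg) auto

text \<open>Fubini: a uniformly random subset of a disjoint union is a pair of independent uniformly
  random subsets. Independence of edges in disjoint sets of pairs is derived from this.\<close>

lemma av_Un:
  assumes "finite X" "finite Y" "X \<inter> Y = {}"
  shows "av (X \<union> Y) f = av X (\<lambda>E. av Y (\<lambda>E'. f (E \<union> E')))"
  using assms
proof (induction X arbitrary: f rule: finite_induct)
  case empty
  then show ?case by simp
next
  case (insert x X)
  then show ?case by (simp add: av_insert)
qed

lemma av_restrict:
  assumes "finite Z" "X \<subseteq> Z"
  shows "av Z (\<lambda>E. f (E \<inter> X)) = av X f"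
proof -
  have fin: "finite X" using assms finite_subset by blast
  have "av (X \<union> (Z - X)) (\<lambda>E. f (E \<inter> X)) = av X (\<lambda>E. av (Z - X) (\<lambda>E'. f ((E \<union> E') \<inter> X)))"
    using assms fin by (intro av_Un) auto
  also have "\<dots> = av X (\<lambda>E. av (Z - X) (\<lambda>E'. f E))"
    by (intro av_cong arg_cong[where f=f]) auto
  also have "\<dots> = av X f" using assms by simp
  finally show ?thesis using assms by (simp add: Un_absorb1)
qed

lemma av_indep:
  assumes "finite Z" "X \<subseteq> Z" "Y \<subseteq> Z" "X \<inter> Y = {}"
  shows "av Z (\<lambda>E. f (E \<inter> X) * g (E \<inter> Y)) = av X f * av Y g"
proof -
  have fin: "finite X" "finite Y" using assms finite_subset by blast+
  have "av Z (\<lambda>E. f (E \<inter> X) * g (E \<inter> Y)) = av Z (\<lambda>E. (\<lambda>F. f (F \<inter> X) * g (F \<inter> Y)) (E \<inter> (X \<union> Y)))"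
    by (intro av_cong arg_cong2[where f="(*)"] arg_cong[where f=f] arg_cong[where f=g]) auto
  also have "\<dots> = av (X \<union> Y) (\<lambda>F. f (F \<inter> X) * g (F \<inter> Y))"
    using assms by (intro av_restrict) auto
  also have "\<dots> = av X (\<lambda>E. av Y (\<lambda>E'. f ((E \<union> E') \<inter> X) * g ((E \<union> E') \<inter> Y)))"
    using assms fin by (intro av_Un) auto
  also have "\<dots> = av X (\<lambda>E. av Y (\<lambda>E'. f E * g E'))"
    using assms by (intro av_cong arg_cong2[where f="(*)"] arg_cong[where f=f] arg_cong[where f=g]) auto
  also have "\<dots> = av X f * av Y g" by (simp add: av_cmult av_cmult_right)
  finally show ?thesis .
qed

lemma av_avoid:
  assumes "finite X" "Y \<subseteq> X"
  shows "av X (\<lambda>E. of_bool (E \<inter> Y = {})) = 1 / 2 ^ card Y"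
proof -
  have "finite Y" using assms finite_subset by blast
  have "av X (\<lambda>E. of_bool (E \<inter> Y = {})) = av Y (\<lambda>E. of_bool (E = {}))"
    using av_restrict[OF assms, of "\<lambda>E. of_bool (E = {})"] by simp
  also have "\<dots> = 1 / 2 ^ card Y"
    using \<open>finite Y\<close> by (simp add: av_def of_bool_def sum.delta)
  finally show ?thesis .
qed

text \<open>Applied to sets of edges: a graph and its complement have the same distribution, which
  is special to edge probability 1/2.\<close>

lemma av_compl:
  assumes "finite X"
  shows "av X (\<lambda>E. f (X - E)) = av X f"
proof -
  have "(\<Sum>E\<in>Pow X. f (X - E)) = (\<Sum>E\<in>Pow X. f E)"
    by (rule sum.reindex_bij_witness[of _ "\<lambda>E. X - E" "\<lambda>E. X - E"]) auto
  then show ?thesis by (simp add: av_def)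
qed

lemma av_bij:
  assumes "bij_betw \<phi> X Y"
  shows "av Y f = av X (\<lambda>E. f (\<phi> ` E))"
proof -
  have "(\<Sum>E\<in>Pow Y. f E) = (\<Sum>E\<in>Pow X. f (\<phi> ` E))"
    using bij_betw_Pow[OF assms] by (simp add: sum.reindex_bij_betw)
  moreover have "card X = card Y" using assms bij_betw_same_card by blast
  ultimately show ?thesis by (simp add: av_def)
qed

section \<open>Second moment, correlation and concentration inequalities\<close>

lemma Cauchy_av:
  assumes "finite X" "\<And>E. E \<subseteq> X \<Longrightarrow> 0 \<le> f E"
  shows "(av X f)\<^sup>2 \<le> av X (\<lambda>E. of_bool (f E > 0)) * av X (\<lambda>E. (f E)\<^sup>2)"
proof -
  have "(\<Sum>E\<in>Pow X. of_bool (f E > 0) * f E) = (\<Sum>E\<in>Pow X. f E)"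
  proof (rule sum.cong[OF refl])
    fix E assume "E \<in> Pow X"
    then have "0 \<le> f E" using assms(2) by blast
    then show "of_bool (f E > 0) * f E = f E" by (cases "f E > 0") auto
  qed
  moreover have "(\<Sum>E\<in>Pow X. (of_bool (f E > 0))\<^sup>2 :: real) = (\<Sum>E\<in>Pow X. of_bool (f E > 0))"
    by (intro sum.cong) auto
  moreover have "(\<Sum>E\<in>Pow X. of_bool (f E > 0) * f E)\<^sup>2 \<le> (\<Sum>E\<in>Pow X. (of_bool (f E > 0))\<^sup>2) * (\<Sum>E\<in>Pow X. (f E)\<^sup>2)"
    by (rule Cauchy_Schwarz_ineq_sum)
  ultimately have *: "(\<Sum>E\<in>Pow X. f E)\<^sup>2 \<le> (\<Sum>E\<in>Pow X. of_bool (f E > 0)) * (\<Sum>E\<in>Pow X. (f E)\<^sup>2)"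
    by simp
  show ?thesis unfolding av_def
    using divide_right_mono[OF *, of "(2 ^ card X)\<^sup>2"] by (simp add: power_divide power2_eq_square)
qed

text \<open>Induction on the ground set, conditioning on the presence of one element
  \<open>x\<close>: both conditional means increase when \<open>x\<close> is added, so the product
  of the two increments is nonnegative, and this is exactly the missing covariance term.\<close>

lemma Harris:
  assumes "finite X"
    and "\<And>E F. E \<subseteq> F \<Longrightarrow> F \<subseteq> X \<Longrightarrow> f E \<le> f F" "\<And>E F. E \<subseteq> F \<Longrightarrow> F \<subseteq> X \<Longrightarrow> g E \<le> g F"
  shows "av X f * av X g \<le> av X (\<lambda>E. f E * g E)"
  using assms
proof (induction X arbitrary: f g rule: finite_induct)
  case empty
  then show ?case by simp
next
  case (insert x X)
  let ?f1 = "\<lambda>E. f (insert x E)" and ?g1 = "\<lambda>E. g (insert x E)"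
  have f: "av X f \<le> av X ?f1" and g: "av X g \<le> av X ?g1"
    by (intro av_mono insert.prems; auto)+
  have 1: "av X f * av X g \<le> av X (\<lambda>E. f E * g E)"
    by (rule insert.IH) (rule insert.prems; auto)+
  have 2: "av X ?f1 * av X ?g1 \<le> av X (\<lambda>E. ?f1 E * ?g1 E)"
    by (rule insert.IH) (rule insert.prems; auto)+
  have "0 \<le> (av X ?f1 - av X f) * (av X ?g1 - av X g)" using f g by simp
  then show ?case using 1 2 insert.hyps by (simp add: av_insert field_simps)
qed

lemma exp_le_quadratic:
  fixes y :: real
  assumes "\<bar>y\<bar> \<le> 1"
  shows "exp y \<le> 1 + y + y\<^sup>2"
proof (cases "y \<ge> 0")
  case True
  then show ?thesis using exp_bound[of y] assms by simp
next
  case False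
  have "exp (-y) \<ge> 1 + (-y) + (-y)\<^sup>2 / 2" using False by (intro exp_lower_Taylor_quadratic) auto
  then have "exp y * (1 - y + y\<^sup>2 / 2) \<le> 1"
    by (simp add: exp_minus field_simps)
  moreover have "1 \<le> (1 + y + y\<^sup>2) * (1 - y + y\<^sup>2 / 2)"
  proof -
    have "(1 + y + y\<^sup>2) * (1 - y + y\<^sup>2 / 2) - 1 = y\<^sup>2 / 2 * (1 - y + y\<^sup>2)"
      by (simp add: field_simps power2_eq_square)
    moreover have "0 \<le> y\<^sup>2 / 2 * (1 - y + y\<^sup>2)" using False by (intro mult_nonneg_nonneg) auto
    ultimately show ?thesis by linarith
  qed
  ultimately have "exp y * (1 - y + y\<^sup>2 / 2) \<le> (1 + y + y\<^sup>2) * (1 - y + y\<^sup>2 / 2)" by linarith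
  moreover have "0 < 1 - y + y\<^sup>2 / 2" using False by (simp add: add_pos_nonneg)
  ultimately show ?thesis by (simp add: mult_le_cancel_right)
qed

text \<open>A weak form of Hoeffding's lemma. An oscillation of at most 1 keeps the deviation from
  the mean in [-1, 1]; in the quadratic bound for exp the linear term averages out.\<close>

lemma av_exp_deviation:
  fixes l :: real
  assumes "finite X" "\<bar>l\<bar> \<le> 1"
    and "\<And>E F. E \<subseteq> X \<Longrightarrow> F \<subseteq> X \<Longrightarrow> \<bar>f E - f F\<bar> \<le> 1"
  shows "av X (\<lambda>E. exp (l * (f E - av X f))) \<le> exp (l\<^sup>2)"
proof -
  let ?d = "\<lambda>E. f E - av X f"
  have d: "\<bar>?d E\<bar> \<le> 1" if "E \<subseteq> X" for E
  proof -
    have b: "f E - f F \<le> 1" "- 1 \<le> f E - f F" if "F \<subseteq> X" for F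
      using assms(3)[OF \<open>E \<subseteq> X\<close> that] by linarith+
    have "av X (\<lambda>F. f E - f F) \<le> av X (\<lambda>F. 1)" "av X (\<lambda>F. -1) \<le> av X (\<lambda>F. f E - f F)"
      using b by (simp_all add: av_mono)
    then show ?thesis using assms(1) by (simp add: av_diff abs_le_iff)
  qed
  have "av X (\<lambda>E. exp (l * ?d E)) \<le> av X (\<lambda>E. 1 + l * ?d E + l\<^sup>2)"
  proof (rule av_mono)
    fix E assume "E \<subseteq> X"
    have "\<bar>l * ?d E\<bar> \<le> 1" using d[OF \<open>E \<subseteq> X\<close>] assms(2) by (simp add: abs_mult mult_le_one)
    moreover have "(?d E)\<^sup>2 \<le> 1" using d[OF \<open>E \<subseteq> X\<close>] by (simp add: abs_square_le_1)
    then have "l\<^sup>2 * (?d E)\<^sup>2 \<le> l\<^sup>2" by (simp add: mult_left_le)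
    ultimately show "exp (l * ?d E) \<le> 1 + l * ?d E + l\<^sup>2"
      using exp_le_quadratic[of "l * ?d E"] by (simp add: power_mult_distrib)
  qed
  also have "\<dots> = 1 + l\<^sup>2"
    using assms(1) by (simp add: av_add av_diff av_cmult)
  also have "\<dots> \<le> exp (l\<^sup>2)" by (rule exp_ge_add_one_self)
  finally show ?thesis .
qed

text \<open>The blocks \<open>X i\<close> are revealed one after the other. Averaging over the last
  block gives a function \<open>h\<close> of the remaining blocks that again changes by at most 1
  per block. The deviation of \<open>f\<close> splits into that of \<open>h\<close>, treated by
  induction, and \<open>f - h\<close>, treated conditionally on the other blocks.\<close>

lemma Azuma_mgf:
  fixes l :: real and X :: "nat \<Rightarrow> 'a set"
  assumes "\<And>i. i < n \<Longrightarrow> finite (X i)" "\<And>i j. i < n \<Longrightarrow> j < n \<Longrightarrow> i \<noteq> j \<Longrightarrow> X i \<inter> X j = {}"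
    and "\<bar>l\<bar> \<le> 1"
    and "\<And>i E F. i < n \<Longrightarrow> E \<subseteq> (\<Union>j<n. X j) \<Longrightarrow> F \<subseteq> (\<Union>j<n. X j) \<Longrightarrow> E - X i = F - X i \<Longrightarrow> \<bar>f E - f F\<bar> \<le> 1"
  shows "av (\<Union>j<n. X j) (\<lambda>E. exp (l * (f E - av (\<Union>j<n. X j) f))) \<le> exp (l\<^sup>2 * n)"
  using assms
proof (induction n arbitrary: f)
  case 0
  then show ?case by simp
next
  case (Suc n)
  let ?U = "\<Union>j<n. X j"
  have U: "(\<Union>j<Suc n. X j) = ?U \<union> X n" by (auto simp: lessThan_Suc)
  have fin: "finite ?U" "finite (X n)" using Suc.prems(1) by auto
  have dis: "?U \<inter> X n = {}" using Suc.prems(2)[of _ n] by (auto, metis disjoint_iff less_Suc_eq nat_neq_iff)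
  define h where "h E = av (X n) (\<lambda>E'. f (E \<union> E'))" for E
  have avh: "av (?U \<union> X n) f = av ?U h" unfolding h_def by (rule av_Un[OF fin dis])
  have IH: "av ?U (\<lambda>E. exp (l * (h E - av ?U h))) \<le> exp (l\<^sup>2 * n)"
  proof (rule Suc.IH)
    fix i E F assume i: "i < n" and E: "E \<subseteq> ?U" "F \<subseteq> ?U" and eq: "E - X i = F - X i"
    have *: "\<bar>f (E \<union> E') - f (F \<union> E')\<bar> \<le> 1" if "E' \<subseteq> X n" for E'
      using i E that eq by (intro Suc.prems(4)[of i]) (auto simp: U)
    have "av (X n) (\<lambda>E'. f (E \<union> E') - f (F \<union> E')) \<le> av (X n) (\<lambda>E'. 1)"
      using * by (intro av_mono) force
    moreover have "av (X n) (\<lambda>E'. -1) \<le> av (X n) (\<lambda>E'. f (E \<union> E') - f (F \<union> E'))"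
      using * by (intro av_mono) force
    ultimately show "\<bar>h E - h F\<bar> \<le> 1" using fin by (simp add: h_def av_diff abs_le_iff)
  qed (use Suc.prems in auto)
  have step: "av (X n) (\<lambda>E'. exp (l * (f (E \<union> E') - av ?U h))) \<le> exp (l * (h E - av ?U h)) * exp (l\<^sup>2)"
    if E: "E \<subseteq> ?U" for E
  proof -
    have "av (X n) (\<lambda>E'. exp (l * (f (E \<union> E') - h E))) \<le> exp (l\<^sup>2)" unfolding h_def
    proof (rule av_exp_deviation[OF fin(2) Suc.prems(3)])
      fix E' F assume "E' \<subseteq> X n" "F \<subseteq> X n"
      then show "\<bar>f (E \<union> E') - f (E \<union> F)\<bar> \<le> 1"
        using E by (intro Suc.prems(4)[of n]) (auto simp: U)
    qed
    moreover have "av (X n) (\<lambda>E'. exp (l * (f (E \<union> E') - av ?U h)))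
       = av (X n) (\<lambda>E'. exp (l * (h E - av ?U h)) * exp (l * (f (E \<union> E') - h E)))"
      by (intro av_cong) (simp add: exp_add[symmetric] right_diff_distrib)
    ultimately show ?thesis by (simp add: av_cmult)
  qed
  have "av (?U \<union> X n) (\<lambda>E. exp (l * (f E - av ?U h))) = av ?U (\<lambda>E. av (X n) (\<lambda>E'. exp (l * (f (E \<union> E') - av ?U h))))"
    by (rule av_Un[OF fin dis])
  also have "\<dots> \<le> av ?U (\<lambda>E. exp (l * (h E - av ?U h)) * exp (l\<^sup>2))"
    using step by (rule av_mono)
  also have "\<dots> = av ?U (\<lambda>E. exp (l * (h E - av ?U h))) * exp (l\<^sup>2)" by (rule av_cmult_right)
  also have "\<dots> \<le> exp (l\<^sup>2 * n) * exp (l\<^sup>2)" using IH by simp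
  also have "\<dots> = exp (l\<^sup>2 * Suc n)" by (simp add: exp_add[symmetric] algebra_simps)
  finally show ?case by (simp only: U avh)
qed

text \<open>Markov's inequality for the exponential moment. The sign of \<open>l\<close> selects the
  upper or the lower tail.\<close>

lemma Azuma_tail:
  fixes X :: "nat \<Rightarrow> 'a set"
  assumes "\<And>i. i < n \<Longrightarrow> finite (X i)" "\<And>i j. i < n \<Longrightarrow> j < n \<Longrightarrow> i \<noteq> j \<Longrightarrow> X i \<inter> X j = {}"
    and "\<bar>l\<bar> \<le> 1"
    and "\<And>i E F. i < n \<Longrightarrow> E \<subseteq> (\<Union>j<n. X j) \<Longrightarrow> F \<subseteq> (\<Union>j<n. X j) \<Longrightarrow> E - X i = F - X i \<Longrightarrow> \<bar>f E - f F\<bar> \<le> 1"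
  shows "av (\<Union>j<n. X j) (\<lambda>E. of_bool (l * (f E - av (\<Union>j<n. X j) f) \<ge> t)) \<le> exp (l\<^sup>2 * n - t)"
proof -
  let ?U = "\<Union>j<n. X j"
  have "av ?U (\<lambda>E. of_bool (l * (f E - av ?U f) \<ge> t)) \<le> av ?U (\<lambda>E. exp (-t) * exp (l * (f E - av ?U f)))"
    by (intro av_mono) (auto simp: of_bool_def exp_add[symmetric])
  also have "\<dots> = exp (-t) * av ?U (\<lambda>E. exp (l * (f E - av ?U f)))" by (rule av_cmult)
  also have "\<dots> \<le> exp (-t) * exp (l\<^sup>2 * n)"
    using Azuma_mgf[of n X l f] assms by simp
  finally show ?thesis by (simp add: exp_add[symmetric] algebra_simps)
qed

section \<open>Colourings of random graphs\<close>

definition edges_in :: "nat set \<Rightarrow> nat set set" where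
  "edges_in V = {e. e \<subseteq> V \<and> card e = 2}"

lemma edges_inE:
  assumes "e \<in> edges_in V"
  obtains i j where "i \<in> V" "j \<in> V" "i \<noteq> j" "e = {i, j}"
  using assms by (auto simp: edges_in_def card_2_iff)

lemma pair_in_edges_in [simp]: "{i, j} \<in> edges_in V \<longleftrightarrow> i \<in> V \<and> j \<in> V \<and> i \<noteq> j"
  by (auto simp: edges_in_def card_2_iff doubleton_eq_iff)

lemma finite_edges_in [simp]: "finite V \<Longrightarrow> finite (edges_in V)"
  by (rule finite_subset[of _ "Pow V"]) (auto simp: edges_in_def)

lemma card_edges_in: "finite V \<Longrightarrow> card (edges_in V) = card V choose 2"
  unfolding edges_in_def by (rule n_subsets)

lemma edges_in_mono: "V \<subseteq> W \<Longrightarrow> edges_in V \<subseteq> edges_in W"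
  by (auto simp: edges_in_def)

lemma edges_in_Int: "edges_in (V \<inter> W) = edges_in V \<inter> edges_in W"
  by (auto simp: edges_in_def)

lemma edges_in_disjoint:
  assumes "V \<inter> W = {}" shows "edges_in V \<inter> edges_in W = {}"
proof -
  have "edges_in {} = {}" by (auto simp: edges_in_def)
  then show ?thesis using assms by (metis edges_in_Int)
qed

lemma all_edges_eq: "all_edges n = edges_in {..<n}"
proof (intro equalityI subsetI)
  fix e assume "e \<in> all_edges n"
  then show "e \<in> edges_in {..<n}" by (auto simp: all_edges_def)
next
  fix e assume "e \<in> edges_in {..<n}"
  then obtain i j where "i < n" "j < n" "i \<noteq> j" "e = {i, j}" by (auto elim: edges_inE)
  then show "e \<in> all_edges n" unfolding all_edges_def
    by (intro CollectI exI[of _ "min i j"] exI[of _ "max i j"]) (auto simp: min_def max_def)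
qed

text \<open>The vertex set is a parameter because the condition is also imposed on the vertices left
  over by a partial colouring; edges not inside \<open>V\<close> are ignored.\<close>

definition colorable :: "nat set \<Rightarrow> nat \<Rightarrow> nat set set \<Rightarrow> bool" where
  "colorable V k E \<longleftrightarrow> (\<exists>f :: nat \<Rightarrow> nat. (\<forall>v\<in>V. f v < k) \<and>
     (\<forall>u\<in>V. \<forall>v\<in>V. u \<noteq> v \<longrightarrow> {u, v} \<in> E \<longrightarrow> f u \<noteq> f v))"

definition cp :: "nat \<Rightarrow> nat \<Rightarrow> real" where
  "cp n k = av (edges_in {..<n}) (\<lambda>E. of_bool (colorable {..<n} k E))"

lemma colorable_mono: "colorable V k E \<Longrightarrow> k \<le> k' \<Longrightarrow> colorable V k' E"
  unfolding colorable_def by (meson order_less_le_trans)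

lemma colorable_edges_antimono: "colorable V k F \<Longrightarrow> E \<subseteq> F \<Longrightarrow> colorable V k E"
  unfolding colorable_def by blast

lemma colorable_restrict: "colorable V k (E \<inter> edges_in V) \<longleftrightarrow> colorable V k E"
  unfolding colorable_def by auto

lemma colorable_card: assumes "finite V" "card V \<le> k" shows "colorable V k E"
proof -
  obtain f where f: "f ` V \<subseteq> {..<k}" "inj_on f V"
    using card_le_inj[OF assms(1), of "{..<k}"] assms by auto
  then show ?thesis unfolding colorable_def by (intro exI[of _ f]) (auto simp: inj_on_def)
qed

lemma cp_nonneg: "0 \<le> cp n k" and cp_le_1: "cp n k \<le> 1"
proof -
  show "0 \<le> cp n k" unfolding cp_def by (intro av_nonneg) auto
  have "cp n k \<le> av (edges_in {..<n}) (\<lambda>E. 1)" unfolding cp_def by (intro av_mono) auto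
  then show "cp n k \<le> 1" by simp
qed

lemma cp_eq_1: "n \<le> k \<Longrightarrow> cp n k = 1"
  by (simp add: cp_def colorable_card)

lemma prob_Gn_half_eq_av: "prob_Gn_half n P = av (edges_in {..<n}) (\<lambda>E. of_bool (P E))"
proof -
  let ?A = "Pow (edges_in {..<n})"
  have "real (card {E \<in> ?A. P E}) = (\<Sum>E\<in>{E \<in> ?A. P E}. 1)" by simp
  also have "\<dots> = (\<Sum>E\<in>?A. if P E then 1 else 0)" by (rule sum.inter_filter) simp
  finally show ?thesis
    by (simp add: prob_Gn_half_def graphs_def all_edges_eq av_def of_bool_def card_Pow)
qed

lemma chromatic_number_le_iff:
  assumes "E \<subseteq> edges_in {..<n}"
  shows "chromatic_number n E \<le> k \<longleftrightarrow> colorable {..<n} k E"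
proof -
  have ne: "u \<noteq> v" if "{u, v} \<in> E" for u v using assms pair_in_edges_in[of u v] that by blast
  have eq: "(\<exists>f :: nat \<Rightarrow> nat. (\<forall>v<n. f v < k) \<and> (\<forall>u<n. \<forall>v<n. {u, v} \<in> E \<longrightarrow> f u \<noteq> f v)) \<longleftrightarrow> colorable {..<n} k E" for k
    unfolding colorable_def Ball_def lessThan_iff using ne by blast
  have chi: "chromatic_number n E = (LEAST k. colorable {..<n} k E)"
    unfolding chromatic_number_def eq ..
  have "colorable {..<n} n E" by (simp add: colorable_card)
  then have "colorable {..<n} (chromatic_number n E) E" unfolding chi by (rule LeastI)
  then show ?thesis using colorable_mono chi Least_le by metis
qed

lemma cochromatic_number_le:
  assumes "colorable {..<n} k (edges_in {..<n} - E)"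
  shows "cochromatic_number n E \<le> k"
proof -
  obtain f :: "nat \<Rightarrow> nat" where f: "\<forall>v<n. f v < k"
    "\<forall>u<n. \<forall>v<n. u \<noteq> v \<longrightarrow> {u, v} \<notin> E \<longrightarrow> f u \<noteq> f v"
    using assms unfolding colorable_def by auto
  show ?thesis unfolding cochromatic_number_def
    by (rule Least_le, rule exI[of _ f]) (use f in \<open>auto simp: is_clique_def; metis\<close>)
qed

text \<open>The cochromatic number is at most the chromatic number of the complement, and
  \<open>\<chi>(G)\<close> is increasing while the chromatic number of the complement is decreasing in \<open>G\<close>; so
  Harris' inequality makes a large \<open>\<chi>(G)\<close> together with a small \<open>\<zeta>(G)\<close> at least as likely
  as for independent events.\<close>

lemma cp_product_bound:
  assumes "prob_Gn_half n (\<lambda>E. int (chromatic_number n E) - int (cochromatic_number n E) \<le> g) > 0.999"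
    and "g \<le> int s"
  shows "cp n A * (1 - cp n (A + s)) \<le> 0.001"
proof -
  let ?X = "edges_in {..<n}"
  let ?f = "\<lambda>E. of_bool (\<not> colorable {..<n} (A + s) E) :: real"
  let ?h = "\<lambda>E. of_bool (colorable {..<n} A (?X - E)) :: real"
  have "av ?X ?f * av ?X ?h \<le> av ?X (\<lambda>E. ?f E * ?h E)"
  proof (rule Harris)
    fix E F assume "E \<subseteq> F" "F \<subseteq> ?X"
    show "?f E \<le> ?f F" using colorable_edges_antimono[OF _ \<open>E \<subseteq> F\<close>] by auto
    have "?X - F \<subseteq> ?X - E" using \<open>E \<subseteq> F\<close> by auto
    then show "?h E \<le> ?h F" using colorable_edges_antimono by auto
  qed simp
  also have "\<dots> \<le> av ?X (\<lambda>E. 1 - of_bool (int (chromatic_number n E) - int (cochromatic_number n E) \<le> g))"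
  proof (rule av_mono)
    fix E assume E: "E \<subseteq> ?X"
    have "\<not> int (chromatic_number n E) - int (cochromatic_number n E) \<le> g"
      if "\<not> colorable {..<n} (A + s) E" "colorable {..<n} A (?X - E)"
      using that chromatic_number_le_iff[OF E, of "A + s"] cochromatic_number_le[of n A E] assms(2)
      by linarith
    then show "?f E * ?h E \<le> 1 - of_bool (int (chromatic_number n E) - int (cochromatic_number n E) \<le> g)"
      by auto
  qed
  also have "\<dots> = 1 - prob_Gn_half n (\<lambda>E. int (chromatic_number n E) - int (cochromatic_number n E) \<le> g)"
    by (simp add: prob_Gn_half_eq_av av_diff)
  also have "\<dots> \<le> 0.001" using assms(1) by simp
  finally have "av ?X ?f * av ?X ?h \<le> 0.001" .
  moreover have "av ?X ?h = cp n A"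
    unfolding cp_def by (rule av_compl) simp
  moreover have "av ?X ?f = 1 - cp n (A + s)"
  proof -
    have "av ?X ?f = av ?X (\<lambda>E. 1 - of_bool (colorable {..<n} (A + s) E))"
      by (intro av_cong) auto
    then show ?thesis by (simp add: av_diff cp_def)
  qed
  ultimately show ?thesis by (simp add: mult.commute)
qed

text \<open>Relabelling the vertices induces a bijection of the edge sets. This is applied to the
  left-over vertices, a set that varies with the partial colouring.\<close>

lemma av_colorable:
  assumes "finite V"
  shows "av (edges_in V) (\<lambda>E. of_bool (colorable V k E)) = cp (card V) k"
proof -
  define m where "m = card V"
  obtain \<phi> where \<phi>: "bij_betw \<phi> {..<m} V"
    using ex_bij_betw_nat_finite[OF assms] by (auto simp: m_def lessThan_atLeast0)
  have inj: "inj_on \<phi> {..<m}" and im: "\<phi> ` {..<m} = V" using \<phi> by (auto simp: bij_betw_def)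
  have bij: "bij_betw ((`) \<phi>) (edges_in {..<m}) (edges_in V)"
    unfolding bij_betw_def
  proof (intro conjI equalityI subsetI)
    show "inj_on ((`) \<phi>) (edges_in {..<m})"
    proof (rule inj_onI)
      fix e e' assume "e \<in> edges_in {..<m}" "e' \<in> edges_in {..<m}" "\<phi> ` e = \<phi> ` e'"
      then show "e = e'" using inj_on_image_eq_iff[OF inj] by (auto simp: edges_in_def)
    qed
  next
    fix e assume "e \<in> (`) \<phi> ` edges_in {..<m}"
    then obtain i j where "i < m" "j < m" "i \<noteq> j" "e = {\<phi> i, \<phi> j}" by (auto elim!: edges_inE)
    then show "e \<in> edges_in V" using im inj by (auto simp: inj_on_eq_iff)
  next
    fix e assume "e \<in> edges_in V"
    then obtain i j where "i < m" "j < m" "\<phi> i \<noteq> \<phi> j" "e = \<phi> ` {i, j}"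
      unfolding im[symmetric] by (auto elim!: edges_inE)
    moreover have "{i, j} \<in> edges_in {..<m}" using calculation by auto
    ultimately show "e \<in> (`) \<phi> ` edges_in {..<m}" by blast
  qed
  have eq: "colorable V k ((`) \<phi> ` E) \<longleftrightarrow> colorable {..<m} k E" if E: "E \<subseteq> edges_in {..<m}" for E
  proof
    assume "colorable V k ((`) \<phi> ` E)"
    then obtain f :: "nat \<Rightarrow> nat" where f: "\<forall>v\<in>V. f v < k"
      "\<forall>u\<in>V. \<forall>v\<in>V. u \<noteq> v \<longrightarrow> {u, v} \<in> (`) \<phi> ` E \<longrightarrow> f u \<noteq> f v"
      unfolding colorable_def by (elim exE conjE) (rule that)
    have "f (\<phi> u) \<noteq> f (\<phi> v)" if "u < m" "v < m" "u \<noteq> v" "{u, v} \<in> E" for u v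
    proof -
      have e: "{\<phi> u, \<phi> v} \<in> (`) \<phi> ` E" using imageI[OF that(4), of "(`) \<phi>"] by simp
      have ne: "\<phi> u \<noteq> \<phi> v" using inj that by (auto simp: inj_on_eq_iff)
      have "\<phi> u \<in> V" "\<phi> v \<in> V" using im that by auto
      then show ?thesis using e ne by (intro f(2)[rule_format])
    qed
    moreover have "f (\<phi> u) < k" if "u < m" for u using f(1) im that by auto
    ultimately show "colorable {..<m} k E"
      unfolding colorable_def by (intro exI[of _ "f \<circ> \<phi>"]) auto
  next
    assume "colorable {..<m} k E"
    then obtain f :: "nat \<Rightarrow> nat" where f: "\<forall>v<m. f v < k"
      "\<forall>u<m. \<forall>v<m. u \<noteq> v \<longrightarrow> {u, v} \<in> E \<longrightarrow> f u \<noteq> f v"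
      unfolding colorable_def by auto
    define h where "h = f \<circ> inv_into {..<m} \<phi>"
    have h: "h (\<phi> u) = f u" if "u < m" for u using inj that by (simp add: h_def)
    have "h (\<phi> u) \<noteq> h (\<phi> v)" if uv: "u < m" "v < m" "\<phi> u \<noteq> \<phi> v" "{\<phi> u, \<phi> v} \<in> (`) \<phi> ` E" for u v
    proof -
      obtain e where e: "e \<in> E" "\<phi> ` e = \<phi> ` {u, v}" using uv(4) by auto
      then have "e \<subseteq> {..<m}" using E by (auto simp: edges_in_def)
      then have "e = {u, v}" using inj_on_image_eq_iff[OF inj, of e "{u, v}"] uv e by auto
      then show ?thesis using f(2) e uv by (auto simp: h)
    qed
    then show "colorable V k ((`) \<phi> ` E)"
      unfolding colorable_def im[symmetric] using f(1) h by (intro exI[of _ h]) auto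
  qed
  show ?thesis unfolding cp_def m_def[symmetric] av_bij[OF bij]
    by (intro av_cong) (simp add: eq)
qed

text \<open>Raises an exponentially small probability to 1/2: by the lower tail, \<open>k\<close>
  cannot lie more than 2 sqrt (n s) below the mean chromatic number, and by the upper tail, 2 sqrt n
  colours above the mean suffice with probability 1/2.\<close>

lemma cp_concentration:
  assumes "exp (- s) \<le> cp n k" "0 < s" "s \<le> real n" "2 * sqrt (n * s) + 2 * sqrt n \<le> real m"
  shows "1 / 2 \<le> cp n (k + m)"
proof -
  have n: "0 < real n" using assms by linarith
  \<comment> \<open>Vertex exposure: block \<open>i\<close> consists of the edges whose larger
    endpoint is \<open>i\<close>. If only these edges change, giving vertex \<open>i\<close> a new
    colour repairs any proper colouring, so the chromatic number moves by at most 1.\<close>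
  define X where "X i = {e \<in> edges_in {..<n}. Max e = i}" for i
  let ?U = "\<Union>j<n. X j"
  have U: "?U = edges_in {..<n}"
  proof -
    have "Max e < n" if "e \<in> edges_in {..<n}" for e
    proof -
      have "e \<noteq> {}" "finite e" "e \<subseteq> {..<n}" using that by (auto simp: edges_in_def intro: card_ge_0_finite)
      then show ?thesis using Max_in by blast
    qed
    then show ?thesis by (auto simp: X_def)
  qed
  define f where "f E = real (chromatic_number n E)" for E
  have lip: "chromatic_number n E \<le> chromatic_number n F + 1"
    if sub: "E \<subseteq> ?U" "F \<subseteq> ?U" and eq: "E - X i = F - X i" for i E F
  proof -
    have EF: "E \<subseteq> edges_in {..<n}" "F \<subseteq> edges_in {..<n}" using sub U by auto
    define k where "k = chromatic_number n F"
    have "colorable {..<n} k F" using chromatic_number_le_iff[OF EF(2)] k_def by blast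
    then obtain c :: "nat \<Rightarrow> nat" where c: "\<forall>v<n. c v < k" "\<forall>u<n. \<forall>v<n. u \<noteq> v \<longrightarrow> {u, v} \<in> F \<longrightarrow> c u \<noteq> c v"
      unfolding colorable_def by auto
    have "(c(i := k)) u \<noteq> (c(i := k)) v" if uv: "u < n" "v < n" "u \<noteq> v" "{u, v} \<in> E" for u v
    proof (cases "u = i \<or> v = i")
      case True
      then show ?thesis using c uv by (auto simp: nat_neq_iff)
    next
      case False
      then have "{u, v} \<notin> X i" by (auto simp: X_def max_def split: if_splits)
      then have "{u, v} \<in> F" using uv eq by blast
      then show ?thesis using c uv False by auto
    qed
    moreover have "(c(i := k)) v < k + 1" if "v < n" for v using c that by (auto simp: less_Suc_eq)
    ultimately have "colorable {..<n} (k + 1) E"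
      unfolding colorable_def by (intro exI[of _ "c(i := k)"]) (meson lessThan_iff)
    then show ?thesis using chromatic_number_le_iff[OF EF(1)] k_def by blast
  qed
  have lip': "\<bar>f E - f F\<bar> \<le> 1" if "E \<subseteq> ?U" "F \<subseteq> ?U" "E - X i = F - X i" for i E F
    using lip[OF that] lip[OF that(2,1) that(3)[symmetric]] by (simp add: f_def abs_le_iff)
  have tail: "av ?U (\<lambda>E. of_bool (l * (f E - av ?U f) \<ge> t)) \<le> exp (l\<^sup>2 * n - t)" if "\<bar>l\<bar> \<le> 1" for l t
    by (rule Azuma_tail) (use that lip' in \<open>auto simp: X_def\<close>)
  define M where "M = av ?U f"
  have M: "M - k \<le> 2 * sqrt (n * s)"
  proof -
    \<comment> \<open>With l^2 n = s the tail bound reads exp (- s) <= exp (s - l (M - k)); the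
      hypothesis \<open>s \<le> real n\<close> gives \<open>l \<le> 1\<close>.\<close>
    define l where "l = sqrt (s / n)"
    have l: "0 < l" "l \<le> 1" "l\<^sup>2 * n = s" using assms n by (auto simp: l_def)
    have "exp (- s) \<le> av ?U (\<lambda>E. of_bool (colorable {..<n} k E))" using assms(1) by (simp add: cp_def U)
    also have "\<dots> \<le> av ?U (\<lambda>E. of_bool ((-l) * (f E - M) \<ge> l * (M - k)))"
    proof (rule av_mono)
      fix E assume "E \<subseteq> ?U"
    then have E: "E \<subseteq> edges_in {..<n}" using U by simp
      have "l * (M - k) \<le> (-l) * (f E - M)" if "colorable {..<n} k E"
      proof -
        have "chromatic_number n E \<le> k" using that chromatic_number_le_iff[OF E] by simp
        then have "l * (M - k) \<le> l * (M - f E)" using l by (intro mult_left_mono) (auto simp: f_def)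
        then show ?thesis by (simp add: algebra_simps)
      qed
      then show "of_bool (colorable {..<n} k E) \<le> (of_bool ((-l) * (f E - M) \<ge> l * (M - k)) :: real)" by auto
    qed
    also have "\<dots> \<le> exp ((-l)\<^sup>2 * n - l * (M - k))" unfolding M_def by (rule tail) (use l in auto)
    finally have "l * (M - k) \<le> 2 * s" using l by simp
    also have "\<dots> = l * (2 * (l * n))" using l by (simp add: power2_eq_square algebra_simps)
    finally have "M - k \<le> 2 * (l * n)" using l by simp
    also have "l * n = sqrt (n * s)"
    proof -
      have "(l * n)\<^sup>2 = n * s" using l by (simp add: power_mult_distrib power2_eq_square algebra_simps)
      then show ?thesis using l n by (metis real_sqrt_abs abs_of_pos mult_pos_pos)
    qed
    finally show ?thesis .
  qed
  define l where "l = 1 / sqrt n"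
  have l: "0 < l" "l \<le> 1" "l\<^sup>2 * n = 1" "l * sqrt n = 1"
    using n by (auto simp: l_def power_divide)
  have "av ?U (\<lambda>E. of_bool (\<not> colorable {..<n} (k + m) E)) \<le> av ?U (\<lambda>E. of_bool (l * (f E - M) \<ge> 2))"
  proof (rule av_mono)
    fix E assume "E \<subseteq> ?U"
    then have E: "E \<subseteq> edges_in {..<n}" using U by simp
    have "2 \<le> l * (f E - M)" if "\<not> colorable {..<n} (k + m) E"
    proof -
      have "\<not> chromatic_number n E \<le> k + m" using that chromatic_number_le_iff[OF E] by simp
      then have "2 * sqrt n \<le> f E - M" using M assms(4) by (simp add: f_def)
      then have "l * (2 * sqrt n) \<le> l * (f E - M)" using l by (intro mult_left_mono) auto
      then show ?thesis using l(4) by simp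
    qed
    then show "of_bool (\<not> colorable {..<n} (k + m) E) \<le> (of_bool (l * (f E - M) \<ge> 2) :: real)" by auto
  qed
  also have "\<dots> \<le> exp (l\<^sup>2 * n - 2)" unfolding M_def by (rule tail) (use l in auto)
  also have "\<dots> \<le> 1 / 2"
  proof -
    have "exp (1::real) \<ge> 2" using exp_ge_add_one_self[of 1] by simp
    then show ?thesis using l(3) by (simp add: exp_minus field_simps)
  qed
  finally have 1: "av ?U (\<lambda>E. of_bool (\<not> colorable {..<n} (k + m) E)) \<le> 1 / 2" .
  have "av ?U (\<lambda>E. of_bool (\<not> colorable {..<n} (k + m) E)) = av ?U (\<lambda>E. 1 - of_bool (colorable {..<n} (k + m) E))"
    by (intro av_cong) auto
  also have "\<dots> = 1 - cp n (k + m)" by (simp add: av_diff cp_def U)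
  finally show ?thesis using 1 by simp
qed

section \<open>Falling factorials\<close>

text \<open>The falling factorial, the number of injections of an \<open>m\<close>-set into an
  \<open>n\<close>-set. As a product over the reals it vanishes for \<open>n < m\<close>, because
  the factor with \<open>i = n\<close> is 0.\<close>

definition ff :: "nat \<Rightarrow> nat \<Rightarrow> real" where
  "ff n m = (\<Prod>i<m. real n - real i)"

lemma ff_0 [simp]: "ff n 0 = 1"
  by (simp add: ff_def)

lemma ff_Suc: "ff n (Suc m) = ff n m * (real n - real m)"
  by (simp add: ff_def)

lemma ff_pos: "m \<le> n \<Longrightarrow> 0 < ff n m"
  unfolding ff_def by (intro prod_pos) auto

lemma ff_eq_0: "n < m \<Longrightarrow> ff n m = 0"
  unfolding ff_def by (rule prod_zero) (auto intro!: bexI[of _ n])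

lemma ff_nonneg [simp]: "0 \<le> ff n m"
  by (cases "m \<le> n") (auto simp: ff_pos less_imp_le ff_eq_0 not_le)

lemma ff_le_power: "ff n m \<le> real n ^ m"
proof (cases "m \<le> n")
  case True
  then have "ff n m \<le> (\<Prod>i<m. real n)" unfolding ff_def by (intro prod_mono) auto
  then show ?thesis by simp
qed (simp add: ff_eq_0)

lemma ff_add: "ff n (m + l) = ff n m * ff (n - m) l" if "m \<le> n"
  using that by (induction l) (simp_all add: ff_Suc of_nat_diff algebra_simps)

lemma ff_add_le: "ff n (m + l) \<le> ff n m * ff n l"
proof (cases "m + l \<le> n")
  case True
  then have "ff (n - m) l \<le> ff n l" unfolding ff_def by (intro prod_mono) auto
  then show ?thesis using True by (simp add: ff_add mult_left_mono)
qed (simp add: ff_eq_0)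

lemma ff_sum_le: "finite A \<Longrightarrow> ff n (\<Sum>x\<in>A. f x) \<le> (\<Prod>x\<in>A. ff n (f x))"
proof (induction A rule: finite_induct)
  case (insert x A)
  have "ff n (f x + (\<Sum>x\<in>A. f x)) \<le> ff n (f x) * ff n (\<Sum>x\<in>A. f x)" by (rule ff_add_le)
  also have "\<dots> \<le> ff n (f x) * (\<Prod>x\<in>A. ff n (f x))" using insert.IH by (intro mult_left_mono) auto
  finally show ?case using insert by simp
qed simp

lemma ff_fact: "m \<le> n \<Longrightarrow> ff n m = fact n / fact (n - m)"
proof (induction m)
  case (Suc m)
  then have "fact (n - m) = real (n - m) * fact (n - Suc m)"
    by (metis Suc_diff_Suc Suc_le_eq fact_Suc of_nat_fact of_nat_mult)
  moreover have "real (n - m) = real n - real m" "real n - real m \<noteq> 0" using Suc.prems by auto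
  ultimately show ?case using Suc by (simp add: ff_Suc)
qed simp

lemma ff_ge_fact: "m \<le> n \<Longrightarrow> fact m \<le> ff n m"
proof -
  assume "m \<le> n"
  have "fact m = (\<Prod>i<m. real m - real i)"
    using ff_fact[of m m] by (simp add: ff_def)
  also have "\<dots> \<le> ff n m" unfolding ff_def using \<open>m \<le> n\<close> by (intro prod_mono) auto
  finally show ?thesis .
qed

section \<open>Colourings with prescribed class sizes\<close>

definition cls :: "nat \<Rightarrow> (nat \<Rightarrow> nat) \<Rightarrow> nat \<Rightarrow> nat set" where
  "cls n c j = {v. v < n \<and> c v = j}"

text \<open>Classes \<open>j < k\<close> have the prescribed size \<open>u j\<close>; the value \<open>k\<close> marks the vertices
  left over.\<close>

definition cols :: "nat \<Rightarrow> nat \<Rightarrow> (nat \<Rightarrow> nat) \<Rightarrow> (nat \<Rightarrow> nat) set" where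
  "cols n k u = {c \<in> {..<n} \<rightarrow>\<^sub>E {..k}. \<forall>j<k. card (cls n c j) = u j}"

lemma finite_cls [simp]: "finite (cls n c j)"
  by (simp add: cls_def)

lemma cls_subset: "cls n c j \<subseteq> {..<n}"
  by (auto simp: cls_def)

lemma cls_disjoint: "i \<noteq> j \<Longrightarrow> cls n c i \<inter> cls n c j = {}"
  by (auto simp: cls_def)

lemma finite_cols [simp]: "finite (cols n k u)"
  by (rule finite_subset[of _ "{..<n} \<rightarrow>\<^sub>E {..k}"]) (auto simp: cols_def intro: finite_PiE)

lemma card_cls_rest:
  assumes "c \<in> cols n k u"
  shows "card (cls n c k) + (\<Sum>j<k. u j) = n"
proof -
  have "{..<n} = (\<Union>j\<in>{..k}. cls n c j)" using assms by (auto simp: cols_def cls_def)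
  then have "n = card (\<Union>j\<in>{..k}. cls n c j)" by (metis card_lessThan)
  also have "\<dots> = (\<Sum>j\<in>{..k}. card (cls n c j))"
    by (rule card_UN_disjoint) (auto simp: cls_def)
  also have "\<dots> = card (cls n c k) + (\<Sum>j<k. card (cls n c j))"
    by (simp add: lessThan_Suc_atMost[symmetric])
  also have "(\<Sum>j<k. card (cls n c j)) = (\<Sum>j<k. u j)" using assms by (simp add: cols_def)
  finally show ?thesis by simp
qed

lemma cols_nonempty:
  assumes "(\<Sum>j<k. u j) \<le> n"
  shows "cols n k u \<noteq> {}"
  using assms
proof (induction k)
  case 0
  have "(\<lambda>v\<in>{..<n}. 0) \<in> cols n 0 u" by (auto simp: cols_def)
  then show ?case by blast
next
  case (Suc k)
  then obtain c where c: "c \<in> cols n k u" by auto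
  have "u k \<le> card (cls n c k)" using card_cls_rest[OF c] Suc.prems by simp
  then obtain B where B: "B \<subseteq> cls n c k" "card B = u k" by (rule obtain_subset_with_card_n)
  define c' where "c' v = (if v \<in> cls n c k - B then Suc k else c v)" for v
  have "cls n c' k = B" using B by (auto simp: c'_def cls_def split: if_splits)
  moreover have "cls n c' j = cls n c j" if "j < k" for j
    using B that by (auto simp: c'_def cls_def split: if_splits)
  moreover have "c' \<in> {..<n} \<rightarrow>\<^sub>E {..Suc k}"
    using c B by (auto simp: c'_def cols_def cls_def PiE_def Pi_def extensional_def le_Suc_eq)
  ultimately have "c' \<in> cols n (Suc k) u" using c B by (auto simp: cols_def less_Suc_eq)
  then show ?case by blast
qed

definition class_edges :: "nat \<Rightarrow> nat \<Rightarrow> (nat \<Rightarrow> nat) \<Rightarrow> nat set set" where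
  "class_edges n k c = (\<Union>j<k. edges_in (cls n c j))"

text \<open>The probability that the classes of \<open>c\<close> and of \<open>c'\<close> are all
  independent is this factor times the product of the two separate probabilities: each pair of
  vertices lying in a common class of both is counted only once. The product form allows an
  expansion over pairs of classes.\<close>

definition overlap_weight :: "nat \<Rightarrow> nat \<Rightarrow> (nat \<Rightarrow> nat) \<Rightarrow> (nat \<Rightarrow> nat) \<Rightarrow> real" where
  "overlap_weight n k c c' =
     (\<Prod>p\<in>{..<k} \<times> {..<k}. 2 ^ (card (cls n c (fst p) \<inter> cls n c' (snd p)) choose 2))"

lemma overlap_weight_eq: "overlap_weight n k c c' = 2 ^ card (class_edges n k c \<inter> class_edges n k c')"
proof -
  let ?K = "{..<k} \<times> {..<k}" and ?e = "\<lambda>p. edges_in (cls n c (fst p) \<inter> cls n c' (snd p))"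
  have "class_edges n k c \<inter> class_edges n k c' = (\<Union>p\<in>?K. ?e p)"
    by (auto simp: class_edges_def edges_in_Int)
  moreover have "card (\<Union>p\<in>?K. ?e p) = (\<Sum>p\<in>?K. card (?e p))"
  proof (rule card_UN_disjoint)
    show "\<forall>p\<in>?K. \<forall>q\<in>?K. p \<noteq> q \<longrightarrow> ?e p \<inter> ?e q = {}"
    proof (intro ballI impI edges_in_disjoint)
      fix p q :: "nat \<times> nat" assume "p \<noteq> q"
      then have "fst p \<noteq> fst q \<or> snd p \<noteq> snd q" by (simp add: prod_eq_iff)
      then show "cls n c (fst p) \<inter> cls n c' (snd p) \<inter> (cls n c (fst q) \<inter> cls n c' (snd q)) = {}"
        using cls_disjoint[of "fst p" "fst q" n c] cls_disjoint[of "snd p" "snd q" n c'] by blast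
    qed
  qed auto
  ultimately show ?thesis
    by (simp add: overlap_weight_def card_edges_in power_sum)
qed

lemma card_class_edges:
  assumes "c \<in> cols n k u"
  shows "card (class_edges n k c) = (\<Sum>j<k. u j choose 2)"
proof -
  have "card (class_edges n k c) = (\<Sum>j<k. card (edges_in (cls n c j)))"
    unfolding class_edges_def
    by (rule card_UN_disjoint) (auto intro!: edges_in_disjoint cls_disjoint simp del: edges_in_Int)
  also have "\<dots> = (\<Sum>j<k. u j choose 2)" using assms by (simp add: card_edges_in cols_def)
  finally show ?thesis .
qed

lemma class_edges_subset: "class_edges n k c \<subseteq> edges_in {..<n}"
  unfolding class_edges_def by (intro UN_least edges_in_mono cls_subset)

text \<open>The random variable \<open>X\<close> counts the partial colourings with sizes
  \<open>u\<close> whose remaining vertices can be coloured with \<open>f\<close> colours. The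
  condition on the rest involves other edges than the classes, so in the mean it contributes the
  factor \<open>p\<close>; in the second moment its indicators are bounded by 1, which is why
  \<open>p\<close> appears squared on the left.\<close>

lemma cp_second_moment:
  fixes S :: real
  assumes sum: "(\<Sum>j<k. u j) \<le> n"
    and S: "\<And>c. c \<in> cols n k u \<Longrightarrow> (\<Sum>c'\<in>cols n k u. overlap_weight n k c c') \<le> S * card (cols n k u)"
  shows "(cp (n - (\<Sum>j<k. u j)) f)\<^sup>2 \<le> S * cp n (f + k)"
proof -
  let ?Z = "edges_in {..<n}" and ?C = "cols n k u" and ?I = "class_edges n k"
  define m where "m = (\<Sum>j<k. u j choose 2)"
  define p where "p = cp (n - (\<Sum>j<k. u j)) f"
  define N where "N = real (card ?C)"
  have N: "0 < N" using cols_nonempty[OF sum] by (simp add: N_def card_gt_0_iff)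
  have finI: "finite (?I c)" for c by (rule finite_subset[OF class_edges_subset]) simp
  have cardI: "card (?I c) = m" if "c \<in> ?C" for c
    using card_class_edges[OF that] by (simp add: m_def)
  define X where "X E = (\<Sum>c\<in>?C. of_bool (E \<inter> ?I c = {}) * of_bool (colorable (cls n c k) f E) :: real)" for E
  have mean: "av ?Z X = N * p / 2 ^ m"
  proof -
    have "av ?Z (\<lambda>E. of_bool (E \<inter> ?I c = {}) * of_bool (colorable (cls n c k) f E)) = p / 2 ^ m"
      if c: "c \<in> ?C" for c
    proof -
      let ?R = "edges_in (cls n c k)"
      have "edges_in (cls n c j) \<inter> ?R = {}" if "j < k" for j
        by (intro edges_in_disjoint cls_disjoint) (use that in auto)
      then have dis: "?I c \<inter> ?R = {}" unfolding class_edges_def by blast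
      have "av ?Z (\<lambda>E. of_bool (E \<inter> ?I c = {}) * of_bool (colorable (cls n c k) f E))
          = av ?Z (\<lambda>E. (\<lambda>F. of_bool (F = {})) (E \<inter> ?I c) * (\<lambda>F. of_bool (colorable (cls n c k) f F)) (E \<inter> ?R))"
        by (simp add: colorable_restrict)
      also have "\<dots> = av (?I c) (\<lambda>F. of_bool (F = {})) * av ?R (\<lambda>F. of_bool (colorable (cls n c k) f F))"
        by (rule av_indep[OF _ class_edges_subset edges_in_mono[OF cls_subset] dis]) simp
      also have "av (?I c) (\<lambda>F. of_bool (F = {})) = av (?I c) (\<lambda>F. of_bool (F \<inter> ?I c = {}))"
        by (intro av_cong) (auto simp: Int_absorb2)
      also have "\<dots> = 1 / 2 ^ m" using av_avoid[OF finI subset_refl] cardI[OF c] by simp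
      also have "av ?R (\<lambda>F. of_bool (colorable (cls n c k) f F)) = p"
      proof -
        have "card (cls n c k) = n - (\<Sum>j<k. u j)" using card_cls_rest[OF c] by simp
        then show ?thesis using av_colorable[of "cls n c k" f] by (simp add: p_def)
      qed
      finally show ?thesis by simp
    qed
    then have "(\<Sum>c\<in>?C. av ?Z (\<lambda>E. of_bool (E \<inter> ?I c = {}) * of_bool (colorable (cls n c k) f E))) = (\<Sum>c\<in>?C. p / 2 ^ m)"
      by (rule sum.cong[OF refl])
    then show ?thesis unfolding X_def av_sum by (simp add: N_def)
  qed
  have var: "av ?Z (\<lambda>E. (X E)\<^sup>2) \<le> S * N\<^sup>2 / 4 ^ m"
  proof -
    have "av ?Z (\<lambda>E. (X E)\<^sup>2) \<le> av ?Z (\<lambda>E. \<Sum>c\<in>?C. \<Sum>c'\<in>?C. of_bool (E \<inter> (?I c \<union> ?I c') = {}))"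
    proof (rule av_mono)
      fix E
      have "(X E)\<^sup>2 = (\<Sum>c\<in>?C. \<Sum>c'\<in>?C. (of_bool (E \<inter> ?I c = {}) * of_bool (colorable (cls n c k) f E))
          * (of_bool (E \<inter> ?I c' = {}) * of_bool (colorable (cls n c' k) f E)))"
        by (simp only: X_def power2_eq_square sum_product)
      also have "\<dots> \<le> (\<Sum>c\<in>?C. \<Sum>c'\<in>?C. of_bool (E \<inter> (?I c \<union> ?I c') = {}))"
        by (intro sum_mono) (auto simp: Int_Un_distrib)
      finally show "(X E)\<^sup>2 \<le> (\<Sum>c\<in>?C. \<Sum>c'\<in>?C. of_bool (E \<inter> (?I c \<union> ?I c') = {}))" .
    qed
    also have "\<dots> = (\<Sum>c\<in>?C. \<Sum>c'\<in>?C. av ?Z (\<lambda>E. of_bool (E \<inter> (?I c \<union> ?I c') = {})))"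
      by (simp only: av_sum)
    also have "\<dots> = (\<Sum>c\<in>?C. \<Sum>c'\<in>?C. overlap_weight n k c c' / 4 ^ m)"
    proof (intro sum.cong refl)
      fix c c' assume cc: "c \<in> ?C" "c' \<in> ?C"
      have "card (?I c \<union> ?I c') + card (?I c \<inter> ?I c') = 2 * m"
        using card_Un_Int[OF finI finI, of c c'] cardI cc by simp
      then have "(2::real) ^ card (?I c \<union> ?I c') * 2 ^ card (?I c \<inter> ?I c') = 2 ^ (2 * m)"
        by (simp add: power_add[symmetric])
      also have "\<dots> = 4 ^ m" by (simp add: power_mult)
      finally have "(2::real) ^ card (?I c \<union> ?I c') * 2 ^ card (?I c \<inter> ?I c') = 4 ^ m" .
      then have "1 / 2 ^ card (?I c \<union> ?I c') = overlap_weight n k c c' / 4 ^ m"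
        by (simp add: overlap_weight_eq field_simps)
      then show "av ?Z (\<lambda>E. of_bool (E \<inter> (?I c \<union> ?I c') = {})) = overlap_weight n k c c' / 4 ^ m"
        by (subst av_avoid) (simp_all add: class_edges_subset)
    qed
    also have "\<dots> = (\<Sum>c\<in>?C. (\<Sum>c'\<in>?C. overlap_weight n k c c') / 4 ^ m)"
      by (simp add: sum_divide_distrib)
    also have "\<dots> \<le> (\<Sum>c\<in>?C. S * N / 4 ^ m)"
      using S by (intro sum_mono divide_right_mono) (auto simp: N_def)
    also have "\<dots> = S * N\<^sup>2 / 4 ^ m" by (simp add: N_def power2_eq_square)
    finally show ?thesis .
  qed
  have pos: "av ?Z (\<lambda>E. of_bool (X E > 0)) \<le> cp n (f + k)" unfolding cp_def
  proof (rule av_mono)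
    fix E
    have "colorable {..<n} (f + k) E" if "X E > 0"
    proof -
      have "\<exists>c\<in>?C. E \<inter> ?I c = {} \<and> colorable (cls n c k) f E"
      proof (rule ccontr)
        assume "\<not> (\<exists>c\<in>?C. E \<inter> ?I c = {} \<and> colorable (cls n c k) f E)"
        then have "X E = 0" unfolding X_def by (intro sum.neutral) auto
        then show False using \<open>X E > 0\<close> by simp
      qed
      then obtain c where c: "c \<in> ?C" "E \<inter> ?I c = {}" "colorable (cls n c k) f E" by blast
      obtain h where h: "\<forall>v\<in>cls n c k. h v < f" "\<forall>u\<in>cls n c k. \<forall>v\<in>cls n c k. u \<noteq> v \<longrightarrow> {u, v} \<in> E \<longrightarrow> h u \<noteq> h v"
        using c(3) unfolding colorable_def by blast
      have ck: "c v \<le> k" if "v < n" for v using c(1) that by (auto simp: cols_def)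
      have rest: "v \<in> cls n c k" if "v < n" "\<not> c v < k" for v
        using ck[OF that(1)] that by (auto simp: cls_def)
      define g where "g v = (if c v < k then f + c v else h v)" for v
      have "g v < f + k" if "v < n" for v
        using h(1) rest[OF that] by (cases "c v < k") (auto simp: g_def trans_less_add1)
      moreover have "g u \<noteq> g v" if uv: "u < n" "v < n" "u \<noteq> v" "{u, v} \<in> E" for u v
      proof (cases "c u < k")
        case True
        show ?thesis
        proof (cases "c v < k")
          case False
          then show ?thesis using True h(1) rest[OF uv(2)] by (force simp: g_def)
        next
          case True': True
          have "c u \<noteq> c v"
          proof
            assume "c u = c v"
            then have "{u, v} \<in> edges_in (cls n c (c u))" using uv by (auto simp: cls_def)
            then have "{u, v} \<in> ?I c" using True by (auto simp: class_edges_def)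
            then show False using c(2) uv by blast
          qed
          then show ?thesis using True True' by (simp add: g_def)
        qed
      next
        case False
        then have "u \<in> cls n c k" using rest uv by blast
        show ?thesis
        proof (cases "c v < k")
          case True
          then show ?thesis using False h(1) \<open>u \<in> cls n c k\<close> by (force simp: g_def)
        next
          case False': False
          then have "v \<in> cls n c k" using rest uv by blast
          then show ?thesis using h(2) uv \<open>u \<in> cls n c k\<close> False False' by (auto simp: g_def)
        qed
      qed
      ultimately show ?thesis unfolding colorable_def by (intro exI[of _ g]) auto
    qed
    then show "of_bool (X E > 0) \<le> (of_bool (colorable {..<n} (f + k) E) :: real)" by auto
  qed
  have X0: "0 \<le> X E" for E unfolding X_def by (intro sum_nonneg) auto
  have "(N * p / 2 ^ m)\<^sup>2 \<le> av ?Z (\<lambda>E. of_bool (X E > 0)) * av ?Z (\<lambda>E. (X E)\<^sup>2)"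
    using Cauchy_av[of ?Z X] X0 by (simp add: mean)
  also have "\<dots> \<le> cp n (f + k) * (S * N\<^sup>2 / 4 ^ m)"
    using pos var by (intro mult_mono cp_nonneg av_nonneg) auto
  finally have "N\<^sup>2 * p\<^sup>2 \<le> N\<^sup>2 * (S * cp n (f + k))"
  proof -
    have "((2::real) ^ m)\<^sup>2 = 4 ^ m" by (simp add: power_even_eq[symmetric] power_mult)
    moreover assume "(N * p / 2 ^ m)\<^sup>2 \<le> cp n (f + k) * (S * N\<^sup>2 / 4 ^ m)"
    ultimately show ?thesis by (simp add: power_divide power_mult_distrib field_simps)
  qed
  then show ?thesis using N by (simp add: p_def)
qed

section \<open>Counting colourings with prescribed values on a set of vertices\<close>

definition ext :: "nat \<Rightarrow> nat \<Rightarrow> (nat \<Rightarrow> nat) \<Rightarrow> nat set \<Rightarrow> (nat \<Rightarrow> nat) \<Rightarrow> (nat \<Rightarrow> nat) set" where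
  "ext n k u D \<tau> = {c \<in> cols n k u. \<forall>v\<in>D. c v = \<tau> v}"

lemma finite_ext [simp]: "finite (ext n k u D \<tau>)"
  by (simp add: ext_def)

text \<open>Double counting of pairs of an extension and a vertex outside \<open>D\<close> with
  colour \<open>\<tau> v\<close>. Transposing two vertices outside \<open>D\<close> shows that each
  of them receives this colour in equally many extensions, while a single extension has
  \<open>u (\<tau> v)\<close> such vertices minus those already in \<open>D\<close>.\<close>

lemma card_ext_insert:
  assumes "D \<subseteq> {..<n}" "v < n" "v \<notin> D" "\<tau> v < k"
  shows "real (card (ext n k u (insert v D) \<tau>)) * (real n - card D)
       = real (card (ext n k u D \<tau>)) * (real (u (\<tau> v)) - card {w \<in> D. \<tau> w = \<tau> v})"
proof -
  let ?X = "ext n k u D \<tau>" and ?j = "\<tau> v" and ?R = "{..<n} - D"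
  have finD: "finite D" using assms finite_subset by blast
  have sym: "card {c \<in> ?X. c w = ?j} = card {c \<in> ?X. c v = ?j}" if w: "w \<in> ?R" for w
  proof -
    define \<sigma> where "\<sigma> = id(v := w, w := v)"
    have \<sigma>\<sigma>: "\<sigma> (\<sigma> x) = x" for x by (simp add: \<sigma>_def)
    have \<sigma>n: "\<sigma> x < n \<longleftrightarrow> x < n" for x using assms w by (auto simp: \<sigma>_def)
    have \<sigma>D: "x \<in> D \<Longrightarrow> \<sigma> x = x" for x using assms w by (auto simp: \<sigma>_def)
    have cls\<sigma>: "cls n (c \<circ> \<sigma>) i = \<sigma> ` cls n c i" for c i
    proof (intro equalityI subsetI)
      fix x assume "x \<in> cls n (c \<circ> \<sigma>) i"
      then have "\<sigma> x \<in> cls n c i" by (auto simp: cls_def \<sigma>n)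
      then have "\<sigma> (\<sigma> x) \<in> \<sigma> ` cls n c i" by blast
      then show "x \<in> \<sigma> ` cls n c i" by (simp add: \<sigma>\<sigma>)
    qed (auto simp: cls_def \<sigma>n \<sigma>\<sigma>)
    have inj\<sigma>: "inj \<sigma>" by (metis injI \<sigma>\<sigma>)
    have mem: "c \<circ> \<sigma> \<in> ?X" if "c \<in> ?X" for c
    proof -
      have "c \<circ> \<sigma> \<in> {..<n} \<rightarrow>\<^sub>E {..k}"
      proof (rule PiE_I)
        fix x assume "x \<in> {..<n}"
        then show "(c \<circ> \<sigma>) x \<in> {..k}" using that \<sigma>n by (auto simp: ext_def cols_def)
      next
        fix x assume "x \<notin> {..<n}"
        then have "\<sigma> x \<notin> {..<n}" using \<sigma>n by simp
        then show "(c \<circ> \<sigma>) x = undefined" using that by (auto simp: ext_def cols_def PiE_def extensional_def)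
      qed
      moreover have "card (cls n (c \<circ> \<sigma>) i) = card (cls n c i)" for i
        unfolding cls\<sigma> by (rule card_image) (use inj\<sigma> in \<open>auto intro: inj_on_subset\<close>)
      ultimately show ?thesis using that \<sigma>D by (auto simp: ext_def cols_def)
    qed
    have cc: "c \<circ> \<sigma> \<circ> \<sigma> = c" for c :: "nat \<Rightarrow> nat" by (auto simp: \<sigma>\<sigma>)
    have "bij_betw (\<lambda>c. c \<circ> \<sigma>) {c \<in> ?X. c w = ?j} {c \<in> ?X. c v = ?j}"
    proof (rule bij_betw_byWitness[where f' = "\<lambda>c. c \<circ> \<sigma>"])
      have "\<sigma> v = w" "\<sigma> w = v" by (auto simp: \<sigma>_def)
      then show "(\<lambda>c. c \<circ> \<sigma>) ` {c \<in> ?X. c w = ?j} \<subseteq> {c \<in> ?X. c v = ?j}"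
        "(\<lambda>c. c \<circ> \<sigma>) ` {c \<in> ?X. c v = ?j} \<subseteq> {c \<in> ?X. c w = ?j}"
        using mem by auto
    qed (use cc in auto)
    then show ?thesis by (rule bij_betw_same_card)
  qed
  have v: "{c \<in> ?X. c v = ?j} = ext n k u (insert v D) \<tau>" by (auto simp: ext_def)
  have cnt: "card {w \<in> ?R. c w = ?j} + card {w \<in> D. \<tau> w = ?j} = u ?j" if "c \<in> ?X" for c
  proof -
    have "{w \<in> D. \<tau> w = ?j} = {w \<in> D. c w = ?j}" using that by (auto simp: ext_def)
    moreover have "card {w \<in> ?R. c w = ?j} + card {w \<in> D. c w = ?j} = card (cls n c ?j)"
    proof -
      have "cls n c ?j = {w \<in> ?R. c w = ?j} \<union> {w \<in> D. c w = ?j}" using assms by (auto simp: cls_def)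
      then show ?thesis using finD by (simp add: card_Un_disjoint disjoint_iff)
    qed
    ultimately show ?thesis using that assms by (auto simp: ext_def cols_def)
  qed
  have dc: "real (card {x \<in> A. P x}) = (\<Sum>x\<in>A. of_bool (P x))" if "finite A" for A :: "'b set" and P
    using that by (simp add: of_bool_def sum.If_cases Int_def)
  have "real (card (ext n k u (insert v D) \<tau>)) * (real n - card D) = (\<Sum>w\<in>?R. real (card {c \<in> ?X. c w = ?j}))"
  proof -
    have "card ?R = n - card D" using assms finD by (simp add: card_Diff_subset)
    moreover have "card D \<le> n" using assms card_mono[of "{..<n}" D] by simp
    ultimately show ?thesis using sym v by (simp add: of_nat_diff algebra_simps)
  qed
  also have "\<dots> = (\<Sum>w\<in>?R. \<Sum>c\<in>?X. of_bool (c w = ?j))" by (simp add: dc)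
  also have "\<dots> = (\<Sum>c\<in>?X. \<Sum>w\<in>?R. of_bool (c w = ?j))" by (rule sum.swap)
  also have "\<dots> = (\<Sum>c\<in>?X. real (card {w \<in> ?R. c w = ?j}))" by (intro sum.cong refl dc[symmetric]) simp
  also have "\<dots> = (\<Sum>c\<in>?X. real (u ?j) - card {w \<in> D. \<tau> w = ?j})"
  proof (intro sum.cong refl)
    fix c assume "c \<in> ?X"
    from cnt[OF this] show "real (card {w \<in> ?R. c w = ?j}) = real (u ?j) - card {w \<in> D. \<tau> w = ?j}"
      by linarith
  qed
  finally show ?thesis by simp
qed

text \<open>The previous identity, applied vertex by vertex. Places of a class already taken by
  vertices of \<open>D0\<close> are not subtracted, which only increases the right-hand
  side.\<close>

lemma card_ext_le:
  assumes "finite D1" "D0 \<union> D1 \<subseteq> {..<n}" "D0 \<inter> D1 = {}" "\<And>v. v \<in> D1 \<Longrightarrow> \<tau> v < k"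
  shows "card (ext n k u (D0 \<union> D1) \<tau>) * ff (n - card D0) (card D1)
       \<le> card (ext n k u D0 \<tau>) * (\<Prod>j<k. ff (u j) (card {w \<in> D1. \<tau> w = j}))"
  using assms
proof (induction D1 rule: finite_induct)
  case empty
  then show ?case by simp
next
  case (insert v D1)
  let ?D = "D0 \<union> D1" and ?j = "\<tau> v"
  let ?d = "\<lambda>D j. card {w \<in> D. \<tau> w = j}"
  have finD0: "finite D0" using insert.prems finite_subset by blast
  have IH: "card (ext n k u ?D \<tau>) * ff (n - card D0) (card D1)
       \<le> card (ext n k u D0 \<tau>) * (\<Prod>j<k. ff (u j) (?d D1 j))"
    using insert.prems by (intro insert.IH) auto
  have cD0: "card D0 \<le> n" using insert.prems card_mono[of "{..<n}" D0] by simp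
  have cD: "card ?D = card D0 + card D1" using insert finD0 by (intro card_Un_disjoint) auto
  have jk: "?j < k" using insert.prems by auto
  have prod: "(\<Prod>j<k. ff (u j) (?d (insert v D1) j)) = (\<Prod>j<k. ff (u j) (?d D1 j)) * (real (u ?j) - ?d D1 ?j)"
  proof -
    have e: "{w \<in> insert v D1. \<tau> w = j} = (if j = ?j then insert v {w \<in> D1. \<tau> w = j} else {w \<in> D1. \<tau> w = j})" for j
      by auto
    have 1: "?d (insert v D1) ?j = Suc (?d D1 ?j)" unfolding e using insert.hyps by simp
    have 2: "?d (insert v D1) j = ?d D1 j" if "j \<noteq> ?j" for j unfolding e using that by simp
    have "(\<Prod>j<k. ff (u j) (?d (insert v D1) j)) = ff (u ?j) (?d (insert v D1) ?j) * (\<Prod>j\<in>{..<k}-{?j}. ff (u j) (?d (insert v D1) j))"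
      using jk by (intro prod.remove) auto
    also have "(\<Prod>j\<in>{..<k}-{?j}. ff (u j) (?d (insert v D1) j)) = (\<Prod>j\<in>{..<k}-{?j}. ff (u j) (?d D1 j))"
      by (rule prod.cong[OF refl], subst 2) auto
    also have "ff (u ?j) (?d (insert v D1) ?j) = (real (u ?j) - ?d D1 ?j) * ff (u ?j) (?d D1 ?j)"
      unfolding 1 by (simp add: ff_Suc)
    finally show ?thesis using jk by (subst (2) prod.remove[of _ ?j]) auto
  qed
  show ?case
  proof (cases "ext n k u (D0 \<union> insert v D1) \<tau> = {}")
    case True
    then show ?thesis by (simp add: prod_nonneg)
  next
    case False
    \<comment> \<open>An existing extension shows that the class still has room, so the new factor
      is nonnegative and the induction hypothesis may be multiplied by it.\<close>
    then obtain c where c: "c \<in> cols n k u" "\<forall>w\<in>D0 \<union> insert v D1. c w = \<tau> w" by (auto simp: ext_def)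
    have "{w \<in> D1. \<tau> w = ?j} \<subseteq> cls n c ?j" using c insert.prems by (auto simp: cls_def)
    then have "?d D1 ?j \<le> card (cls n c ?j)" by (rule card_mono[OF finite_cls])
    then have "?d D1 ?j \<le> u ?j" using c(1) jk by (simp add: cols_def)
    then have nn: "0 \<le> real (u ?j) - ?d D1 ?j" by simp
    have dd: "?d D1 ?j \<le> ?d ?D ?j" using insert.hyps finD0 by (intro card_mono) auto
    have "card (ext n k u (D0 \<union> insert v D1) \<tau>) * ff (n - card D0) (card (insert v D1))
        = (card (ext n k u (insert v ?D) \<tau>) * (real n - card ?D)) * ff (n - card D0) (card D1)"
      using insert.hyps cD0 by (simp add: ff_Suc cD of_nat_diff algebra_simps)
    also have "\<dots> = (card (ext n k u ?D \<tau>) * (real (u ?j) - ?d ?D ?j)) * ff (n - card D0) (card D1)"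
      using insert.prems insert.hyps by (subst card_ext_insert) auto
    also have "\<dots> \<le> (card (ext n k u ?D \<tau>) * (real (u ?j) - ?d D1 ?j)) * ff (n - card D0) (card D1)"
      using dd by (intro mult_right_mono mult_left_mono) auto
    also have "\<dots> = (card (ext n k u ?D \<tau>) * ff (n - card D0) (card D1)) * (real (u ?j) - ?d D1 ?j)"
      by simp
    also have "\<dots> \<le> (card (ext n k u D0 \<tau>) * (\<Prod>j<k. ff (u j) (?d D1 j))) * (real (u ?j) - ?d D1 ?j)"
      using IH nn by (rule mult_right_mono)
    finally show ?thesis unfolding prod by (simp only: mult.assoc)
  qed
qed

section \<open>Overlaps of two colourings\<close>

text \<open>After the product is expanded, a choice \<open>h\<close> of one set for each pair
  prescribes \<open>c'\<close> on the union \<open>D1\<close> of these sets, and the extension bound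
  applies. Its denominator \<open>ff (n - card D0) (card D1)\<close> does not factorise;
  \<open>C0\<close> and \<open>x\<close> replace it by a power with one factor per vertex, after
  which the sum becomes a product over pairs again.\<close>

lemma overlap_sum:
  fixes x C0 :: real
  assumes c: "c \<in> cols n k u" and D0: "D0 \<subseteq> {..<n}"
    and P: "finite P" "P \<subseteq> {..<k} \<times> {..<k}"
    and finF: "\<And>p. p \<in> P \<Longrightarrow> finite (F p)"
    and F: "\<And>p T. p \<in> P \<Longrightarrow> T \<in> F p \<Longrightarrow> T \<subseteq> cls n c (fst p) - D0"
    and w: "\<And>T. 0 \<le> w T" and x: "0 \<le> x" "0 \<le> C0"
    and C0: "\<And>t. t \<le> n - card D0 \<Longrightarrow> t \<le> (\<Sum>j<k. u j) \<Longrightarrow> 1 \<le> C0 * x ^ t * ff (n - card D0) t"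
  shows "(\<Sum>c'\<in>ext n k u D0 \<tau>. \<Prod>p\<in>P. \<Sum>T\<in>F p. of_bool (T \<subseteq> cls n c' (snd p)) * w T)
     \<le> card (ext n k u D0 \<tau>) * C0 * (\<Prod>p\<in>P. \<Sum>T\<in>F p. w T * ff (u (snd p)) (card T) * x ^ card T)"
proof -
  let ?N = "ext n k u D0 \<tau>"
  let ?A = "\<lambda>h. {c' \<in> ?N. \<forall>p\<in>P. h p \<subseteq> cls n c' (snd p)}"
  have main: "real (card (?A h)) \<le> card ?N * C0 * (\<Prod>p\<in>P. ff (u (snd p)) (card (h p)) * x ^ card (h p))"
    if h: "h \<in> PiE P F" for h
  proof (cases "?A h = {}")
    case True
    have "0 \<le> card ?N * C0 * (\<Prod>p\<in>P. ff (u (snd p)) (card (h p)) * x ^ card (h p))"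
      using x by (intro mult_nonneg_nonneg prod_nonneg) auto
    then show ?thesis unfolding True by simp
  next
    case False
    \<comment> \<open>Any colouring \<open>c1\<close> realising \<open>h\<close> serves as the
      template of the values on \<open>D1\<close>. Together with \<open>c\<close> it also shows that
      the sets \<open>h p\<close> are disjoint, as distinct pairs differ in a class of
      \<open>c\<close> or in a class of \<open>c1\<close>.\<close>
    then obtain c1 where c1: "c1 \<in> ?N" "\<And>p. p \<in> P \<Longrightarrow> h p \<subseteq> cls n c1 (snd p)" by blast
    define D1 where "D1 = (\<Union>p\<in>P. h p)"
    have hA: "h p \<subseteq> cls n c (fst p) - D0" if "p \<in> P" for p
      by (rule F[OF that PiE_mem[OF h that]])
    have finh: "finite (h p)" if "p \<in> P" for p
      using finite_subset[OF hA[OF that]] by simp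
    have dis: "h p \<inter> h q = {}" if "p \<in> P" "q \<in> P" "p \<noteq> q" for p q
    proof -
      have "fst p \<noteq> fst q \<or> snd p \<noteq> snd q" using that(3) by (simp add: prod_eq_iff)
      then have "cls n c (fst p) \<inter> cls n c (fst q) = {} \<or> cls n c1 (snd p) \<inter> cls n c1 (snd q) = {}"
        using cls_disjoint by blast
      moreover have "h p \<subseteq> cls n c (fst p)" "h q \<subseteq> cls n c (fst q)" using hA that by blast+
      moreover have "h p \<subseteq> cls n c1 (snd p)" "h q \<subseteq> cls n c1 (snd q)" using c1(2) that by blast+
      ultimately show ?thesis by blast
    qed
    have card_UN: "card (\<Union>p\<in>Q. h p) = (\<Sum>p\<in>Q. card (h p))" if "Q \<subseteq> P" for Q
    proof (rule card_UN_disjoint)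
      show "finite Q" using that P(1) finite_subset by blast
      show "\<forall>p\<in>Q. finite (h p)" using that finh by blast
      show "\<forall>p\<in>Q. \<forall>q\<in>Q. p \<noteq> q \<longrightarrow> h p \<inter> h q = {}" using that dis by blast
    qed
    have D1n: "D1 \<subseteq> (\<Union>j<k. cls n c j)" using hA P(2) by (fastforce simp: D1_def)
    have finD1: "finite D1" using P(1) finh by (auto simp: D1_def)
    have D1k: "card D1 \<le> (\<Sum>j<k. u j)"
    proof -
      have "card D1 \<le> card (\<Union>j<k. cls n c j)" using D1n by (intro card_mono) auto
      also have "\<dots> \<le> (\<Sum>j<k. card (cls n c j))" by (rule card_UN_le) simp
      also have "\<dots> = (\<Sum>j<k. u j)" using c by (simp add: cols_def)
      finally show ?thesis .
    qed
    have D1n': "D1 \<subseteq> {..<n}" using D1n cls_subset[of n c] by blast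
    have D01: "D0 \<inter> D1 = {}" using hA by (auto simp: D1_def)
    have finD0: "finite D0" using D0 finite_subset by blast
    have "card D0 + card D1 = card (D0 \<union> D1)" using D01 finD0 finD1 by (simp add: card_Un_disjoint)
    also have "\<dots> \<le> n" using D0 D1n' card_mono[of "{..<n}" "D0 \<union> D1"] by simp
    finally have D1c: "card D1 \<le> n - card D0" by simp
    have c1k: "c1 v < k" if "v \<in> D1" for v
      using that c1(2) P(2) by (fastforce simp: D1_def cls_def)
    have sub: "?A h \<subseteq> ext n k u (D0 \<union> D1) c1"
    proof
      fix c' assume c': "c' \<in> ?A h"
      have "c' v = c1 v" if "v \<in> D1" for v
      proof -
        obtain p where "p \<in> P" "v \<in> h p" using \<open>v \<in> D1\<close> by (auto simp: D1_def)
        then have "v \<in> cls n c' (snd p)" "v \<in> cls n c1 (snd p)" using c' c1(2) by blast+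
        then show ?thesis by (simp add: cls_def)
      qed
      then show "c' \<in> ext n k u (D0 \<union> D1) c1" using c' c1(1) by (auto simp: ext_def)
    qed
    have eqN: "ext n k u D0 c1 = ?N" using c1(1) by (auto simp: ext_def)
    have prod_le: "(\<Prod>j<k. ff (u j) (card {v \<in> D1. c1 v = j})) \<le> (\<Prod>p\<in>P. ff (u (snd p)) (card (h p)))"
    proof -
      have "(\<Prod>j<k. ff (u j) (card {v \<in> D1. c1 v = j})) \<le> (\<Prod>j<k. \<Prod>p\<in>{p \<in> P. snd p = j}. ff (u (snd p)) (card (h p)))"
      proof (intro prod_mono conjI ff_nonneg)
        fix j
        have "{v \<in> D1. c1 v = j} = (\<Union>p\<in>{p \<in> P. snd p = j}. h p)"
          using c1(2) by (fastforce simp: D1_def cls_def)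
        then have "card {v \<in> D1. c1 v = j} = (\<Sum>p\<in>{p \<in> P. snd p = j}. card (h p))" by (simp add: card_UN)
        then have "ff (u j) (card {v \<in> D1. c1 v = j}) \<le> (\<Prod>p\<in>{p \<in> P. snd p = j}. ff (u j) (card (h p)))"
          using ff_sum_le[of "{p \<in> P. snd p = j}" "u j" "\<lambda>p. card (h p)"] P(1) by simp
        also have "\<dots> = (\<Prod>p\<in>{p \<in> P. snd p = j}. ff (u (snd p)) (card (h p)))" by (intro prod.cong) auto
        finally show "ff (u j) (card {v \<in> D1. c1 v = j}) \<le> (\<Prod>p\<in>{p \<in> P. snd p = j}. ff (u (snd p)) (card (h p)))" .
      qed
      also have "\<dots> = (\<Prod>p\<in>P. ff (u (snd p)) (card (h p)))"
        using P by (intro prod.group) auto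
      finally show ?thesis .
    qed
    have cardD1: "card D1 = (\<Sum>p\<in>P. card (h p))" unfolding D1_def by (rule card_UN) simp
    have "real (card (?A h)) \<le> card (ext n k u (D0 \<union> D1) c1)"
      using card_mono[OF finite_ext sub] by simp
    also have "\<dots> = real (card (ext n k u (D0 \<union> D1) c1)) * 1" by simp
    also have "\<dots> \<le> card (ext n k u (D0 \<union> D1) c1) * (C0 * x ^ card D1 * ff (n - card D0) (card D1))"
      using C0[OF D1c D1k] by (intro mult_left_mono) auto
    also have "\<dots> = C0 * x ^ card D1 * (card (ext n k u (D0 \<union> D1) c1) * ff (n - card D0) (card D1))"
      by simp
    also have "\<dots> \<le> C0 * x ^ card D1 * (card (ext n k u D0 c1) * (\<Prod>j<k. ff (u j) (card {v \<in> D1. c1 v = j})))"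
      using x D0 D1n' D01 c1k finD1 by (intro mult_left_mono card_ext_le) auto
    also have "\<dots> \<le> C0 * x ^ card D1 * (card ?N * (\<Prod>p\<in>P. ff (u (snd p)) (card (h p))))"
      unfolding eqN using x prod_le by (intro mult_left_mono) auto
    also have "\<dots> = card ?N * C0 * (\<Prod>p\<in>P. ff (u (snd p)) (card (h p)) * x ^ card (h p))"
      by (simp add: cardD1 power_sum prod.distrib)
    finally show ?thesis .
  qed
  have dc: "real (card {x \<in> A. Q x}) = (\<Sum>x\<in>A. of_bool (Q x))" if "finite A" for A :: "(nat \<Rightarrow> nat) set" and Q
    using that by (simp add: of_bool_def sum.If_cases Int_def)
  have ob: "(\<Prod>p\<in>P. of_bool (Q p)) = (of_bool (\<forall>p\<in>P. Q p) :: real)" for Q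
    using P(1) by (induction P rule: finite_induct) auto
  have "(\<Sum>c'\<in>?N. \<Prod>p\<in>P. \<Sum>T\<in>F p. of_bool (T \<subseteq> cls n c' (snd p)) * w T)
      = (\<Sum>c'\<in>?N. \<Sum>h\<in>PiE P F. \<Prod>p\<in>P. of_bool (h p \<subseteq> cls n c' (snd p)) * w (h p))"
    using P(1) finF by (intro sum.cong refl prod_sum_PiE) auto
  also have "\<dots> = (\<Sum>h\<in>PiE P F. \<Sum>c'\<in>?N. \<Prod>p\<in>P. of_bool (h p \<subseteq> cls n c' (snd p)) * w (h p))"
    by (rule sum.swap)
  also have "\<dots> = (\<Sum>h\<in>PiE P F. (\<Prod>p\<in>P. w (h p)) * real (card (?A h)))"
  proof (intro sum.cong refl)
    fix h
    have "(\<Sum>c'\<in>?N. \<Prod>p\<in>P. of_bool (h p \<subseteq> cls n c' (snd p)) * w (h p))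
        = (\<Sum>c'\<in>?N. (\<Prod>p\<in>P. w (h p)) * of_bool (\<forall>p\<in>P. h p \<subseteq> cls n c' (snd p)))"
      by (intro sum.cong refl) (simp only: prod.distrib ob mult.commute)
    then show "(\<Sum>c'\<in>?N. \<Prod>p\<in>P. of_bool (h p \<subseteq> cls n c' (snd p)) * w (h p)) = (\<Prod>p\<in>P. w (h p)) * real (card (?A h))"
      using dc[OF finite_ext, of n k u D0 \<tau> "\<lambda>c'. \<forall>p\<in>P. h p \<subseteq> cls n c' (snd p)"] by (simp only: sum_distrib_left)
  qed
  also have "\<dots> \<le> (\<Sum>h\<in>PiE P F. (\<Prod>p\<in>P. w (h p)) * (card ?N * C0 * (\<Prod>p\<in>P. ff (u (snd p)) (card (h p)) * x ^ card (h p))))"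
    using main w by (intro sum_mono mult_left_mono prod_nonneg) auto
  also have "\<dots> = card ?N * C0 * (\<Sum>h\<in>PiE P F. \<Prod>p\<in>P. w (h p) * ff (u (snd p)) (card (h p)) * x ^ card (h p))"
    unfolding sum_distrib_left by (intro sum.cong refl) (simp add: prod.distrib algebra_simps)
  also have "(\<Sum>h\<in>PiE P F. \<Prod>p\<in>P. w (h p) * ff (u (snd p)) (card (h p)) * x ^ card (h p))
      = (\<Prod>p\<in>P. \<Sum>T\<in>F p. w T * ff (u (snd p)) (card T) * x ^ card T)"
    using P(1) finF by (intro prod_sum_PiE[symmetric]) auto
  finally show ?thesis .
qed

lemma sum_subsets_by_card:
  fixes g :: "nat \<Rightarrow> real"
  assumes "finite A" "finite I" "\<And>t. 0 \<le> g t"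
  shows "(\<Sum>T\<in>{T. T \<subseteq> A \<and> card T \<in> I}. g (card T)) = (\<Sum>t\<in>I. real (card A choose t) * g t)"
proof -
  have "{T. T \<subseteq> A \<and> card T \<in> I} = (\<Union>t\<in>I. {T. T \<subseteq> A \<and> card T = t})" by auto
  then have "(\<Sum>T\<in>{T. T \<subseteq> A \<and> card T \<in> I}. g (card T)) = (\<Sum>t\<in>I. \<Sum>T\<in>{T. T \<subseteq> A \<and> card T = t}. g (card T))"
    using assms by (simp only:) (intro sum.UNION_disjoint; auto)
  also have "\<dots> = (\<Sum>t\<in>I. real (card A choose t) * g t)"
    using assms n_subsets[OF assms(1)] by (intro sum.cong refl) simp
  finally show ?thesis .
qed

text \<open>The expected contribution of two classes meeting in \<open>t\<close> vertices with
  \<open>2 \<le> t < L\<close>: choose the \<open>t\<close> vertices in the first class, assign them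
  to places of the second, pay \<open>x\<close>, roughly the inverse number of vertices, for each,
  and count the common pairs with weight 2.\<close>

definition pair_weight :: "nat \<Rightarrow> nat \<Rightarrow> nat \<Rightarrow> real \<Rightarrow> real" where
  "pair_weight u v L x = (\<Sum>t=2..<L. real (u choose t) * ff v t * 2 ^ (t choose 2) * x ^ t)"

lemma small_overlap_sum:
  fixes x C0 :: real
  assumes c: "c \<in> cols n k u" and D0: "D0 \<subseteq> {..<n}"
    and P: "P \<subseteq> {..<k} \<times> {..<k}" and L: "0 < L"
    and C': "C' \<subseteq> ext n k u D0 \<tau>"
      "\<And>c' p. c' \<in> C' \<Longrightarrow> p \<in> P \<Longrightarrow> card (cls n c (fst p) \<inter> cls n c' (snd p)) < L"
      "\<And>c' p. c' \<in> C' \<Longrightarrow> p \<in> P \<Longrightarrow> cls n c (fst p) \<inter> cls n c' (snd p) \<inter> D0 = {}"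
    and x: "0 \<le> x" "0 \<le> C0"
    and C0: "\<And>t. t \<le> n - card D0 \<Longrightarrow> t \<le> (\<Sum>j<k. u j) \<Longrightarrow> 1 \<le> C0 * x ^ t * ff (n - card D0) t"
  shows "(\<Sum>c'\<in>C'. \<Prod>p\<in>P. 2 ^ (card (cls n c (fst p) \<inter> cls n c' (snd p)) choose 2))
     \<le> card (ext n k u D0 \<tau>) * C0 * exp (\<Sum>p\<in>P. pair_weight (u (fst p)) (u (snd p)) L x)"
proof -
  have finP: "finite P" using P finite_subset by blast
  define I where "I = insert 0 {2..<L}"
  define F where "F p = {T. T \<subseteq> cls n c (fst p) - D0 \<and> card T \<in> I}" for p :: "nat \<times> nat"
  define w where "w T = (2::real) ^ (card T choose 2)" for T :: "nat set"
  have finF: "finite (F p)" for p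
    by (rule finite_subset[of _ "Pow (cls n c (fst p))"]) (auto simp: F_def)
  have 1: "2 ^ (card (cls n c (fst p) \<inter> cls n c' (snd p)) choose 2) \<le> (\<Sum>T\<in>F p. of_bool (T \<subseteq> cls n c' (snd p)) * w T)"
    if "c' \<in> C'" "p \<in> P" for c' p
  proof -
    let ?B = "cls n c (fst p) \<inter> cls n c' (snd p)"
    \<comment> \<open>A single common vertex has weight 1 and is recorded as the empty set. Thus no
      term t = 1, which would be worth u v x for every pair of classes, enters
      \<open>pair_weight\<close>.\<close>
    define T where "T = (if card ?B = 1 then {} else ?B)"
    have "2 ^ (card ?B choose 2) = of_bool (T \<subseteq> cls n c' (snd p)) * w T"
      by (auto simp: T_def w_def binomial_eq_0)
    also have "\<dots> \<le> (\<Sum>T\<in>F p. of_bool (T \<subseteq> cls n c' (snd p)) * w T)"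
    proof (rule member_le_sum)
      have B: "card ?B < L" "?B \<inter> D0 = {}" using C'(2,3) that by auto
      show "T \<in> F p"
      proof (cases "card ?B = 1")
        case False
        then have "card ?B \<in> I" using B(1) unfolding I_def insert_iff atLeastLessThan_iff by linarith
        then show ?thesis using False B(2) by (auto simp: T_def F_def)
      qed (simp add: T_def F_def I_def)
    qed (auto simp: w_def finF)
    finally show ?thesis .
  qed
  have 2: "(\<Sum>T\<in>F p. w T * ff (u (snd p)) (card T) * x ^ card T) \<le> exp (pair_weight (u (fst p)) (u (snd p)) L x)"
    if p: "p \<in> P" for p
  proof -
    define g where "g t = (2::real) ^ (t choose 2) * ff (u (snd p)) t * x ^ t" for t
    have g0: "0 \<le> g t" for t using x by (simp add: g_def)
    let ?A = "cls n c (fst p)"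
    have "(\<Sum>T\<in>F p. w T * ff (u (snd p)) (card T) * x ^ card T) = (\<Sum>T\<in>F p. g (card T))"
      by (simp add: g_def w_def)
    also have "\<dots> \<le> (\<Sum>T\<in>{T. T \<subseteq> ?A \<and> card T \<in> I}. g (card T))"
      using g0 by (intro sum_mono2) (auto simp: F_def)
    also have "\<dots> = (\<Sum>t\<in>I. real (card ?A choose t) * g t)"
      by (rule sum_subsets_by_card) (auto simp: I_def g0)
    also have "\<dots> = 1 + pair_weight (card ?A) (u (snd p)) L x"
      by (simp add: I_def g_def pair_weight_def binomial_eq_0 algebra_simps)
    also have "card ?A = u (fst p)" using c p P by (auto simp: cols_def)
    finally show ?thesis using exp_ge_add_one_self[of "pair_weight (u (fst p)) (u (snd p)) L x"] by linarith
  qed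
  have "(\<Sum>c'\<in>C'. \<Prod>p\<in>P. 2 ^ (card (cls n c (fst p) \<inter> cls n c' (snd p)) choose 2))
      \<le> (\<Sum>c'\<in>C'. \<Prod>p\<in>P. \<Sum>T\<in>F p. of_bool (T \<subseteq> cls n c' (snd p)) * w T)"
    using 1 by (intro sum_mono prod_mono) auto
  also have "\<dots> \<le> (\<Sum>c'\<in>ext n k u D0 \<tau>. \<Prod>p\<in>P. \<Sum>T\<in>F p. of_bool (T \<subseteq> cls n c' (snd p)) * w T)"
    using C'(1) by (intro sum_mono2 prod_nonneg sum_nonneg ballI) (auto simp: w_def)
  also have "\<dots> \<le> card (ext n k u D0 \<tau>) * C0 * (\<Prod>p\<in>P. \<Sum>T\<in>F p. w T * ff (u (snd p)) (card T) * x ^ card T)"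
    by (rule overlap_sum[OF c D0 finP P finF _ _ x C0]) (auto simp: F_def w_def)
  also have "\<dots> \<le> card (ext n k u D0 \<tau>) * C0 * (\<Prod>p\<in>P. exp (pair_weight (u (fst p)) (u (snd p)) L x))"
    using 2 x by (intro mult_left_mono prod_mono conjI sum_nonneg) (auto simp: w_def)
  also have "(\<Prod>p\<in>P. exp (pair_weight (u (fst p)) (u (snd p)) L x)) = exp (\<Sum>p\<in>P. pair_weight (u (fst p)) (u (snd p)) L x)"
    using finP by (simp add: exp_sum)
  finally show ?thesis .
qed

text \<open>Intersections have at most \<open>a\<close> vertices, so with L = a + 1 all of them
  count as small. The first a r factors of the falling factorial of m + a r are at least m, hence x
  = 1 / m and C0 = 1 are admissible.\<close>

lemma cp_plant:
  assumes "0 < m"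
  shows "(cp m f)\<^sup>2 \<le> exp (real r ^ 2 * pair_weight a a (Suc a) (1 / m)) * cp (m + a * r) (f + r)"
proof -
  let ?n = "m + a * r" and ?u = "\<lambda>j::nat. a"
  let ?S = "exp (real r ^ 2 * pair_weight a a (Suc a) (1 / m))"
  have S: "(\<Sum>c'\<in>cols ?n r ?u. overlap_weight ?n r c c') \<le> ?S * card (cols ?n r ?u)" if c: "c \<in> cols ?n r ?u" for c
  proof -
    have e: "ext ?n r ?u {} c = cols ?n r ?u" by (auto simp: ext_def)
    have "(\<Sum>c'\<in>cols ?n r ?u. overlap_weight ?n r c c')
       \<le> real (card (ext ?n r ?u {} c)) * 1 * exp (\<Sum>p\<in>{..<r} \<times> {..<r}. pair_weight a a (Suc a) (1 / m))"
      unfolding overlap_weight_def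
    proof (rule small_overlap_sum[OF c])
      fix c' and p :: "nat \<times> nat" assume "p \<in> {..<r} \<times> {..<r}"
      then have "card (cls ?n c (fst p)) = a" using c by (auto simp: cols_def)
      then show "card (cls ?n c (fst p) \<inter> cls ?n c' (snd p)) < Suc a"
        by (metis card_mono finite_cls inf_le1 less_Suc_eq_le)
    next
      fix t assume "t \<le> (\<Sum>j<r. a)"
      then have t: "t \<le> a * r" by (simp add: mult.commute)
      have "real m ^ t = (\<Prod>i<t. real m)" by simp
      also have "\<dots> \<le> ff ?n t" unfolding ff_def using t
        by (intro prod_mono) (auto simp: of_nat_mult[symmetric] simp del: of_nat_mult)
      finally show "1 \<le> 1 * (1 / real m) ^ t * ff (?n - card {}) t"
        using assms by (simp add: power_divide field_simps)
    qed (auto simp: e)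
    then show ?thesis by (simp add: e card_cartesian_product power2_eq_square algebra_simps)
  qed
  have "(cp (?n - (\<Sum>j<r. a)) f)\<^sup>2 \<le> ?S * cp ?n (f + r)"
    by (rule cp_second_moment[OF _ S]) (auto simp: mult.commute)
  moreover have "?n - (\<Sum>j<r. a) = m" by (simp add: mult.commute)
  ultimately show ?thesis by simp
qed

section \<open>Planting independent sets\<close>

text \<open>The expected number of independent sets of size \<open>u\<close> is about \<open>n ^ u / dw u\<close>.\<close>

definition dw :: "nat \<Rightarrow> real" where
  "dw u = fact u * 2 ^ (u choose 2)"

lemma dw_pos [simp]: "0 < dw u"
  by (simp add: dw_def)

lemma real_choose_2: "real (t choose 2) = real t * (real t - 1) / 2"
proof (induction t)
  case (Suc t)
  have "Suc t choose 2 = t + (t choose 2)" by (simp add: numeral_2_eq_2)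
  then show ?case using Suc by (simp add: field_simps)
qed simp

lemma two_powr_power: "(2 powr y) ^ s = 2 powr (y * real s)" for y :: real
  by (simp add: powr_def exp_of_nat_mult[symmetric] algebra_simps)

lemma two_power_choose_2: "(2::real) ^ (t choose 2) = 2 powr (real t * (real t - 1) / 2)"
  by (simp add: powr_realpow[symmetric] real_choose_2)

lemma binomial_le_power_real: "real (n choose t) \<le> real n ^ t"
proof (cases "t \<le> n")
  case True
  then show ?thesis by (metis binomial_le_pow of_nat_le_iff of_nat_power)
qed (simp add: binomial_eq_0)

text \<open>The weights decrease and then increase again in the overlap \<open>t\<close>. Up to a /
  2 the hypothesis r^2 <= m pays for the pair of classes; beyond that the term is compared with t =
  a, where r^2 is at most the expected number m^a / dw a of independent sets. All terms with t < a
  are at most 1 / a, and the last is at most 1.\<close>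

lemma plant_weight:
  assumes a: "4 \<le> a" and \<delta>: "real a ^ 4 * 2 powr (- real a / 4) \<le> 1 / a"
    and m: "2 powr (real a / 2) \<le> real m" "real m \<le> 2 * a * 2 powr (real a / 2)"
    and r: "real r ^ 2 \<le> m" "real r ^ 2 * dw a \<le> real m ^ a"
  shows "real r ^ 2 * pair_weight a a (Suc a) (1 / m) \<le> 2"
proof -
  define \<delta> where "\<delta> = real a ^ 4 * 2 powr (- real a / 4)"
  have \<delta>: "0 \<le> \<delta>" "\<delta> \<le> 1 / a" "\<delta> \<le> 1"
  proof -
    show "0 \<le> \<delta>" by (simp add: \<delta>_def)
    show "\<delta> \<le> 1 / a" using \<delta> by (simp add: \<delta>_def)
    also have "1 / real a \<le> 1" using a by simp
    finally show "\<delta> \<le> 1" .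
  qed
  have \<delta>pow: "\<delta> ^ s \<le> 1 / a" if "1 \<le> s" for s
    using power_decreasing[OF that \<delta>(1,3)] \<delta>(2) by simp
  have m0: "0 < real m" using m(1) by (smt (verit) powr_gt_zero)
  have minv: "1 / real m \<le> 2 powr (- real a / 2)"
    using m(1) m0 by (simp add: powr_minus_divide field_simps)
  define X where "X t = real r ^ 2 * (real (a choose t) * ff a t * 2 ^ (t choose 2) * (1 / m) ^ t)" for t
  \<comment> \<open>With s = t - 1: one factor \<open>m\<close> is used up by r^2, and each of the
    remaining \<open>s\<close> factors 1 / m beats 2 powr (t / 2) because t <= a / 2.\<close>
  have small: "X t \<le> 1 / a" if t: "2 \<le> t" "2 * t \<le> a" for t
  proof -
    obtain s where s: "t = Suc s" "1 \<le> s" using t(1) by (cases t) auto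
    have "X t \<le> m * (real a ^ t * real a ^ t * 2 powr (real t * (real t - 1) / 2) * (1 / m) ^ t)"
      unfolding X_def two_power_choose_2
      by (intro mult_mono r binomial_le_power_real ff_le_power order_refl mult_nonneg_nonneg zero_le_power) auto
    also have "\<dots> = (real a ^ t * real a ^ t) * 2 powr (real t * (real t - 1) / 2) * (1 / m) ^ s"
      using m0 by (simp add: s(1))
    also have "\<dots> \<le> real a ^ (4 * s) * 2 powr (real t * (real t - 1) / 2) * (2 powr (- real a / 2)) ^ s"
    proof -
      have "real a ^ t * real a ^ t \<le> real a ^ (4 * s)"
        unfolding power_add[symmetric] by (rule power_increasing) (use s a in auto)
      moreover have "(1 / m) ^ s \<le> (2 powr (- real a / 2)) ^ s" by (rule power_mono[OF minv]) simp
      ultimately show ?thesis by (intro mult_mono) auto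
    qed
    also have "\<dots> = real a ^ (4 * s) * 2 powr (real t * (real t - 1) / 2 + (- real a / 2) * s)"
      by (simp only: two_powr_power powr_add mult.assoc)
    also have "\<dots> \<le> real a ^ (4 * s) * 2 powr ((- real a / 4) * s)"
    proof -
      have "real s * (real t - real a / 2) \<le> 0" using t(2) by (intro mult_nonneg_nonpos) auto
      then have "real t * (real t - 1) / 2 + (- real a / 2) * s \<le> (- real a / 4) * s"
        using s by (simp add: algebra_simps)
      then show ?thesis by (intro mult_left_mono powr_mono) auto
    qed
    also have "\<dots> = \<delta> ^ s" by (simp add: \<delta>_def power_mult_distrib power_mult two_powr_power)
    finally show ?thesis using \<delta>pow[OF s(2)] by linarith
  qed
  \<comment> \<open>With s = a - t: giving up \<open>s\<close> common vertices gains a factor of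
    about (a m)^s but loses the common pairs at these vertices, a power of 2 with exponent about s
    (a - s / 2).\<close>
  have large: "X t \<le> 1 / a" if t: "a < 2 * t" "t < a" for t
  proof -
    define s where "s = a - t"
    have s: "1 \<le> s" "a = t + s" "2 * s < a" using t by (auto simp: s_def)
    have rs: "real a = real t + real s" using s(2) by simp
    have ffle: "ff a t \<le> fact a"
    proof -
      have "ff a t = fact a / fact (a - t)" using t by (intro ff_fact) auto
      also have "\<dots> \<le> fact a / 1" by (intro divide_left_mono) (auto simp: fact_ge_1)
      finally show ?thesis by simp
    qed
    have ch: "real (a choose t) \<le> real a ^ s"
      using binomial_le_power_real[of a s] binomial_symmetric[of t a] s(2) by simp
    have "X t = (real r ^ 2 * ff a t * (1 / m) ^ t) * (real (a choose t) * 2 powr (real t * (real t - 1) / 2))"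
      by (simp add: X_def two_power_choose_2)
    also have "\<dots> \<le> (m ^ s / 2 powr (real a * (real a - 1) / 2)) * (real a ^ s * 2 powr (real t * (real t - 1) / 2))"
    proof (intro mult_mono)
      have "real r ^ 2 * ff a t * (1 / m) ^ t * 2 powr (real a * (real a - 1) / 2) \<le> real r ^ 2 * fact a * (1 / m) ^ t * 2 powr (real a * (real a - 1) / 2)"
        using ffle by (intro mult_right_mono mult_left_mono) auto
      also have "\<dots> = real r ^ 2 * dw a * (1 / m) ^ t" by (simp add: dw_def two_power_choose_2)
      also have "\<dots> \<le> real m ^ a * (1 / m) ^ t" using r(2) by (intro mult_right_mono) auto
      also have "\<dots> = m ^ s" using m0 by (simp add: s(2) power_add power_divide)
      finally show "real r ^ 2 * ff a t * (1 / m) ^ t \<le> m ^ s / 2 powr (real a * (real a - 1) / 2)"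
        by (simp add: pos_le_divide_eq)
    qed (use ch in auto)
    also have "\<dots> = (real a * m) ^ s * 2 powr (real t * (real t - 1) / 2 - real a * (real a - 1) / 2)"
      by (simp add: powr_diff power_mult_distrib)
    also have "\<dots> \<le> (real a * (2 * a * 2 powr (real a / 2))) ^ s * 2 powr (real t * (real t - 1) / 2 - real a * (real a - 1) / 2)"
      using m by (intro mult_right_mono power_mono mult_left_mono) auto
    also have "\<dots> = (2 * real a ^ 2) ^ s * (2 powr (real a / 2 * s) * 2 powr (real t * (real t - 1) / 2 - real a * (real a - 1) / 2))"
      by (simp add: power_mult_distrib two_powr_power power2_eq_square)
    also have "\<dots> = (2 * real a ^ 2) ^ s * 2 powr (- (s * (real a - s - 1)) / 2)"
    proof -
      have "real a / 2 * s + (real t * (real t - 1) / 2 - real a * (real a - 1) / 2) = - (s * (real a - s - 1)) / 2"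
        unfolding rs by (simp add: field_simps)
      then show ?thesis by (simp add: powr_add[symmetric])
    qed
    also have "\<dots> \<le> (2 * real a ^ 2) ^ s * 2 powr ((1 - real a / 4) * s)"
    proof -
      have "real s * (real a / 2 - s + 1) \<ge> 0" using s(3) by (intro mult_nonneg_nonneg) auto
      then have "- (s * (real a - s - 1)) / 2 \<le> (1 - real a / 4) * s" by (simp add: field_simps)
      then show ?thesis by (intro mult_left_mono powr_mono) auto
    qed
    also have "\<dots> = (4 * real a ^ 2 * 2 powr (- real a / 4)) ^ s"
    proof -
      have "2 powr (1 - real a / 4) = 2 * 2 powr (- real a / 4)" by (simp add: powr_diff powr_minus_divide)
      then have "2 powr ((1 - real a / 4) * s) = (2 * 2 powr (- real a / 4)) ^ s"
        by (simp only: two_powr_power[symmetric])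
      then show ?thesis by (simp only: power_mult_distrib[symmetric]) (simp add: mult_ac)
    qed
    also have "\<dots> \<le> \<delta> ^ s"
    proof (intro power_mono)
      have "4 * real a ^ 2 \<le> real a ^ 2 * real a ^ 2"
        using a power_mono[of 2 "real a" 2] by (intro mult_right_mono) auto
      then show "4 * real a ^ 2 * 2 powr (- real a / 4) \<le> \<delta>"
        unfolding \<delta>_def by (intro mult_right_mono) (auto simp: power_add[symmetric])
    qed auto
    finally show ?thesis using \<delta>pow[OF s(1)] by linarith
  qed
  have top: "X a \<le> 1"
  proof -
    have "X a = real r ^ 2 * dw a / m ^ a" by (simp add: X_def ff_fact dw_def power_divide)
    then show ?thesis using r(2) m0 by (simp add: divide_le_eq)
  qed
  have "real r ^ 2 * pair_weight a a (Suc a) (1 / m) = (\<Sum>t=2..<Suc a. X t)"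
    unfolding pair_weight_def sum_distrib_left X_def ..
  also have "\<dots> = (\<Sum>t=2..<a. X t) + X a" using a by simp
  also have "\<dots> \<le> (\<Sum>t=2..<a. 1 / a) + 1"
    using top small large by (intro add_mono sum_mono) (force simp: not_le)+
  also have "(\<Sum>t=2..<a. 1 / real a) \<le> 1" using a by simp
  finally show ?thesis by simp
qed

section \<open>Counting matchings\<close>

text \<open>A subset of a disjoint union is chosen independently in each block; after division by
  powers of 2 this is \<open>av_indep\<close>.\<close>

lemma sum_Pow_prod:
  fixes g :: "'s \<Rightarrow> 'a set \<Rightarrow> real"
  assumes "finite S" "\<And>s. s \<in> S \<Longrightarrow> finite (X s)" "\<And>s t. s \<in> S \<Longrightarrow> t \<in> S \<Longrightarrow> s \<noteq> t \<Longrightarrow> X s \<inter> X t = {}"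
  shows "(\<Sum>Z\<in>Pow (\<Union>s\<in>S. X s). \<Prod>s\<in>S. g s (Z \<inter> X s)) = (\<Prod>s\<in>S. \<Sum>Z\<in>Pow (X s). g s Z)"
  using assms
proof (induction S rule: finite_induct)
  case empty
  then show ?case by simp
next
  case (insert s S)
  let ?U = "\<Union>t\<in>S. X t"
  have fin: "finite ?U" "finite (X s)" using insert by auto
  have dis: "X s \<inter> ?U = {}" using insert.prems(2)[of s] insert.hyps by blast
  have sum_av: "(\<Sum>Z\<in>Pow Y. f Z) = av Y f * 2 ^ card Y" for Y :: "'a set" and f by (simp add: av_def)
  have IH: "(\<Sum>Z\<in>Pow ?U. \<Prod>t\<in>S. g t (Z \<inter> X t)) = (\<Prod>t\<in>S. \<Sum>Z\<in>Pow (X t). g t Z)"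
    using insert.prems by (intro insert.IH) auto
  have "(\<Sum>Z\<in>Pow (X s \<union> ?U). \<Prod>t\<in>insert s S. g t (Z \<inter> X t))
      = (\<Sum>Z\<in>Pow (X s \<union> ?U). g s (Z \<inter> X s) * (\<lambda>F. \<Prod>t\<in>S. g t (F \<inter> X t)) (Z \<inter> ?U))"
  proof (intro sum.cong refl)
    fix Z
    have "(\<Prod>t\<in>S. g t (Z \<inter> X t)) = (\<Prod>t\<in>S. g t (Z \<inter> ?U \<inter> X t))"
      by (intro prod.cong refl arg_cong[where f = "g _"]) auto
    then show "(\<Prod>t\<in>insert s S. g t (Z \<inter> X t)) = g s (Z \<inter> X s) * (\<lambda>F. \<Prod>t\<in>S. g t (F \<inter> X t)) (Z \<inter> ?U)"
      using insert.hyps by simp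
  qed
  also have "\<dots> = av (X s) (g s) * av ?U (\<lambda>F. \<Prod>t\<in>S. g t (F \<inter> X t)) * 2 ^ card (X s \<union> ?U)"
    unfolding sum_av using fin dis by (subst av_indep) auto
  also have "\<dots> = (\<Sum>Z\<in>Pow (X s). g s Z) * (\<Sum>Z\<in>Pow ?U. \<Prod>t\<in>S. g t (Z \<inter> X t))"
    unfolding sum_av using fin dis by (simp add: card_Un_disjoint power_add)
  finally show ?case using insert.hyps by (simp add: IH)
qed

text \<open>Indices stand for classes and \<open>u\<close> for their sizes. The set \<open>Z\<close>
  collects exceptional indices, whose images are arbitrary; all others are mapped injectively to
  indices of the same size.\<close>

lemma card_typed_injections:
  fixes u :: "nat \<Rightarrow> nat"
  assumes "finite I" "finite K" "finite S" "u ` I \<subseteq> S"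
  shows "real (card {f \<in> I \<rightarrow>\<^sub>E K. inj_on f (I - Z) \<and> (\<forall>i\<in>I - Z. u (f i) = u i)})
     \<le> real (card K) ^ card (I \<inter> Z) * (\<Prod>s\<in>S. ff (card {j \<in> K. u j = s}) (card {i \<in> I - Z. u i = s}))"
  using assms
proof (induction I rule: finite_induct)
  case empty
  then show ?case by simp
next
  case (insert i I)
  let ?N = "\<lambda>I. {f \<in> I \<rightarrow>\<^sub>E K. inj_on f (I - Z) \<and> (\<forall>i\<in>I - Z. u (f i) = u i)}"
  let ?q = "\<lambda>I s. card {i \<in> I - Z. u i = s}" and ?\<kappa> = "\<lambda>s. card {j \<in> K. u j = s}"
  have IH: "real (card (?N I)) \<le> real (card K) ^ card (I \<inter> Z) * (\<Prod>s\<in>S. ff (?\<kappa> s) (?q I s))"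
    using insert.prems by (intro insert.IH) auto
  have finN: "finite (?N I)"
    by (rule finite_subset[of _ "I \<rightarrow>\<^sub>E K"]) (use insert in \<open>auto intro: finite_PiE\<close>)
  \<comment> \<open>The admissible images of the new index. Because ordinary indices keep their
    size, only earlier ordinary indices of the same size can occupy such an image.\<close>
  define opts where "opts f = (if i \<in> Z then K else {j \<in> K. u j = u i} - f ` {l \<in> I - Z. u l = u i})" for f
  have finopts: "finite (opts f)" for f using insert.prems by (auto simp: opts_def)
  have "?N (insert i I) \<subseteq> (\<lambda>(f, j). f(i := j)) ` (SIGMA f:?N I. opts f)"
  proof
    fix f assume f: "f \<in> ?N (insert i I)"
    let ?g = "f(i := undefined)"
    have gf: "?g l = f l" if "l \<in> I" for l using that insert.hyps by auto
    have "?g \<in> ?N I"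
    proof -
      have "?g \<in> I \<rightarrow>\<^sub>E K" using f insert.hyps by (auto simp: PiE_def extensional_def Pi_def)
      moreover have "inj_on ?g (I - Z)"
      proof (rule inj_onI)
        fix x y assume "x \<in> I - Z" "y \<in> I - Z" "?g x = ?g y"
        then show "x = y" using f gf by (auto simp: inj_on_def)
      qed
      moreover have "\<forall>l\<in>I - Z. u (?g l) = u l" using f gf by auto
      ultimately show ?thesis by blast
    qed
    moreover have "f i \<in> opts ?g"
    proof (cases "i \<in> Z")
      case True
      then show ?thesis using f by (auto simp: opts_def PiE_def Pi_def)
    next
      case False
      have "f i \<notin> ?g ` {l \<in> I - Z. u l = u i}"
      proof
        assume "f i \<in> ?g ` {l \<in> I - Z. u l = u i}"
        then obtain l where l: "l \<in> I - Z" "f i = f l" using gf by auto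
        then have "i = l" using f False unfolding mem_Collect_eq inj_on_def by blast
        then show False using l insert.hyps by auto
      qed
      then show ?thesis using f False by (auto simp: opts_def PiE_def Pi_def)
    qed
    moreover have "f = ?g(i := f i)" by simp
    ultimately show "f \<in> (\<lambda>(f, j). f(i := j)) ` (SIGMA f:?N I. opts f)" by (intro rev_image_eqI[of "(?g, f i)"]) auto
  qed
  then have "card (?N (insert i I)) \<le> card (SIGMA f:?N I. opts f)"
    using finN finopts by (meson card_image_le card_mono finite_SigmaI finite_imageI le_trans)
  also have "\<dots> = (\<Sum>f\<in>?N I. card (opts f))" using finN finopts by (intro card_SigmaI) auto
  finally have "card (?N (insert i I)) \<le> (\<Sum>f\<in>?N I. card (opts f))" .
  then have "real (card (?N (insert i I))) \<le> real (\<Sum>f\<in>?N I. card (opts f))" by (rule of_nat_mono)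
  then have le: "real (card (?N (insert i I))) \<le> (\<Sum>f\<in>?N I. real (card (opts f)))" by (simp only: of_nat_sum)
  show ?case
  proof (cases "i \<in> Z")
    case True
    have "(\<Sum>f\<in>?N I. real (card (opts f))) = card (?N I) * real (card K)" using True by (simp add: opts_def)
    also have "\<dots> \<le> (real (card K) ^ card (I \<inter> Z) * (\<Prod>s\<in>S. ff (?\<kappa> s) (?q I s))) * real (card K)"
      using IH by (intro mult_right_mono) auto
    also have "\<dots> = real (card K) ^ card (insert i I \<inter> Z) * (\<Prod>s\<in>S. ff (?\<kappa> s) (?q (insert i I) s))"
      using True insert.hyps by (simp add: insert_Diff_if)
    finally show ?thesis using le by linarith
  next
    case False
    let ?s = "u i"
    have cO: "real (card (opts f)) = real (?\<kappa> ?s) - ?q I ?s" if f: "f \<in> ?N I" for f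
    proof -
      have sub: "f ` {l \<in> I - Z. u l = ?s} \<subseteq> {j \<in> K. u j = ?s}" using f by (auto simp: PiE_def Pi_def)
      have "inj_on f {l \<in> I - Z. u l = ?s}" using f by (auto intro: inj_on_subset)
      then have "card (f ` {l \<in> I - Z. u l = ?s}) = ?q I ?s" by (rule card_image)
      moreover have "card (opts f) = ?\<kappa> ?s - card (f ` {l \<in> I - Z. u l = ?s})"
        using False sub insert.prems finite_subset[OF sub] by (simp add: opts_def card_Diff_subset)
      moreover have "card (f ` {l \<in> I - Z. u l = ?s}) \<le> ?\<kappa> ?s" using sub insert.prems by (intro card_mono) auto
      ultimately show ?thesis by simp
    qed
    have q1: "?q (insert i I) ?s = Suc (?q I ?s)"
    proof -
      have "{l \<in> insert i I - Z. u l = ?s} = insert i {l \<in> I - Z. u l = ?s}" using False by auto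
      then show ?thesis using insert.hyps by simp
    qed
    have q2: "?q (insert i I) s = ?q I s" if "s \<noteq> ?s" for s
      using that by (intro arg_cong[where f = card]) auto
    have sS: "?s \<in> S" using insert.prems by auto
    have P: "(\<Prod>s\<in>S. ff (?\<kappa> s) (?q (insert i I) s)) = (\<Prod>s\<in>S. ff (?\<kappa> s) (?q I s)) * (real (?\<kappa> ?s) - ?q I ?s)"
    proof -
      have "(\<Prod>s\<in>S. ff (?\<kappa> s) (?q (insert i I) s)) = ff (?\<kappa> ?s) (?q (insert i I) ?s) * (\<Prod>s\<in>S - {?s}. ff (?\<kappa> s) (?q (insert i I) s))"
        using insert.prems sS by (intro prod.remove) auto
      also have "(\<Prod>s\<in>S - {?s}. ff (?\<kappa> s) (?q (insert i I) s)) = (\<Prod>s\<in>S - {?s}. ff (?\<kappa> s) (?q I s))"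
        by (rule prod.cong[OF refl], subst q2) auto
      also have "ff (?\<kappa> ?s) (?q (insert i I) ?s) = (real (?\<kappa> ?s) - ?q I ?s) * ff (?\<kappa> ?s) (?q I ?s)"
        unfolding q1 by (simp add: ff_Suc)
      also have "(real (?\<kappa> ?s) - ?q I ?s) * ff (?\<kappa> ?s) (?q I ?s) * (\<Prod>s\<in>S - {?s}. ff (?\<kappa> s) (?q I s)) = (\<Prod>s\<in>S. ff (?\<kappa> s) (?q I s)) * (real (?\<kappa> ?s) - ?q I ?s)"
        using insert.prems sS prod.remove[of S ?s "\<lambda>s. ff (?\<kappa> s) (?q I s)"] by simp
      finally show ?thesis .
    qed
    show ?thesis
    proof (cases "?N I = {}")
      case True
      then have "real (card (?N (insert i I))) \<le> 0" using le by (simp only: True sum.empty)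
      also have "0 \<le> real (card K) ^ card (insert i I \<inter> Z) * (\<Prod>s\<in>S. ff (?\<kappa> s) (?q (insert i I) s))"
        by (intro mult_nonneg_nonneg prod_nonneg) auto
      finally show ?thesis .
    next
      case False': False
      then obtain f0 where f0: "f0 \<in> ?N I" by blast
      have nn: "0 \<le> real (?\<kappa> ?s) - ?q I ?s" unfolding cO[OF f0, symmetric] by simp
      have "(\<Sum>f\<in>?N I. real (card (opts f))) = (\<Sum>f\<in>?N I. real (?\<kappa> ?s) - ?q I ?s)" by (rule sum.cong[OF refl cO])
      also have "\<dots> = card (?N I) * (real (?\<kappa> ?s) - ?q I ?s)" by simp
      also have "\<dots> \<le> (real (card K) ^ card (I \<inter> Z) * (\<Prod>s\<in>S. ff (?\<kappa> s) (?q I s))) * (real (?\<kappa> ?s) - ?q I ?s)"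
        by (rule mult_right_mono[OF IH nn])
      also have "\<dots> = real (card K) ^ card (insert i I \<inter> Z) * (\<Prod>s\<in>S. ff (?\<kappa> s) (?q (insert i I) s))"
        unfolding P using False by simp
      finally show ?thesis using le by linarith
    qed
  qed
qed

lemma ff_diff_fact: "z \<le> q \<Longrightarrow> q \<le> k \<Longrightarrow> ff k (q - z) * fact z \<le> ff k q"
proof -
  assume zq: "z \<le> q" "q \<le> k"
  have "ff k q = ff k (q - z) * ff (k - (q - z)) z"
    using ff_add[of "q - z" k z] zq by simp
  moreover have "fact z \<le> ff (k - (q - z)) z" using zq by (intro ff_ge_fact) auto
  ultimately show ?thesis by (simp add: mult_left_mono)
qed

lemma sum_power_fact_le_exp:
  assumes "0 \<le> y"
  shows "(\<Sum>z\<le>q. y ^ z / fact z) \<le> exp (y::real)"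
proof -
  have "sum (\<lambda>n. y ^ n /\<^sub>R fact n) {..q} \<le> (\<Sum>n. y ^ n /\<^sub>R fact n)"
    by (rule sum_le_suminf[OF summable_exp_generic]) (use assms in auto)
  then show ?thesis by (simp add: exp_def divide_inverse mult.commute)
qed

text \<open>Bounding the binomial coefficient by N^z / z! leaves a Bessel-type series of squares
  (v^z / z!)^2 with v^2 = N y; the sum of the squares is at most the square of the sum.\<close>

lemma sum_subsets_fact_le:
  fixes y :: real
  assumes "finite X" "real (card X) \<le> N" "0 \<le> y"
  shows "(\<Sum>Z\<in>Pow X. y ^ card Z / fact (card Z)) \<le> exp (2 * sqrt (N * y))"
proof -
  define v where "v = sqrt (N * y)"
  have v: "0 \<le> v" "v ^ 2 = N * y" using assms by (auto simp: v_def intro!: mult_nonneg_nonneg)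
  have "Pow X = {Z. Z \<subseteq> X \<and> card Z \<in> {..card X}}" using assms(1) by (auto intro: card_mono)
  then have "(\<Sum>Z\<in>Pow X. y ^ card Z / fact (card Z)) = (\<Sum>Z\<in>{Z. Z \<subseteq> X \<and> card Z \<in> {..card X}}. y ^ card Z / fact (card Z))"
    by (simp only:)
  also have "\<dots> = (\<Sum>z\<in>{..card X}. real (card X choose z) * (y ^ z / fact z))"
    using assms by (intro sum_subsets_by_card) auto
  also have "\<dots> \<le> (\<Sum>z\<in>{..card X}. (v ^ z / fact z)\<^sup>2)"
  proof (intro sum_mono)
    fix z assume "z \<in> {..card X}"
    have "real (card X choose z) \<le> N ^ z / fact z"
    proof -
      have "real (card X choose z) = ff (card X) z / fact z"
        using \<open>z \<in> _\<close> by (simp add: binomial_fact ff_fact)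
      also have "\<dots> \<le> N ^ z / fact z"
        using ff_le_power[of "card X" z] power_mono[OF assms(2), of z] by (intro divide_right_mono) auto
      finally show ?thesis .
    qed
    then have "real (card X choose z) * (y ^ z / fact z) \<le> (N ^ z / fact z) * (y ^ z / fact z)"
      using assms by (intro mult_right_mono) auto
    also have "\<dots> = (v ^ 2) ^ z / (fact z)\<^sup>2" unfolding v by (simp add: power_mult_distrib power2_eq_square)
    also have "\<dots> = (v ^ z / fact z)\<^sup>2" by (simp add: power_divide power_mult[symmetric] mult.commute)
    finally show "real (card X choose z) * (y ^ z / fact z) \<le> (v ^ z / fact z)\<^sup>2" .
  qed
  also have "\<dots> \<le> (\<Sum>z\<le>card X. v ^ z / fact z)\<^sup>2"
  proof -
    have "(\<Sum>z\<in>A. (f z)\<^sup>2) \<le> (\<Sum>z\<in>A. f z)\<^sup>2" if "finite A" "\<And>z. 0 \<le> f z" for A :: "nat set" and f :: "nat \<Rightarrow> real"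
      using that(1)
    proof (induction A rule: finite_induct)
      case (insert z A)
      have "0 \<le> f z * (\<Sum>z\<in>A. f z)" using that(2) by (intro mult_nonneg_nonneg sum_nonneg)
      then show ?case using insert by (simp add: power2_sum)
    qed simp
    then show ?thesis using v by simp
  qed
  also have "\<dots> \<le> (exp v)\<^sup>2" using v by (intro power_mono sum_power_fact_le_exp sum_nonneg) auto
  also have "\<dots> = exp (2 * v)" by (simp add: exp_double)
  finally show ?thesis by (simp add: v_def)
qed

definition matchings :: "nat \<Rightarrow> (nat \<times> nat) set set" where
  "matchings k = {m. m \<subseteq> {..<k} \<times> {..<k} \<and> inj_on fst m \<and> inj_on snd m}"

lemma finite_matchings [simp]: "finite (matchings k)"
  by (rule finite_subset[of _ "Pow ({..<k} \<times> {..<k})"]) (auto simp: matchings_def)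

text \<open>A matching with row set \<open>I\<close> is the graph of an injection. Expanding the
  product, \<open>Z\<close> is the set of rows where \<open>\<epsilon>\<close> is taken; such a row
  has at most \<open>k\<close> partners, all others keep the size. By \<open>ff_diff_fact\<close>
  removing z rows of one size from the falling factorial gains 1 / z!, which makes the sum over
  \<open>Z\<close> as small as exp (2 k sqrt \<open>\<epsilon>\<close>) per size.\<close>

lemma sum_matchings_with_domain:
  fixes u :: "nat \<Rightarrow> nat" and \<epsilon> :: real
  assumes I: "I \<subseteq> {..<k}" and \<epsilon>: "0 \<le> \<epsilon>"
  shows "(\<Sum>m\<in>{m \<in> matchings k. fst ` m = I}. \<Prod>p\<in>m. of_bool (u (fst p) = u (snd p)) + \<epsilon>)
     \<le> (\<Prod>s\<in>u ` {..<k}. ff (card {j \<in> {..<k}. u j = s}) (card {i \<in> I. u i = s}))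
       * exp (2 * real k * sqrt \<epsilon>) ^ card (u ` {..<k})"
proof -
  let ?K = "{..<k}" and ?S = "u ` {..<k}"
  let ?\<kappa> = "\<lambda>s. card {j \<in> {..<k}. u j = s}" and ?I = "\<lambda>s. {i \<in> I. u i = s}"
  let ?F = "\<lambda>m. \<Prod>p\<in>m. of_bool (u (fst p) = u (snd p)) + \<epsilon>"
  define G where "G f = (\<lambda>i. (i, f i)) ` I" for f :: "nat \<Rightarrow> nat"
  define Fs where "Fs = {f \<in> I \<rightarrow>\<^sub>E ?K. inj_on f I}"
  have finI: "finite I" using I finite_subset by blast
  have finFs: "finite Fs"
    by (rule finite_subset[of _ "I \<rightarrow>\<^sub>E ?K"]) (use finI in \<open>auto simp: Fs_def intro: finite_PiE\<close>)
  have sub: "{m \<in> matchings k. fst ` m = I} \<subseteq> G ` Fs"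
  proof
    fix m assume "m \<in> {m \<in> matchings k. fst ` m = I}"
    then have m: "m \<subseteq> ?K \<times> ?K" "inj_on fst m" "inj_on snd m" "fst ` m = I" by (auto simp: matchings_def)
    define f where "f = (\<lambda>i\<in>I. SOME j. (i, j) \<in> m)"
    have f: "(i, f i) \<in> m" if "i \<in> I" for i
    proof -
      have "\<exists>j. (i, j) \<in> m" using that m(4) by force
      then have "(i, SOME j. (i, j) \<in> m) \<in> m" by (rule someI_ex)
      then show ?thesis using that by (simp add: f_def)
    qed
    have "f \<in> I \<rightarrow>\<^sub>E ?K" using f m(1) by (auto simp: f_def)
    moreover have "inj_on f I"
    proof (rule inj_onI)
      fix x y assume xy: "x \<in> I" "y \<in> I" "f x = f y"
      then show "x = y" using inj_onD[OF m(3) _ f[OF xy(1)] f[OF xy(2)]] by simp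
    qed
    moreover have "m = G f"
    proof (intro equalityI subsetI)
      fix p assume p: "p \<in> m"
      then have "fst p \<in> I" using m(4) by blast
      then have "p = (fst p, f (fst p))" using inj_onD[OF m(2) _ p f[of "fst p"]] by simp
      then show "p \<in> G f" using \<open>fst p \<in> I\<close> unfolding G_def by blast
    qed (use f in \<open>auto simp: G_def\<close>)
    ultimately show "m \<in> G ` Fs" by (auto simp: Fs_def)
  qed
  have F0: "0 \<le> ?F m" for m using \<epsilon> by (intro prod_nonneg) auto
  have "(\<Sum>m\<in>{m \<in> matchings k. fst ` m = I}. ?F m) \<le> (\<Sum>m\<in>G ` Fs. ?F m)"
    using sub finFs F0 by (intro sum_mono2) auto
  also have "\<dots> \<le> (\<Sum>f\<in>Fs. ?F (G f))"
    using sum_image_le[OF finFs, of ?F G] F0 by (simp add: o_def)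
  also have "\<dots> = (\<Sum>f\<in>Fs. \<Sum>Z\<in>Pow I. \<epsilon> ^ card Z * of_bool (\<forall>i\<in>I - Z. u (f i) = u i))"
  proof (intro sum.cong refl)
    fix f :: "nat \<Rightarrow> nat"
    have ob: "(\<Prod>i\<in>A. of_bool (Q i)) = (of_bool (\<forall>i\<in>A. Q i) :: real)" if "finite A" for Q and A :: "nat set"
      using that by (induction A rule: finite_induct) auto
    have "?F (G f) = (\<Prod>i\<in>I. \<epsilon> + of_bool (u (f i) = u i))"
      unfolding G_def by (subst prod.reindex) (auto simp: inj_on_def add.commute eq_commute)
    also have "\<dots> = (\<Sum>Z\<in>Pow I. (\<Prod>i\<in>Z. \<epsilon>) * (\<Prod>i\<in>I - Z. of_bool (u (f i) = u i)))"
      by (rule prod_add[OF finI])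
    also have "\<dots> = (\<Sum>Z\<in>Pow I. \<epsilon> ^ card Z * of_bool (\<forall>i\<in>I - Z. u (f i) = u i))"
      using finI by (intro sum.cong refl) (simp add: ob)
    finally show "?F (G f) = (\<Sum>Z\<in>Pow I. \<epsilon> ^ card Z * of_bool (\<forall>i\<in>I - Z. u (f i) = u i))" .
  qed
  also have "\<dots> = (\<Sum>Z\<in>Pow I. \<Sum>f\<in>Fs. \<epsilon> ^ card Z * of_bool (\<forall>i\<in>I - Z. u (f i) = u i))" by (rule sum.swap)
  also have "\<dots> \<le> (\<Sum>Z\<in>Pow I. (\<Prod>s\<in>?S. ff (?\<kappa> s) (card (?I s))) * (\<Prod>s\<in>?S. (\<epsilon> * k) ^ card (Z \<inter> ?I s) / fact (card (Z \<inter> ?I s))))"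
  proof (intro sum_mono)
    fix Z assume "Z \<in> Pow I"
    then have Z: "Z \<subseteq> I" "finite Z" using finI finite_subset by auto
    have "(\<Sum>f\<in>Fs. \<epsilon> ^ card Z * of_bool (\<forall>i\<in>I - Z. u (f i) = u i)) = \<epsilon> ^ card Z * real (card {f \<in> Fs. \<forall>i\<in>I - Z. u (f i) = u i})"
      using finFs by (simp add: sum_distrib_left[symmetric] of_bool_def sum.If_cases Int_def)
    also have "\<dots> \<le> \<epsilon> ^ card Z * real (card {f \<in> I \<rightarrow>\<^sub>E ?K. inj_on f (I - Z) \<and> (\<forall>i\<in>I - Z. u (f i) = u i)})"
      using \<epsilon> finI by (intro mult_left_mono of_nat_mono card_mono) (auto simp: Fs_def intro: inj_on_subset intro!: finite_subset[OF _ finite_PiE[of I "\<lambda>_. ?K"]])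
    also have "\<dots> \<le> \<epsilon> ^ card Z * (real (card ?K) ^ card (I \<inter> Z) * (\<Prod>s\<in>?S. ff (card {j \<in> ?K. u j = s}) (card {i \<in> I - Z. u i = s})))"
      using \<epsilon> I finI by (intro mult_left_mono card_typed_injections) auto
    also have "\<dots> = (\<epsilon> * k) ^ card Z * (\<Prod>s\<in>?S. ff (?\<kappa> s) (card {i \<in> I - Z. u i = s}))"
      using Z by (simp add: Int_absorb1 power_mult_distrib)
    also have "(\<epsilon> * k) ^ card Z = (\<Prod>s\<in>?S. (\<epsilon> * k) ^ card (Z \<inter> ?I s))"
    proof -
      have "Z = (\<Union>s\<in>?S. Z \<inter> ?I s)" using Z I by auto
      then have "card Z = card (\<Union>s\<in>?S. Z \<inter> ?I s)" by (rule arg_cong)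
      also have "\<dots> = (\<Sum>s\<in>?S. card (Z \<inter> ?I s))" using Z by (intro card_UN_disjoint) auto
      finally show ?thesis by (simp add: power_sum)
    qed
    also have "(\<Prod>s\<in>?S. (\<epsilon> * k) ^ card (Z \<inter> ?I s)) * (\<Prod>s\<in>?S. ff (?\<kappa> s) (card {i \<in> I - Z. u i = s}))
       \<le> (\<Prod>s\<in>?S. (\<epsilon> * k) ^ card (Z \<inter> ?I s)) * (\<Prod>s\<in>?S. ff (?\<kappa> s) (card (?I s)) / fact (card (Z \<inter> ?I s)))"
    proof (intro mult_left_mono prod_mono prod_nonneg conjI ff_nonneg)
      fix s
      have "{i \<in> I - Z. u i = s} = ?I s - Z \<inter> ?I s" by auto
      then have c: "card {i \<in> I - Z. u i = s} = card (?I s) - card (Z \<inter> ?I s)"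
        using finI by (simp add: card_Diff_subset Z)
      have "ff (?\<kappa> s) (card (?I s) - card (Z \<inter> ?I s)) * fact (card (Z \<inter> ?I s)) \<le> ff (?\<kappa> s) (card (?I s))"
        using I finI by (intro ff_diff_fact card_mono) auto
      then show "ff (?\<kappa> s) (card {i \<in> I - Z. u i = s}) \<le> ff (?\<kappa> s) (card (?I s)) / fact (card (Z \<inter> ?I s))"
        unfolding c by (simp add: pos_le_divide_eq)
    qed (use \<epsilon> in auto)
    also have "\<dots> = (\<Prod>s\<in>?S. ff (?\<kappa> s) (card (?I s))) * (\<Prod>s\<in>?S. (\<epsilon> * k) ^ card (Z \<inter> ?I s) / fact (card (Z \<inter> ?I s)))"
      by (simp add: prod.distrib[symmetric] mult.commute)
    finally show "(\<Sum>f\<in>Fs. \<epsilon> ^ card Z * of_bool (\<forall>i\<in>I - Z. u (f i) = u i))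
       \<le> (\<Prod>s\<in>?S. ff (?\<kappa> s) (card (?I s))) * (\<Prod>s\<in>?S. (\<epsilon> * k) ^ card (Z \<inter> ?I s) / fact (card (Z \<inter> ?I s)))" .
  qed
  also have "\<dots> = (\<Prod>s\<in>?S. ff (?\<kappa> s) (card (?I s))) * (\<Sum>Z\<in>Pow (\<Union>s\<in>?S. ?I s). \<Prod>s\<in>?S. (\<epsilon> * k) ^ card (Z \<inter> ?I s) / fact (card (Z \<inter> ?I s)))"
  proof -
    have "(\<Union>s\<in>?S. ?I s) = I" using I by auto
    then show ?thesis by (simp add: sum_distrib_left)
  qed
  also have "(\<Sum>Z\<in>Pow (\<Union>s\<in>?S. ?I s). \<Prod>s\<in>?S. (\<epsilon> * k) ^ card (Z \<inter> ?I s) / fact (card (Z \<inter> ?I s)))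
      = (\<Prod>s\<in>?S. \<Sum>Z\<in>Pow (?I s). (\<epsilon> * k) ^ card Z / fact (card Z))"
    using finI by (intro sum_Pow_prod) auto
  also have "(\<Prod>s\<in>?S. ff (?\<kappa> s) (card (?I s))) * \<dots> \<le> (\<Prod>s\<in>?S. ff (?\<kappa> s) (card (?I s))) * (\<Prod>s\<in>?S. exp (2 * real k * sqrt \<epsilon>))"
  proof (intro mult_left_mono prod_mono prod_nonneg conjI ff_nonneg sum_nonneg)
    fix s
    have "card (?I s) \<le> card ?K" using I by (intro card_mono) auto
    then have "(\<Sum>Z\<in>Pow (?I s). (\<epsilon> * k) ^ card Z / fact (card Z)) \<le> exp (2 * sqrt (real k * (\<epsilon> * k)))"
      using finI \<epsilon> by (intro sum_subsets_fact_le) auto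
    also have "sqrt (real k * (\<epsilon> * k)) = k * sqrt \<epsilon>"
      by (simp add: real_sqrt_mult algebra_simps)
    finally show "(\<Sum>Z\<in>Pow (?I s). (\<epsilon> * k) ^ card Z / fact (card Z)) \<le> exp (2 * real k * sqrt \<epsilon>)" by (simp add: mult.assoc)
  qed (use \<epsilon> in auto)
  finally show ?thesis by simp
qed

text \<open>The number of sets \<open>I\<close> with given counts per size is the product of the
  binomial coefficients, so all of them together contribute at most \<open>B\<close>; each size
  admits at most k + 1 counts.\<close>

lemma sum_weighted_subsets:
  fixes u :: "nat \<Rightarrow> nat" and w :: "nat set \<Rightarrow> real"
  assumes "\<And>I. I \<subseteq> {..<k} \<Longrightarrow>
      (\<Prod>s\<in>u ` {..<k}. real (card {j \<in> {..<k}. u j = s} choose card {i \<in> I. u i = s}) * ff (card {j \<in> {..<k}. u j = s}) (card {i \<in> I. u i = s})) * w I \<le> B"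
    and "0 \<le> B"
  shows "(\<Sum>I\<in>Pow {..<k}. w I * (\<Prod>s\<in>u ` {..<k}. ff (card {j \<in> {..<k}. u j = s}) (card {i \<in> I. u i = s})))
     \<le> B * (real k + 1) ^ card (u ` {..<k})"
proof -
  let ?K = "{..<k}" and ?S = "u ` {..<k}" and ?X = "\<lambda>s. {j \<in> {..<k}. u j = s}"
  have XI: "{i \<in> I. u i = s} = I \<inter> ?X s" if "I \<subseteq> ?K" for I s using that by auto
  have "(\<Sum>I\<in>Pow ?K. w I * (\<Prod>s\<in>?S. ff (card (?X s)) (card {i \<in> I. u i = s})))
      \<le> (\<Sum>I\<in>Pow ?K. B * (\<Prod>s\<in>?S. 1 / real (card (?X s) choose card (I \<inter> ?X s))))"
  proof (intro sum_mono)
    fix I assume "I \<in> Pow ?K"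
    then have I: "I \<subseteq> ?K" by auto
    have pos: "0 < (\<Prod>s\<in>?S. real (card (?X s) choose card (I \<inter> ?X s)))"
      by (intro prod_pos) (auto intro!: card_mono)
    have "w I * (\<Prod>s\<in>?S. ff (card (?X s)) (card {i \<in> I. u i = s})) * (\<Prod>s\<in>?S. real (card (?X s) choose card (I \<inter> ?X s))) \<le> B"
      using assms(1)[OF I] by (simp add: XI[OF I] prod.distrib algebra_simps)
    then show "w I * (\<Prod>s\<in>?S. ff (card (?X s)) (card {i \<in> I. u i = s})) \<le> B * (\<Prod>s\<in>?S. 1 / real (card (?X s) choose card (I \<inter> ?X s)))"
      using pos by (simp add: prod_dividef pos_le_divide_eq)
  qed
  also have "\<dots> = B * (\<Sum>I\<in>Pow (\<Union>s\<in>?S. ?X s). \<Prod>s\<in>?S. 1 / real (card (?X s) choose card (I \<inter> ?X s)))"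
  proof -
    have "(\<Union>s\<in>?S. ?X s) = ?K" by auto
    then show ?thesis by (simp only: sum_distrib_left)
  qed
  also have "(\<Sum>I\<in>Pow (\<Union>s\<in>?S. ?X s). \<Prod>s\<in>?S. 1 / real (card (?X s) choose card (I \<inter> ?X s)))
      = (\<Prod>s\<in>?S. \<Sum>Z\<in>Pow (?X s). 1 / real (card (?X s) choose card Z))"
    by (intro sum_Pow_prod) auto
  also have "B * \<dots> \<le> B * (\<Prod>s\<in>?S. real k + 1)"
  proof (intro mult_left_mono prod_mono conjI sum_nonneg)
    fix s
    have "Pow (?X s) = {Z. Z \<subseteq> ?X s \<and> card Z \<in> {..card (?X s)}}" by (auto intro!: card_mono)
    then have "(\<Sum>Z\<in>Pow (?X s). 1 / real (card (?X s) choose card Z)) = (\<Sum>Z\<in>{Z. Z \<subseteq> ?X s \<and> card Z \<in> {..card (?X s)}}. 1 / real (card (?X s) choose card Z))"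
      by (simp only:)
    also have "\<dots> = (\<Sum>t\<in>{..card (?X s)}. real (card (?X s) choose t) * (1 / real (card (?X s) choose t)))"
      by (rule sum_subsets_by_card) auto
    also have "\<dots> = (\<Sum>t\<in>{..card (?X s)}. 1)" by (intro sum.cong refl) auto
    also have "\<dots> \<le> real k + 1"
      using card_mono[of ?K "?X s"] by auto
    finally show "(\<Sum>Z\<in>Pow (?X s). 1 / real (card (?X s) choose card Z)) \<le> real k + 1" .
  qed (use assms(2) in auto)
  finally show ?thesis by simp
qed

section \<open>The second moment for a profile: large overlaps\<close>

text \<open>The weight of two classes sharing \<open>t\<close> vertices, relative to the geometric
  mean of reproducing the first and reproducing the second class completely. It equals 1 for t = u =
  v.\<close>

definition overlap_ratio :: "nat \<Rightarrow> nat \<Rightarrow> nat \<Rightarrow> nat \<Rightarrow> real" where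
  "overlap_ratio n u v t = ff v t * 2 ^ (t choose 2) * sqrt (real n ^ (u - t) * real n ^ (v - t) / (dw u * dw v))"

lemma overlap_ratio_nonneg: "0 \<le> overlap_ratio n u v t"
  by (simp add: overlap_ratio_def less_imp_le)

text \<open>The reciprocal of the expected number of ordered families of disjoint independent sets
  with the sizes \<open>u i\<close>, i in \<open>I\<close>.\<close>

definition subset_weight :: "nat \<Rightarrow> (nat \<Rightarrow> nat) \<Rightarrow> nat set \<Rightarrow> real" where
  "subset_weight n u I = (\<Prod>i\<in>I. dw (u i)) / ff n (\<Sum>i\<in>I. u i)"

lemma subset_weight_nonneg: "0 \<le> subset_weight n u I"
  unfolding subset_weight_def by (intro divide_nonneg_nonneg prod_nonneg) (auto simp: less_imp_le)

text \<open>Compare an overlap pattern with the two patterns in which the row classes, respectively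
  the column classes, are reproduced completely.\<close>

lemma matching_term_le:
  assumes m: "m \<in> matchings k" and un: "(\<Sum>j<k. u j) \<le> n" and t: "\<And>p. p \<in> m \<Longrightarrow> t p \<le> u (fst p)"
  shows "(\<Prod>p\<in>m. ff (u (snd p)) (t p) * 2 ^ (t p choose 2)) / ff n (\<Sum>p\<in>m. t p)
     \<le> (\<Prod>p\<in>m. overlap_ratio n (u (fst p)) (u (snd p)) (t p))
       * ((subset_weight n u (fst ` m) + subset_weight n u (snd ` m)) / 2)"
proof (cases "\<forall>p\<in>m. t p \<le> u (snd p)")
  case False
  then obtain p where p: "p \<in> m" "u (snd p) < t p" by (auto simp: not_le)
  have finm: "finite m" using m by (auto simp: matchings_def intro: finite_subset)
  have "(\<Prod>p\<in>m. ff (u (snd p)) (t p) * 2 ^ (t p choose 2)) = (0::real)"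
    using p finm by (intro prod_zero) (auto simp: ff_eq_0 intro!: bexI[of _ p])
  moreover have "0 \<le> (\<Prod>p\<in>m. overlap_ratio n (u (fst p)) (u (snd p)) (t p))
       * ((subset_weight n u (fst ` m) + subset_weight n u (snd ` m)) / 2)"
    using subset_weight_nonneg[of n u] by (intro mult_nonneg_nonneg prod_nonneg overlap_ratio_nonneg) (simp add: add_nonneg_nonneg)
  ultimately show ?thesis by simp
next
  case True
  have m': "m \<subseteq> {..<k} \<times> {..<k}" "inj_on fst m" "inj_on snd m" using m by (auto simp: matchings_def)
  have finm: "finite m" using m' by (auto intro: finite_subset)
  define R where "R = (\<Sum>p\<in>m. u (fst p))"
  define C where "C = (\<Sum>p\<in>m. u (snd p))"
  define T where "T = (\<Sum>p\<in>m. t p)"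
  have Rs: "(\<Sum>i\<in>fst ` m. u i) = R" using m' by (simp add: R_def sum.reindex)
  have Cs: "(\<Sum>i\<in>snd ` m. u i) = C" using m' by (simp add: C_def sum.reindex)
  have sub: "fst ` m \<subseteq> {..<k}" "snd ` m \<subseteq> {..<k}" using m' by auto
  have Rn: "R \<le> n" unfolding Rs[symmetric] using sum_mono2[OF _ sub(1), of u] un by auto
  have Cn: "C \<le> n" unfolding Cs[symmetric] using sum_mono2[OF _ sub(2), of u] un by auto
  have TR: "T \<le> R" "T \<le> C" unfolding T_def R_def C_def using t True by (auto intro!: sum_mono)
  have RT: "R - T = (\<Sum>p\<in>m. u (fst p) - t p)" "C - T = (\<Sum>p\<in>m. u (snd p) - t p)"
    unfolding T_def R_def C_def using t True by (simp_all add: sum_subtractf_nat)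
  have ffle: "ff n R \<le> ff n T * real n ^ (R - T)" if "T \<le> R" "R \<le> n" for R
  proof -
    have "ff n R = ff n T * ff (n - T) (R - T)" using ff_add[of T n "R - T"] that by simp
    also have "ff (n - T) (R - T) \<le> real n ^ (R - T)"
      using ff_le_power[of "n - T" "R - T"] power_mono[of "real (n - T)" "real n" "R - T"] by simp
    finally show ?thesis by (simp add: mult_left_mono)
  qed
  have pos: "0 < ff n T" "0 < ff n R" "0 < ff n C" using TR Rn Cn by (auto intro!: ff_pos)
  \<comment> \<open>The falling factorial of the common vertices is compared with that of all row
    classes and with that of all column classes; the geometric mean treats both colourings alike and
    later splits by the inequality of arithmetic and geometric means.\<close>
  have "1 / ff n T \<le> sqrt ((real n ^ (R - T) * real n ^ (C - T)) / (ff n R * ff n C))"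
  proof (rule real_le_rsqrt)
    have "ff n R * ff n C \<le> (ff n T * real n ^ (R - T)) * (ff n T * real n ^ (C - T))"
      using ffle TR Rn Cn by (intro mult_mono) auto
    then show "(1 / ff n T)\<^sup>2 \<le> (real n ^ (R - T) * real n ^ (C - T)) / (ff n R * ff n C)"
      using pos by (simp add: field_simps power2_eq_square)
  qed
  then have "(\<Prod>p\<in>m. ff (u (snd p)) (t p) * 2 ^ (t p choose 2)) * (1 / ff n T)
     \<le> (\<Prod>p\<in>m. ff (u (snd p)) (t p) * 2 ^ (t p choose 2)) * sqrt ((real n ^ (R - T) * real n ^ (C - T)) / (ff n R * ff n C))"
    by (intro mult_left_mono prod_nonneg) auto
  also have "\<dots> = (\<Prod>p\<in>m. overlap_ratio n (u (fst p)) (u (snd p)) (t p))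
     * sqrt (subset_weight n u (fst ` m) * subset_weight n u (snd ` m))"
  proof -
    let ?D = "\<Prod>p\<in>m. dw (u (fst p)) * dw (u (snd p))"
    have D: "0 < ?D" by (intro prod_pos) auto
    have w: "subset_weight n u (fst ` m) * subset_weight n u (snd ` m) = ?D / (ff n R * ff n C)"
      unfolding subset_weight_def Rs Cs using m' by (simp add: prod.reindex prod.distrib)
    have sqrt_prod: "sqrt (\<Prod>p\<in>m. f p) = (\<Prod>p\<in>m. sqrt (f p))" for f
      using finm by (induction m rule: finite_induct) (auto simp: real_sqrt_mult)
    have "(\<Prod>p\<in>m. sqrt (real n ^ (u (fst p) - t p) * real n ^ (u (snd p) - t p) / (dw (u (fst p)) * dw (u (snd p)))))
       = sqrt (real n ^ (R - T) * real n ^ (C - T) / ?D)"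
      unfolding sqrt_prod[symmetric] RT by (simp add: prod_dividef prod.distrib power_sum)
    then have "(\<Prod>p\<in>m. overlap_ratio n (u (fst p)) (u (snd p)) (t p))
       = (\<Prod>p\<in>m. ff (u (snd p)) (t p) * 2 ^ (t p choose 2)) * sqrt (real n ^ (R - T) * real n ^ (C - T) / ?D)"
      unfolding overlap_ratio_def by (simp only: prod.distrib)
    moreover have "sqrt (real n ^ (R - T) * real n ^ (C - T) / ?D) * sqrt (?D / (ff n R * ff n C))
       = sqrt ((real n ^ (R - T) * real n ^ (C - T)) / (ff n R * ff n C))"
      using D by (simp add: real_sqrt_mult[symmetric])
    ultimately show ?thesis unfolding w by (simp add: mult.assoc)
  qed
  also have "\<dots> \<le> (\<Prod>p\<in>m. overlap_ratio n (u (fst p)) (u (snd p)) (t p))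
       * ((subset_weight n u (fst ` m) + subset_weight n u (snd ` m)) / 2)"
    by (intro mult_left_mono arith_geo_mean_sqrt prod_nonneg overlap_ratio_nonneg subset_weight_nonneg)
  finally show ?thesis by (simp add: T_def)
qed

definition big_pairs :: "nat \<Rightarrow> nat \<Rightarrow> nat \<Rightarrow> (nat \<Rightarrow> nat) \<Rightarrow> (nat \<Rightarrow> nat) \<Rightarrow> (nat \<times> nat) set" where
  "big_pairs n k L c c' = {p \<in> {..<k} \<times> {..<k}. L \<le> card (cls n c (fst p) \<inter> cls n c' (snd p))}"

text \<open>Two disjoint sets of at least \<open>L\<close> vertices do not fit into a class of fewer
  than 2 L vertices, so a class has at most one large intersection.\<close>

lemma big_pairs_matching:
  assumes c: "c \<in> cols n k u" "c' \<in> cols n k u" and u: "\<And>i. i < k \<Longrightarrow> u i < 2 * L"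
  shows "big_pairs n k L c c' \<in> matchings k"
proof -
  let ?m = "big_pairs n k L c c'" and ?T = "\<lambda>p. cls n c (fst p) \<inter> cls n c' (snd p)"
  have no: False if "p \<in> ?m" "q \<in> ?m" "?T p \<inter> ?T q = {}" "?T p \<union> ?T q \<subseteq> cls n b i" "b \<in> cols n k u" "i < k" for p q b i
  proof -
    have "2 * L \<le> card (?T p) + card (?T q)" using that by (auto simp: big_pairs_def)
    also have "\<dots> = card (?T p \<union> ?T q)" using that(3) by (simp add: card_Un_disjoint)
    also have "\<dots> \<le> card (cls n b i)" using that(4) by (intro card_mono) auto
    also have "\<dots> = u i" using that by (auto simp: cols_def)
    finally show False using u[OF that(6)] by simp
  qed
  have "inj_on fst ?m"
  proof (rule inj_onI, rule ccontr)
    fix p q assume pq: "p \<in> ?m" "q \<in> ?m" "fst p = fst q" "p \<noteq> q"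
    then have "snd p \<noteq> snd q" by (simp add: prod_eq_iff)
    then have "?T p \<inter> ?T q = {}" using cls_disjoint[of "snd p" "snd q" n c'] by blast
    moreover have "?T p \<union> ?T q \<subseteq> cls n c (fst p)" using pq(3) by auto
    moreover have "fst p < k" using pq(1) by (auto simp: big_pairs_def)
    ultimately show False using no[OF pq(1,2)] c by blast
  qed
  moreover have "inj_on snd ?m"
  proof (rule inj_onI, rule ccontr)
    fix p q assume pq: "p \<in> ?m" "q \<in> ?m" "snd p = snd q" "p \<noteq> q"
    then have "fst p \<noteq> fst q" by (simp add: prod_eq_iff)
    then have "?T p \<inter> ?T q = {}" using cls_disjoint[of "fst p" "fst q" n c] by blast
    moreover have "?T p \<union> ?T q \<subseteq> cls n c' (snd p)" using pq(3) by auto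
    moreover have "snd p < k" using pq(1) by (auto simp: big_pairs_def)
    ultimately show False using no[OF pq(1,2)] c by blast
  qed
  ultimately show ?thesis by (auto simp: matchings_def big_pairs_def)
qed

text \<open>Prescribing the large intersections fixes \<open>c'\<close> on their union
  \<open>D\<close>. All other intersections avoid \<open>D\<close> and are small, so they are summed
  conditionally by \<open>small_overlap_sum\<close>; the number of colourings agreeing on
  \<open>D\<close> gives the remaining quotient.\<close>

lemma big_overlap_sum:
  fixes M \<beta> :: real
  assumes c: "c \<in> cols n k u" and L: "0 < L" and M: "0 < M"
    and \<beta>: "0 \<le> \<beta>" "\<And>i j. i < k \<Longrightarrow> j < k \<Longrightarrow> pair_weight (u i) (u j) L (1 / M) \<le> \<beta>"
    and m: "m \<in> matchings k" and h: "\<And>p. p \<in> m \<Longrightarrow> h p \<subseteq> cls n c (fst p)"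
  shows "(\<Sum>c'\<in>{c' \<in> cols n k u. big_pairs n k L c c' = m \<and> (\<forall>p\<in>m. cls n c (fst p) \<inter> cls n c' (snd p) = h p)}.
      overlap_weight n k c c')
    \<le> card (cols n k u) * exp (M + real k ^ 2 * \<beta>)
      * ((\<Prod>p\<in>m. ff (u (snd p)) (card (h p)) * 2 ^ (card (h p) choose 2)) / ff n (\<Sum>p\<in>m. card (h p)))"
    (is "sum _ ?C \<le> ?rhs")
proof (cases "?C = {}")
  case True
  have "0 \<le> ?rhs" by (intro mult_nonneg_nonneg divide_nonneg_nonneg prod_nonneg) auto
  then show ?thesis unfolding True by simp
next
  case False
  then obtain c1 where c1: "c1 \<in> ?C" by blast
  let ?K = "{..<k} \<times> {..<k}"
  have m': "m \<subseteq> ?K" "inj_on fst m" "inj_on snd m" using m by (auto simp: matchings_def)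
  have finm: "finite m" using m' by (auto intro: finite_subset)
  define D where "D = (\<Union>p\<in>m. h p)"
  define P where "P = ?K - m"
  have finh: "finite (h p)" if "p \<in> m" for p by (rule finite_subset[OF h[OF that]]) simp
  have dis: "h p \<inter> h q = {}" if "p \<in> m" "q \<in> m" "p \<noteq> q" for p q
  proof -
    have "fst p \<noteq> fst q" using inj_onD[OF m'(2) _ that(1,2)] that(3) by blast
    then show ?thesis using h[OF that(1)] h[OF that(2)] cls_disjoint[of "fst p" "fst q" n c] by blast
  qed
  have card_UN: "card (\<Union>p\<in>Q. h p) = (\<Sum>p\<in>Q. card (h p))" if "Q \<subseteq> m" for Q
  proof (rule card_UN_disjoint)
    show "finite Q" by (rule finite_subset[OF that finm])
    show "\<forall>p\<in>Q. finite (h p)" using that finh by blast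
    show "\<forall>p\<in>Q. \<forall>q\<in>Q. p \<noteq> q \<longrightarrow> h p \<inter> h q = {}" using that dis by blast
  qed
  have cardD: "card D = (\<Sum>p\<in>m. card (h p))" unfolding D_def by (rule card_UN) simp
  have Dn: "D \<subseteq> {..<n}" unfolding D_def by (intro UN_least order_trans[OF h cls_subset])
  have finD: "finite D" by (rule finite_subset[OF Dn]) simp
  have hB: "h p \<subseteq> cls n c' (snd p)" if "c' \<in> ?C" "p \<in> m" for c' p using that by blast
  have val: "c' v = snd p" if "c' \<in> ?C" "p \<in> m" "v \<in> h p" for c' p v
    using hB[OF that(1,2)] that(3) by (auto simp: cls_def)
  have ext: "?C \<subseteq> ext n k u D c1"
  proof
    fix c' assume c': "c' \<in> ?C"
    have "c' v = c1 v" if "v \<in> D" for v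
      using that val[OF c'] val[OF c1] by (auto simp: D_def)
    then show "c' \<in> ext n k u D c1" using c' by (auto simp: ext_def)
  qed
  have small: "(\<Sum>c'\<in>?C. \<Prod>p\<in>P. 2 ^ (card (cls n c (fst p) \<inter> cls n c' (snd p)) choose 2))
     \<le> card (ext n k u D c1) * exp M * exp (\<Sum>p\<in>P. pair_weight (u (fst p)) (u (snd p)) L (1 / M))"
  proof (rule small_overlap_sum[OF c Dn _ L ext])
    show "P \<subseteq> ?K" by (auto simp: P_def)
  next
    fix c' p assume "c' \<in> ?C" "p \<in> P"
    then show "card (cls n c (fst p) \<inter> cls n c' (snd p)) < L" by (auto simp: P_def big_pairs_def not_le)
  next
    fix c' p assume c': "c' \<in> ?C" and p: "p \<in> P"
    show "cls n c (fst p) \<inter> cls n c' (snd p) \<inter> D = {}"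
    proof (rule ccontr)
      assume "cls n c (fst p) \<inter> cls n c' (snd p) \<inter> D \<noteq> {}"
      then obtain v q where v: "v \<in> cls n c (fst p)" "v \<in> cls n c' (snd p)" "q \<in> m" "v \<in> h q"
        by (auto simp: D_def)
      have "fst q = fst p" using h[OF v(3)] v by (auto simp: cls_def)
      moreover have "snd q = snd p" using val[OF c' v(3,4)] v(2) by (simp add: cls_def)
      ultimately have "q = p" by (simp add: prod_eq_iff)
      then show False using v(3) p by (simp add: P_def)
    qed
  next
    fix t assume t: "t \<le> n - card D"
    \<comment> \<open>The profile may cover almost all vertices, so \<open>t\<close> may reach n -
      card D and the factors of the falling factorial may become small. The bound M^t <= exp M * t!
      holds for every \<open>t\<close>; its price is the factor exp M.\<close>
    have "M ^ t / fact t \<le> (\<Sum>z\<le>t. M ^ z / fact z)"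
      by (rule member_le_sum[of t "{..t}" "\<lambda>z. M ^ z / fact z"]) (use M in auto)
    also have "\<dots> \<le> exp M" using M by (intro sum_power_fact_le_exp) simp
    finally have "M ^ t \<le> exp M * fact t" by (simp add: pos_divide_le_eq)
    also have "\<dots> \<le> exp M * ff (n - card D) t" using ff_ge_fact[OF t] by (intro mult_left_mono) auto
    finally show "1 \<le> exp M * (1 / M) ^ t * ff (n - card D) t"
      using M by (simp add: power_divide field_simps)
  qed (use M in auto)
  have pw: "(\<Sum>p\<in>P. pair_weight (u (fst p)) (u (snd p)) L (1 / M)) \<le> real k ^ 2 * \<beta>"
  proof -
    have "(\<Sum>p\<in>P. pair_weight (u (fst p)) (u (snd p)) L (1 / M)) \<le> (\<Sum>p\<in>P. \<beta>)"
      by (intro sum_mono \<beta>) (auto simp: P_def)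
    also have "\<dots> = real (card P) * \<beta>" by simp
    also have "real (card P) \<le> real k ^ 2"
    proof -
      have "card P \<le> card ?K" by (intro card_mono) (auto simp: P_def)
      then have "real (card P) \<le> real (card ?K)" by (rule of_nat_mono)
      then show ?thesis by (simp add: card_cartesian_product power2_eq_square)
    qed
    finally show ?thesis using \<beta>(1) by (simp add: mult_right_mono)
  qed
  have small2: "(\<Sum>c'\<in>?C. \<Prod>p\<in>P. 2 ^ (card (cls n c (fst p) \<inter> cls n c' (snd p)) choose 2))
     \<le> card (ext n k u D c1) * exp M * exp (real k ^ 2 * \<beta>)"
  proof -
    have "card (ext n k u D c1) * exp M * exp (\<Sum>p\<in>P. pair_weight (u (fst p)) (u (snd p)) L (1 / M))
        \<le> card (ext n k u D c1) * exp M * exp (real k ^ 2 * \<beta>)" using pw by (intro mult_left_mono) auto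
    then show ?thesis using small by (rule order_trans[rotated])
  qed
  have prod_le: "(\<Prod>j<k. ff (u j) (card {v \<in> D. c1 v = j})) \<le> (\<Prod>p\<in>m. ff (u (snd p)) (card (h p)))"
  proof -
    have "(\<Prod>j<k. ff (u j) (card {v \<in> D. c1 v = j})) \<le> (\<Prod>j<k. \<Prod>p\<in>{p \<in> m. snd p = j}. ff (u (snd p)) (card (h p)))"
    proof (intro prod_mono conjI ff_nonneg)
      fix j
      have "{v \<in> D. c1 v = j} = (\<Union>p\<in>{p \<in> m. snd p = j}. h p)"
        using val[OF c1] by (auto simp: D_def)
      then have "card {v \<in> D. c1 v = j} = (\<Sum>p\<in>{p \<in> m. snd p = j}. card (h p))" by (simp add: card_UN)
      then have "ff (u j) (card {v \<in> D. c1 v = j}) \<le> (\<Prod>p\<in>{p \<in> m. snd p = j}. ff (u j) (card (h p)))"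
        using ff_sum_le[of "{p \<in> m. snd p = j}" "u j" "\<lambda>p. card (h p)"] finm by simp
      also have "\<dots> = (\<Prod>p\<in>{p \<in> m. snd p = j}. ff (u (snd p)) (card (h p)))" by (intro prod.cong) auto
      finally show "ff (u j) (card {v \<in> D. c1 v = j}) \<le> (\<Prod>p\<in>{p \<in> m. snd p = j}. ff (u (snd p)) (card (h p)))" .
    qed
    also have "\<dots> = (\<Prod>p\<in>m. ff (u (snd p)) (card (h p)))"
      using m' finm by (intro prod.group) auto
    finally show ?thesis .
  qed
  have ffD: "0 < ff n (card D)" using Dn card_mono[of "{..<n}" D] by (intro ff_pos) simp
  have "card (ext n k u ({} \<union> D) c1) * ff (n - card ({} :: nat set)) (card D)
      \<le> card (ext n k u {} c1) * (\<Prod>j<k. ff (u j) (card {v \<in> D. c1 v = j}))"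
  proof (rule card_ext_le)
    fix v assume "v \<in> D"
    then show "c1 v < k" using val[OF c1] m'(1) by (auto simp: D_def)
  qed (use finD Dn in auto)
  also have "\<dots> \<le> card (cols n k u) * (\<Prod>p\<in>m. ff (u (snd p)) (card (h p)))"
    using prod_le by (simp add: ext_def mult_left_mono)
  finally have extD: "card (ext n k u D c1) \<le> card (cols n k u) * (\<Prod>p\<in>m. ff (u (snd p)) (card (h p))) / ff n (card D)"
    using ffD by (simp add: pos_le_divide_eq)
  have "(\<Sum>c'\<in>?C. overlap_weight n k c c')
     = (\<Sum>c'\<in>?C. (\<Prod>p\<in>m. 2 ^ (card (h p) choose 2)) * (\<Prod>p\<in>P. 2 ^ (card (cls n c (fst p) \<inter> cls n c' (snd p)) choose 2)))"
  proof (intro sum.cong refl)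
    fix c' assume c': "c' \<in> ?C"
    have "overlap_weight n k c c' = (\<Prod>p\<in>P. 2 ^ (card (cls n c (fst p) \<inter> cls n c' (snd p)) choose 2))
        * (\<Prod>p\<in>m. 2 ^ (card (cls n c (fst p) \<inter> cls n c' (snd p)) choose 2))"
      unfolding overlap_weight_def P_def using m' by (intro prod.subset_diff) auto
    also have "(\<Prod>p\<in>m. 2 ^ (card (cls n c (fst p) \<inter> cls n c' (snd p)) choose 2)) = (\<Prod>p\<in>m. (2::real) ^ (card (h p) choose 2))"
      using c' by (intro prod.cong) auto
    finally show "overlap_weight n k c c' = (\<Prod>p\<in>m. 2 ^ (card (h p) choose 2)) * (\<Prod>p\<in>P. 2 ^ (card (cls n c (fst p) \<inter> cls n c' (snd p)) choose 2))"
      by simp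
  qed
  also have "\<dots> = (\<Prod>p\<in>m. 2 ^ (card (h p) choose 2)) * (\<Sum>c'\<in>?C. \<Prod>p\<in>P. 2 ^ (card (cls n c (fst p) \<inter> cls n c' (snd p)) choose 2))"
    by (simp add: sum_distrib_left)
  also have "\<dots> \<le> (\<Prod>p\<in>m. 2 ^ (card (h p) choose 2)) * (card (ext n k u D c1) * exp M * exp (real k ^ 2 * \<beta>))"
    by (intro mult_left_mono small2 prod_nonneg) auto
  also have "\<dots> = exp (M + real k ^ 2 * \<beta>) * (\<Prod>p\<in>m. 2 ^ (card (h p) choose 2)) * card (ext n k u D c1)"
    by (simp add: exp_add)
  also have "\<dots> \<le> exp (M + real k ^ 2 * \<beta>) * (\<Prod>p\<in>m. 2 ^ (card (h p) choose 2)) * (card (cols n k u) * (\<Prod>p\<in>m. ff (u (snd p)) (card (h p))) / ff n (card D))"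
    by (intro mult_left_mono extD mult_nonneg_nonneg prod_nonneg) auto
  also have "\<dots> = ?rhs" by (simp add: cardD prod.distrib)
  finally show ?thesis .
qed

text \<open>The second colouring is sorted by the matching of classes with large intersections and
  by these intersections. Relative to complete reproduction, a matched pair contributes 1 for equal
  sizes, up to an error \<open>\<epsilon>\<close>. What remains is a sum over the set
  \<open>I\<close> of reproduced classes, and \<open>B\<close> bounds the contribution of the
  colourings that share a given number of whole classes of each size.\<close>

theorem second_moment_profile:
  fixes M \<beta> \<epsilon> B :: real
  assumes un: "(\<Sum>j<k. u j) \<le> n" and L: "0 < L" and uL: "\<And>i. i < k \<Longrightarrow> u i < 2 * L" and M: "0 < M"
    and \<beta>: "0 \<le> \<beta>" "\<And>i j. i < k \<Longrightarrow> j < k \<Longrightarrow> pair_weight (u i) (u j) L (1 / M) \<le> \<beta>"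
    and \<epsilon>: "0 \<le> \<epsilon>" "\<And>i j. i < k \<Longrightarrow> j < k \<Longrightarrow>
      (\<Sum>t\<in>{L..u i}. real (u i choose t) * overlap_ratio n (u i) (u j) t) \<le> of_bool (u i = u j) + \<epsilon>"
    and B: "0 \<le> B" "\<And>I. I \<subseteq> {..<k} \<Longrightarrow>
      (\<Prod>s\<in>u ` {..<k}. real (card {j \<in> {..<k}. u j = s} choose card {i \<in> I. u i = s}) * ff (card {j \<in> {..<k}. u j = s}) (card {i \<in> I. u i = s}))
        * subset_weight n u I \<le> B"
  shows "(cp (n - (\<Sum>j<k. u j)) f)\<^sup>2
     \<le> exp (M + real k ^ 2 * \<beta>) * (exp (2 * real k * sqrt \<epsilon>) * (real k + 1)) ^ card (u ` {..<k}) * B * cp n (f + k)"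
proof -
  let ?C = "cols n k u" and ?K = "{..<k}" and ?S = "u ` {..<k}"
  have key: "(\<Sum>c'\<in>cols n k u. overlap_weight n k c c')
      \<le> exp (M + real k ^ 2 * \<beta>) * (exp (2 * real k * sqrt \<epsilon>) * (real k + 1)) ^ card (u ` {..<k}) * B * card (cols n k u)"
    if c: "c \<in> cols n k u" for c
  proof -
  let ?T = "\<lambda>c' p. cls n c (fst p) \<inter> cls n c' (snd p)"
  let ?w = "subset_weight n u"
  let ?A = "exp (M + real k ^ 2 * \<beta>)"
  define F where "F p = {T. T \<subseteq> cls n c (fst p) \<and> L \<le> card T}" for p :: "nat \<times> nat"
  have finF: "finite (F p)" for p
    by (rule finite_subset[of _ "Pow (cls n c (fst p))"]) (auto simp: F_def)
  define \<Phi> where "\<Phi> c' = (big_pairs n k L c c', \<lambda>p\<in>big_pairs n k L c c'. ?T c' p)" for c'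
  define Y where "Y = Sigma (matchings k) (\<lambda>m. PiE m F)"
  have finm: "finite m" if "m \<in> matchings k" for m
    using that by (auto simp: matchings_def intro: finite_subset)
  have finY: "finite Y" unfolding Y_def using finm finF by (intro finite_SigmaI finite_PiE) auto
  have \<Phi>Y: "\<Phi> ` ?C \<subseteq> Y"
  proof (rule image_subsetI)
    fix c' assume "c' \<in> ?C"
    then have "big_pairs n k L c c' \<in> matchings k" by (rule big_pairs_matching[OF c _ uL])
    moreover have "(\<lambda>p\<in>big_pairs n k L c c'. ?T c' p) \<in> PiE (big_pairs n k L c c') F"
      by (auto simp: F_def big_pairs_def)
    ultimately show "\<Phi> c' \<in> Y" by (simp add: Y_def \<Phi>_def)
  qed
  have uc: "card (cls n c i) = u i" if "i < k" for i using c that by (auto simp: cols_def)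
  have fibre: "(\<Sum>c'\<in>{c' \<in> ?C. \<Phi> c' = (m, h)}. overlap_weight n k c c')
     \<le> card ?C * ?A * ((\<Prod>p\<in>m. overlap_ratio n (u (fst p)) (u (snd p)) (card (h p))) * ((?w (fst ` m) + ?w (snd ` m)) / 2))"
    if m: "m \<in> matchings k" and h: "h \<in> PiE m F" for m h
  proof -
    have hF: "h p \<subseteq> cls n c (fst p)" if "p \<in> m" for p using PiE_mem[OF h that] by (simp add: F_def)
    have hc: "card (h p) \<le> u (fst p)" if "p \<in> m" for p
    proof -
      have "fst p < k" using that m by (auto simp: matchings_def)
      then show ?thesis using card_mono[OF _ hF[OF that]] uc by simp
    qed
    have "(\<Sum>c'\<in>{c' \<in> ?C. \<Phi> c' = (m, h)}. overlap_weight n k c c')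
      \<le> (\<Sum>c'\<in>{c' \<in> ?C. big_pairs n k L c c' = m \<and> (\<forall>p\<in>m. ?T c' p = h p)}. overlap_weight n k c c')"
      by (intro sum_mono2) (auto simp: \<Phi>_def overlap_weight_def intro!: prod_nonneg)
    also have "\<dots> \<le> card ?C * ?A * ((\<Prod>p\<in>m. ff (u (snd p)) (card (h p)) * 2 ^ (card (h p) choose 2)) / ff n (\<Sum>p\<in>m. card (h p)))"
      by (rule big_overlap_sum[OF c L M \<beta> m hF])
    also have "\<dots> \<le> card ?C * ?A * ((\<Prod>p\<in>m. overlap_ratio n (u (fst p)) (u (snd p)) (card (h p))) * ((?w (fst ` m) + ?w (snd ` m)) / 2))"
      by (intro mult_left_mono matching_term_le[OF m un hc]) auto
    finally show ?thesis .
  qed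
  let ?E = "\<lambda>p. of_bool (u (fst p) = u (snd p)) + \<epsilon>"
  have "(\<Sum>c'\<in>?C. overlap_weight n k c c') = (\<Sum>y\<in>Y. \<Sum>c'\<in>{c' \<in> ?C. \<Phi> c' = y}. overlap_weight n k c c')"
    using finY \<Phi>Y by (intro sum.group[symmetric]) auto
  also have "\<dots> = (\<Sum>m\<in>matchings k. \<Sum>h\<in>PiE m F. \<Sum>c'\<in>{c' \<in> ?C. \<Phi> c' = (m, h)}. overlap_weight n k c c')"
    unfolding Y_def using finm finF by (subst sum.Sigma) (auto intro!: finite_PiE sum.cong)
  also have "\<dots> \<le> (\<Sum>m\<in>matchings k. \<Sum>h\<in>PiE m F. card ?C * ?A * ((\<Prod>p\<in>m. overlap_ratio n (u (fst p)) (u (snd p)) (card (h p))) * ((?w (fst ` m) + ?w (snd ` m)) / 2)))"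
    by (intro sum_mono fibre)
  also have "\<dots> = card ?C * ?A * (\<Sum>m\<in>matchings k. (\<Prod>p\<in>m. \<Sum>T\<in>F p. overlap_ratio n (u (fst p)) (u (snd p)) (card T)) * ((?w (fst ` m) + ?w (snd ` m)) / 2))"
    unfolding sum_distrib_left
  proof (intro sum.cong refl)
    fix m assume "m \<in> matchings k"
    then have "(\<Prod>p\<in>m. \<Sum>T\<in>F p. overlap_ratio n (u (fst p)) (u (snd p)) (card T))
       = (\<Sum>h\<in>PiE m F. \<Prod>p\<in>m. overlap_ratio n (u (fst p)) (u (snd p)) (card (h p)))"
      using finm finF by (intro prod_sum_PiE) auto
    then show "(\<Sum>h\<in>PiE m F. card ?C * ?A * ((\<Prod>p\<in>m. overlap_ratio n (u (fst p)) (u (snd p)) (card (h p))) * ((?w (fst ` m) + ?w (snd ` m)) / 2)))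
      = card ?C * ?A * ((\<Prod>p\<in>m. \<Sum>T\<in>F p. overlap_ratio n (u (fst p)) (u (snd p)) (card T)) * ((?w (fst ` m) + ?w (snd ` m)) / 2))"
      by (simp only: sum_distrib_left sum_distrib_right)
  qed
  also have "\<dots> \<le> card ?C * ?A * (\<Sum>m\<in>matchings k. (\<Prod>p\<in>m. ?E p) * ((?w (fst ` m) + ?w (snd ` m)) / 2))"
  proof (intro mult_left_mono sum_mono mult_right_mono prod_mono conjI sum_nonneg overlap_ratio_nonneg)
    fix m p assume "m \<in> matchings k" "p \<in> m"
    then have p: "fst p < k" "snd p < k" by (auto simp: matchings_def)
    have "F p = {T. T \<subseteq> cls n c (fst p) \<and> card T \<in> {L..u (fst p)}}"
      using card_mono[of "cls n c (fst p)"] uc[OF p(1)] by (auto simp: F_def)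
    then have "(\<Sum>T\<in>F p. overlap_ratio n (u (fst p)) (u (snd p)) (card T))
       = (\<Sum>T\<in>{T. T \<subseteq> cls n c (fst p) \<and> card T \<in> {L..u (fst p)}}. overlap_ratio n (u (fst p)) (u (snd p)) (card T))"
      by (simp only:)
    also have "\<dots> = (\<Sum>t\<in>{L..u (fst p)}. real (card (cls n c (fst p)) choose t) * overlap_ratio n (u (fst p)) (u (snd p)) t)"
      by (rule sum_subsets_by_card) (auto simp: overlap_ratio_nonneg)
    also have "\<dots> \<le> ?E p" unfolding uc[OF p(1)] by (rule \<epsilon>(2)[OF p])
    finally show "(\<Sum>T\<in>F p. overlap_ratio n (u (fst p)) (u (snd p)) (card T)) \<le> ?E p" .
  next
    fix m show "0 \<le> (?w (fst ` m) + ?w (snd ` m)) / 2"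
      using subset_weight_nonneg[of n u] by (simp add: add_nonneg_nonneg)
  qed auto
  also have "(\<Sum>m\<in>matchings k. (\<Prod>p\<in>m. ?E p) * ((?w (fst ` m) + ?w (snd ` m)) / 2)) = (\<Sum>m\<in>matchings k. (\<Prod>p\<in>m. ?E p) * ?w (fst ` m))"
  proof -
    \<comment> \<open>Transposing a matching exchanges rows and columns and preserves its weight, so
      both halves of the arithmetic mean have the same sum.\<close>
    have "(\<Sum>m\<in>matchings k. (\<Prod>p\<in>m. ?E p) * ?w (snd ` m)) = (\<Sum>m\<in>matchings k. (\<Prod>p\<in>m. ?E p) * ?w (fst ` m))"
    proof (rule sum.reindex_bij_witness[of _ "(`) prod.swap" "(`) prod.swap"])
      fix m assume m: "m \<in> matchings k"
      show "prod.swap ` m \<in> matchings k"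
        using m by (auto simp: matchings_def inj_on_def)
      have "(\<Prod>p\<in>prod.swap ` m. ?E p) = (\<Prod>p\<in>m. ?E p)"
        by (subst prod.reindex) (auto simp: eq_commute)
      moreover have "fst ` prod.swap ` m = snd ` m" by (simp add: image_image)
      ultimately show "(\<Prod>p\<in>prod.swap ` m. ?E p) * ?w (fst ` prod.swap ` m) = (\<Prod>p\<in>m. ?E p) * ?w (snd ` m)" by simp
    qed (auto simp: image_image matchings_def inj_on_def)
    then show ?thesis by (simp add: distrib_left sum.distrib sum_divide_distrib[symmetric] add_divide_distrib)
  qed
  also have "\<dots> = (\<Sum>I\<in>Pow ?K. \<Sum>m\<in>{m \<in> matchings k. fst ` m = I}. (\<Prod>p\<in>m. ?E p) * ?w (fst ` m))"
    by (intro sum.group[symmetric]) (auto simp: matchings_def)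
  also have "\<dots> = (\<Sum>I\<in>Pow ?K. ?w I * (\<Sum>m\<in>{m \<in> matchings k. fst ` m = I}. \<Prod>p\<in>m. ?E p))"
    unfolding sum_distrib_left by (intro sum.cong refl) auto
  also have "card ?C * ?A * \<dots> \<le> card ?C * ?A * (\<Sum>I\<in>Pow ?K. ?w I * ((\<Prod>s\<in>?S. ff (card {j \<in> ?K. u j = s}) (card {i \<in> I. u i = s})) * exp (2 * real k * sqrt \<epsilon>) ^ card ?S))"
  proof (rule mult_left_mono, rule sum_mono, rule mult_left_mono)
    fix I assume "I \<in> Pow ?K"
    then have I: "I \<subseteq> ?K" by simp
    show "(\<Sum>m\<in>{m \<in> matchings k. fst ` m = I}. \<Prod>p\<in>m. ?E p)
       \<le> (\<Prod>s\<in>?S. ff (card {j \<in> ?K. u j = s}) (card {i \<in> I. u i = s})) * exp (2 * real k * sqrt \<epsilon>) ^ card ?S"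
      using sum_matchings_with_domain[OF I \<epsilon>(1), of u] by simp
    show "0 \<le> ?w I" by (rule subset_weight_nonneg)
  qed simp
  also have "\<dots> = card ?C * ?A * exp (2 * real k * sqrt \<epsilon>) ^ card ?S * (\<Sum>I\<in>Pow ?K. ?w I * (\<Prod>s\<in>?S. ff (card {j \<in> ?K. u j = s}) (card {i \<in> I. u i = s})))"
    unfolding sum_distrib_left by (intro sum.cong refl) simp
  also have "\<dots> \<le> card ?C * ?A * exp (2 * real k * sqrt \<epsilon>) ^ card ?S * (B * (real k + 1) ^ card ?S)"
    by (intro mult_left_mono sum_weighted_subsets B) auto
  also have "\<dots> = ?A * (exp (2 * real k * sqrt \<epsilon>) * (real k + 1)) ^ card ?S * B * card ?C"
    by (simp add: power_mult_distrib)
  finally show ?thesis .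
  qed
  show ?thesis by (rule cp_second_moment[OF un key])
qed

section \<open>The first moment bound\<close>

text \<open>A saddle point bound: the left-hand side is the factorial times the coefficient of z^n,
  n = card V, in the k-th power of the exponential generating function of \<open>g\<close>. Having
  nonnegative coefficients, this is at most the value at \<open>\<rho>\<close> divided by
  \<open>\<rho>\<close>^n.\<close>

lemma sum_colourings_le:
  fixes g :: "nat \<Rightarrow> real"
  assumes g: "\<And>i. 0 \<le> g i" and \<rho>: "0 < \<rho>" and Y: "\<And>N. (\<Sum>i\<le>N. g i * \<rho> ^ i / fact i) \<le> Y" and "finite V"
  shows "(\<Sum>f\<in>V \<rightarrow>\<^sub>E {..<k}. \<Prod>j<k. g (card {v \<in> V. f v = j})) \<le> fact (card V) / \<rho> ^ card V * Y ^ k"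
  using \<open>finite V\<close>
proof (induction k arbitrary: V)
  case 0
  show ?case
  proof (cases "V = {}")
    case False
    then have "V \<rightarrow>\<^sub>E {..<0::nat} = {}" by (auto simp: PiE_eq_empty_iff)
    then show ?thesis using \<rho> by simp
  qed simp
next
  case (Suc k)
  have Y0: "0 \<le> Y" using Y[of 0] g[of 0] by simp
  define \<phi> where "\<phi> f = ({v \<in> V. f v = k}, restrict f (V - {v \<in> V. f v = k}))" for f :: "'a \<Rightarrow> nat"
  define S where "S = (SIGMA T:Pow V. (V - T) \<rightarrow>\<^sub>E {..<k})"
  define H where "H = (\<lambda>(T, f). g (card T) * (\<Prod>j<k. g (card {v \<in> V - T. f v = j})))"
  have finS: "finite S" unfolding S_def using Suc.prems by (intro finite_SigmaI finite_PiE) auto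
  have inj: "inj_on \<phi> (V \<rightarrow>\<^sub>E {..<Suc k})"
  proof (rule inj_onI)
    fix f f' assume f: "f \<in> V \<rightarrow>\<^sub>E {..<Suc k}" "f' \<in> V \<rightarrow>\<^sub>E {..<Suc k}" and eq: "\<phi> f = \<phi> f'"
    have T: "{v \<in> V. f v = k} = {v \<in> V. f' v = k}" using eq by (simp add: \<phi>_def)
    have R: "restrict f (V - {v \<in> V. f v = k}) = restrict f' (V - {v \<in> V. f v = k})" using eq T by (simp add: \<phi>_def)
    show "f = f'"
    proof (rule PiE_ext[OF f])
      fix v assume v: "v \<in> V"
      show "f v = f' v"
      proof (cases "f v = k")
        case True
        then have "v \<in> {v \<in> V. f v = k}" using v by simp
        then have "v \<in> {v \<in> V. f' v = k}" unfolding T .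
        then show ?thesis using True by simp
      next
        case False
        then show ?thesis using fun_cong[OF R, of v] v by simp
      qed
    qed
  qed
  have im: "\<phi> ` (V \<rightarrow>\<^sub>E {..<Suc k}) \<subseteq> S"
    by (fastforce simp: \<phi>_def S_def PiE_def Pi_def extensional_def less_Suc_eq)
  have "(\<Sum>f\<in>V \<rightarrow>\<^sub>E {..<Suc k}. \<Prod>j<Suc k. g (card {v \<in> V. f v = j})) = (\<Sum>f\<in>V \<rightarrow>\<^sub>E {..<Suc k}. H (\<phi> f))"
  proof (intro sum.cong refl)
    fix f
    have "{v \<in> V - {v \<in> V. f v = k}. restrict f (V - {v \<in> V. f v = k}) v = j} = {v \<in> V. f v = j}" if "j < k" for j
      using that by auto
    then show "(\<Prod>j<Suc k. g (card {v \<in> V. f v = j})) = H (\<phi> f)"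
      by (simp add: H_def \<phi>_def mult.commute cong: prod.cong_simp)
  qed
  also have "\<dots> = (\<Sum>y\<in>\<phi> ` (V \<rightarrow>\<^sub>E {..<Suc k}). H y)" by (simp add: sum.reindex[OF inj])
  also have "\<dots> \<le> (\<Sum>y\<in>S. H y)"
    using finS im g by (intro sum_mono2) (auto simp: H_def intro!: mult_nonneg_nonneg prod_nonneg)
  also have "\<dots> = (\<Sum>T\<in>Pow V. \<Sum>f\<in>(V - T) \<rightarrow>\<^sub>E {..<k}. g (card T) * (\<Prod>j<k. g (card {v \<in> V - T. f v = j})))"
    unfolding S_def H_def using Suc.prems by (subst sum.Sigma) (auto intro!: finite_PiE)
  also have "\<dots> \<le> (\<Sum>T\<in>Pow V. g (card T) * (fact (card V - card T) / \<rho> ^ (card V - card T) * Y ^ k))"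
  proof (intro sum_mono)
    fix T assume "T \<in> Pow V"
    then have c: "finite (V - T)" "card (V - T) = card V - card T"
      using Suc.prems by (auto simp: card_Diff_subset finite_subset)
    have "(\<Sum>f\<in>(V - T) \<rightarrow>\<^sub>E {..<k}. g (card T) * (\<Prod>j<k. g (card {v \<in> V - T. f v = j})))
       = g (card T) * (\<Sum>f\<in>(V - T) \<rightarrow>\<^sub>E {..<k}. \<Prod>j<k. g (card {v \<in> V - T. f v = j}))"
      by (simp only: sum_distrib_left)
    also have "\<dots> \<le> g (card T) * (fact (card (V - T)) / \<rho> ^ card (V - T) * Y ^ k)"
      by (intro mult_left_mono Suc.IH c g)
    finally show "(\<Sum>f\<in>(V - T) \<rightarrow>\<^sub>E {..<k}. g (card T) * (\<Prod>j<k. g (card {v \<in> V - T. f v = j})))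
       \<le> g (card T) * (fact (card V - card T) / \<rho> ^ (card V - card T) * Y ^ k)" by (simp only: c)
  qed
  also have "\<dots> = (\<Sum>t\<le>card V. real (card V choose t) * (g t * (fact (card V - t) / \<rho> ^ (card V - t) * Y ^ k)))"
  proof -
    have "Pow V = {T. T \<subseteq> V \<and> card T \<in> {..card V}}" using Suc.prems by (auto intro: card_mono)
    then show ?thesis
      using Suc.prems g Y0 \<rho>
      by (simp only:) (intro sum_subsets_by_card[of V "{..card V}" "\<lambda>t. g t * (fact (card V - t) / \<rho> ^ (card V - t) * Y ^ k)"] mult_nonneg_nonneg; auto)
  qed
  also have "\<dots> = (\<Sum>t\<le>card V. fact (card V) / \<rho> ^ card V * Y ^ k * (g t * \<rho> ^ t / fact t))"
  proof (intro sum.cong refl)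
    fix t assume "t \<in> {..card V}"
    then have t: "t \<le> card V" by simp
    have "\<rho> ^ card V = \<rho> ^ (card V - t) * \<rho> ^ t" using t by (simp add: power_add[symmetric])
    then show "real (card V choose t) * (g t * (fact (card V - t) / \<rho> ^ (card V - t) * Y ^ k))
        = fact (card V) / \<rho> ^ card V * Y ^ k * (g t * \<rho> ^ t / fact t)"
      using \<rho> t by (simp add: binomial_fact mult_ac)
  qed
  also have "\<dots> = fact (card V) / \<rho> ^ card V * Y ^ k * (\<Sum>t\<le>card V. g t * \<rho> ^ t / fact t)"
    by (simp only: sum_distrib_left)
  also have "\<dots> \<le> fact (card V) / \<rho> ^ card V * Y ^ k * Y"
    using Y Y0 \<rho> by (intro mult_left_mono) auto
  finally show ?case by (simp add: mult.assoc mult.commute[of Y])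
qed

definition indep_sets :: "nat \<Rightarrow> nat \<Rightarrow> nat set set \<Rightarrow> nat set set" where
  "indep_sets n a E = {T. T \<subseteq> {..<n} \<and> card T = a \<and> E \<inter> edges_in T = {}}"

lemma av_card_indep_sets: "av (edges_in {..<n}) (\<lambda>E. real (card (indep_sets n a E))) \<le> real n ^ a / dw a"
proof -
  let ?Z = "edges_in {..<n}" and ?A = "{T. T \<subseteq> {..<n} \<and> card T = a}"
  have finA: "finite ?A" by (rule finite_subset[of _ "Pow {..<n}"]) auto
  have "real (card (indep_sets n a E)) = (\<Sum>T\<in>?A. of_bool (E \<inter> edges_in T = {}))" for E
  proof -
    have "indep_sets n a E = ?A \<inter> {T. E \<inter> edges_in T = {}}" by (auto simp: indep_sets_def)
    then show ?thesis using finA by (simp add: of_bool_def sum.If_cases)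
  qed
  then have "av ?Z (\<lambda>E. real (card (indep_sets n a E))) = (\<Sum>T\<in>?A. av ?Z (\<lambda>E. of_bool (E \<inter> edges_in T = {})))"
    by (simp only: av_sum)
  also have "\<dots> = (\<Sum>T\<in>?A. 1 / 2 ^ (a choose 2))"
  proof (intro sum.cong refl)
    fix T assume "T \<in> ?A"
    then have T: "T \<subseteq> {..<n}" "card T = a" "finite T" using finite_subset by auto
    then show "av ?Z (\<lambda>E. of_bool (E \<inter> edges_in T = {})) = 1 / 2 ^ (a choose 2)"
      by (subst av_avoid) (auto simp: card_edges_in edges_in_mono)
  qed
  also have "\<dots> = real (n choose a) / 2 ^ (a choose 2)" using n_subsets[of "{..<n}" a] by simp
  also have "real (n choose a) \<le> real n ^ a / fact a"
  proof (cases "a \<le> n")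
    case True
    then have "real (n choose a) = ff n a / fact a" by (simp add: binomial_fact ff_fact)
    then show ?thesis by (simp add: divide_right_mono ff_le_power)
  qed (simp add: binomial_eq_0)
  finally show ?thesis by (simp add: dw_def divide_right_mono mult.commute)
qed

text \<open>Classes are nonempty so that permuting the colours yields k! different colourings; the
  bound \<open>b\<close> records that a graph with few independent sets of size \<open>a\<close>
  admits few classes of this size.\<close>

definition good_colourings :: "nat \<Rightarrow> nat \<Rightarrow> nat \<Rightarrow> nat \<Rightarrow> nat set set \<Rightarrow> (nat \<Rightarrow> nat) set" where
  "good_colourings n a b k E = {f \<in> {..<n} \<rightarrow>\<^sub>E {..<k}.
     (\<forall>j<k. cls n f j \<noteq> {} \<and> card (cls n f j) \<le> a \<and> E \<inter> edges_in (cls n f j) = {}) \<and>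
     card {j \<in> {..<k}. card (cls n f j) = a} \<le> b}"

lemma finite_good_colourings [simp]: "finite (good_colourings n a b k E)"
  by (rule finite_subset[of _ "{..<n} \<rightarrow>\<^sub>E {..<k}"]) (auto simp: good_colourings_def intro: finite_PiE)

lemma fact_le_card_good_colourings:
  assumes "good_colourings n a b k E \<noteq> {}"
  shows "fact k \<le> card (good_colourings n a b k E)"
proof -
  obtain f where f: "f \<in> good_colourings n a b k E" using assms by blast
  have fP: "f \<in> {..<n} \<rightarrow>\<^sub>E {..<k}" using f by (simp add: good_colourings_def)
  define \<phi> where "\<phi> \<pi> = restrict (\<pi> \<circ> f) {..<n}" for \<pi> :: "nat \<Rightarrow> nat"
  let ?P = "{\<pi>. \<pi> permutes {..<k}}"
  have cls: "cls n (\<phi> \<pi>) (\<pi> j) = cls n f j" if "\<pi> permutes {..<k}" for \<pi> j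
    using permutes_inj[OF that] by (auto simp: cls_def \<phi>_def inj_eq)
  have surj: "\<exists>v<n. f v = j" if "j < k" for j
  proof -
    have "cls n f j \<noteq> {}" using f that by (simp add: good_colourings_def)
    then show ?thesis by (auto simp: cls_def)
  qed
  have "inj_on \<phi> ?P"
  proof (rule inj_onI)
    fix \<pi> \<sigma> assume p: "\<pi> \<in> ?P" "\<sigma> \<in> ?P" and eq: "\<phi> \<pi> = \<phi> \<sigma>"
    show "\<pi> = \<sigma>"
    proof
      fix j show "\<pi> j = \<sigma> j"
      proof (cases "j < k")
        case True
        then obtain v where v: "v < n" "f v = j" using surj by blast
        then show ?thesis using fun_cong[OF eq, of v] by (simp add: \<phi>_def)
      next
        case False
        then show ?thesis using p by (simp add: permutes_not_in)
      qed
    qed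
  qed
  moreover have "\<phi> ` ?P \<subseteq> good_colourings n a b k E"
  proof (rule image_subsetI)
    fix \<pi> assume "\<pi> \<in> ?P"
    then have \<pi>: "\<pi> permutes {..<k}" by simp
    have \<pi>k: "\<pi> j < k \<longleftrightarrow> j < k" for j using permutes_in_image[OF \<pi>, of j] by simp
    have "\<phi> \<pi> \<in> {..<n} \<rightarrow>\<^sub>E {..<k}" using fP \<pi>k by (auto simp: \<phi>_def)
    moreover have "cls n (\<phi> \<pi>) j \<noteq> {} \<and> card (cls n (\<phi> \<pi>) j) \<le> a \<and> E \<inter> edges_in (cls n (\<phi> \<pi>) j) = {}" if "j < k" for j
    proof -
      obtain i where i: "j = \<pi> i" using permutes_surj[OF \<pi>] by (metis surjD)
      then have "i < k" using that \<pi>k by simp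
      then show ?thesis using f cls[OF \<pi>, of i] by (simp add: i good_colourings_def)
    qed
    moreover have "card {j \<in> {..<k}. card (cls n (\<phi> \<pi>) j) = a} \<le> b"
    proof -
      have "{j \<in> {..<k}. card (cls n (\<phi> \<pi>) j) = a} = \<pi> ` {j \<in> {..<k}. card (cls n f j) = a}"
      proof (intro equalityI subsetI)
        fix j assume j: "j \<in> {j \<in> {..<k}. card (cls n (\<phi> \<pi>) j) = a}"
        obtain i where i: "j = \<pi> i" using permutes_surj[OF \<pi>] by (metis surjD)
        then show "j \<in> \<pi> ` {j \<in> {..<k}. card (cls n f j) = a}" using j \<pi>k cls[OF \<pi>, of i] by auto
      qed (use \<pi>k cls[OF \<pi>] in auto)
      then have "card {j \<in> {..<k}. card (cls n (\<phi> \<pi>) j) = a} \<le> card {j \<in> {..<k}. card (cls n f j) = a}"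
        by (simp add: card_image_le)
      then show ?thesis using f by (simp add: good_colourings_def)
    qed
    ultimately show "\<phi> \<pi> \<in> good_colourings n a b k E" by (simp add: good_colourings_def)
  qed
  ultimately have "card ?P \<le> card (good_colourings n a b k E)"
    by (intro card_inj_on_le[of \<phi>]) auto
  then show ?thesis using card_permutations[of "{..<k}" k] by simp
qed

text \<open>Only the colours in use are kept and renumbered, hence k' <= k. Distinct classes of size
  \<open>a\<close> are distinct independent sets, and a class larger than \<open>a\<close> would
  contain an independent set of size a + 1.\<close>

lemma colorable_imp_good_colouring:
  assumes "colorable {..<n} k E" "card (indep_sets n a E) \<le> b" "indep_sets n (Suc a) E = {}"
  shows "\<exists>k'\<le>k. good_colourings n a b k' E \<noteq> {}"
proof -
  obtain f :: "nat \<Rightarrow> nat" where f: "\<forall>v\<in>{..<n}. f v < k"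
    "\<forall>u\<in>{..<n}. \<forall>v\<in>{..<n}. u \<noteq> v \<longrightarrow> {u, v} \<in> E \<longrightarrow> f u \<noteq> f v"
    using assms(1) unfolding colorable_def by blast
  define A where "A = f ` {..<n}"
  define k' where "k' = card A"
  have "A \<subseteq> {..<k}" using f(1) by (auto simp: A_def)
  then have k': "k' \<le> k" unfolding k'_def using card_mono[of "{..<k}" A] by simp
  have "finite A" by (simp add: A_def)
  then obtain \<beta> where \<beta>: "bij_betw \<beta> A {..<k'}"
    using ex_bij_betw_finite_nat[of A] by (auto simp: k'_def lessThan_atLeast0)
  define h where "h = restrict (\<beta> \<circ> f) {..<n}"
  have inj: "inj_on \<beta> A" and im: "\<beta> ` A = {..<k'}" using \<beta> by (auto simp: bij_betw_def)
  have hP: "h \<in> {..<n} \<rightarrow>\<^sub>E {..<k'}" using im by (auto simp: h_def A_def)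
  have ind: "E \<inter> edges_in (cls n h j) = {}" for j
  proof (rule ccontr)
    assume "E \<inter> edges_in (cls n h j) \<noteq> {}"
    then obtain e where e: "e \<in> E" "e \<in> edges_in (cls n h j)" by blast
    obtain u v where uv: "u \<in> cls n h j" "v \<in> cls n h j" "u \<noteq> v" "e = {u, v}" using e(2) by (rule edges_inE)
    then have "u < n" "v < n" "\<beta> (f u) = \<beta> (f v)" by (auto simp: cls_def h_def)
    then have "f u = f v" using inj by (auto simp: inj_on_def A_def)
    then show False using f(2) uv e \<open>u < n\<close> \<open>v < n\<close> by blast
  qed
  have ne: "cls n h j \<noteq> {}" if "j < k'" for j
  proof -
    have "j \<in> \<beta> ` A" using that im by simp
    then obtain v where "v < n" "\<beta> (f v) = j" by (auto simp: A_def)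
    then have "v \<in> cls n h j" by (simp add: cls_def h_def)
    then show ?thesis by blast
  qed
  have small: "card (cls n h j) \<le> a" for j
  proof (rule ccontr)
    assume "\<not> card (cls n h j) \<le> a"
    then obtain T where T: "T \<subseteq> cls n h j" "card T = Suc a" using obtain_subset_with_card_n[of "Suc a" "cls n h j"] by auto
    then have "edges_in T \<subseteq> edges_in (cls n h j)" by (intro edges_in_mono)
    then have "T \<in> indep_sets n (Suc a) E"
      using T ind[of j] cls_subset[of n h j] by (auto simp: indep_sets_def)
    then show False using assms(3) by simp
  qed
  have "card {j \<in> {..<k'}. card (cls n h j) = a} \<le> card (indep_sets n a E)"
  proof (rule card_inj_on_le[of "cls n h"])
    show "inj_on (cls n h) {j \<in> {..<k'}. card (cls n h j) = a}"
    proof (rule inj_onI)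
      fix i j assume ij: "i \<in> {j \<in> {..<k'}. card (cls n h j) = a}" "cls n h i = cls n h j"
      then have "i < k'" by simp
      then have "cls n h i \<noteq> {}" by (rule ne)
      then show "i = j" using ij(2) cls_disjoint[of i j n h] by auto
    qed
    show "cls n h ` {j \<in> {..<k'}. card (cls n h j) = a} \<subseteq> indep_sets n a E"
      using ind cls_subset by (fastforce simp: indep_sets_def)
    show "finite (indep_sets n a E)"
      by (rule finite_subset[of _ "Pow {..<n}"]) (auto simp: indep_sets_def)
  qed
  then have "h \<in> good_colourings n a b k' E"
    using hP ind ne small assms(2) by (simp add: good_colourings_def)
  then show ?thesis using k' by blast
qed

text \<open>The constraint on classes of size \<open>a\<close> is relaxed by a Chernoff-type weight:
  each such class receives a factor y <= 1, and since there are at most \<open>b\<close> of them,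
  division by y^b compensates. The unconstrained sum is then bounded by the saddle point
  method.\<close>

lemma av_card_good_colourings:
  assumes y: "0 < y" "y \<le> 1" and \<rho>: "0 < \<rho>" and a: "1 \<le> a"
  shows "av (edges_in {..<n}) (\<lambda>E. real (card (good_colourings n a b k E)))
     \<le> fact n / (y ^ b * \<rho> ^ n) * ((\<Sum>i=1..<a. \<rho> ^ i / dw i) + y * \<rho> ^ a / dw a) ^ k"
proof -
  let ?Z = "edges_in {..<n}" and ?P = "{..<n} \<rightarrow>\<^sub>E {..<k}"
  let ?Y = "(\<Sum>i=1..<a. \<rho> ^ i / dw i) + y * \<rho> ^ a / dw a"
  define g where "g i = (if 1 \<le> i \<and> i \<le> a then (if i = a then y else 1) / 2 ^ (i choose 2) else 0)" for i
  have g0: "0 \<le> g i" for i using y by (simp add: g_def)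
  have finP: "finite ?P" by (intro finite_PiE) auto
  have "real (card (good_colourings n a b k E)) = (\<Sum>f\<in>?P. of_bool (f \<in> good_colourings n a b k E))" for E
  proof -
    have "good_colourings n a b k E = ?P \<inter> {f. f \<in> good_colourings n a b k E}" by (auto simp: good_colourings_def)
    then show ?thesis using finP by (simp add: of_bool_def sum.If_cases)
  qed
  then have "av ?Z (\<lambda>E. real (card (good_colourings n a b k E))) = (\<Sum>f\<in>?P. av ?Z (\<lambda>E. of_bool (f \<in> good_colourings n a b k E)))"
    by (simp only: av_sum)
  also have "\<dots> \<le> (\<Sum>f\<in>?P. 1 / y ^ b * (\<Prod>j<k. g (card {v \<in> {..<n}. f v = j})))"
  proof (intro sum_mono)
    fix f assume f: "f \<in> ?P"
    have ce: "{v \<in> {..<n}. f v = j} = cls n f j" for j by (auto simp: cls_def)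
    have rhs0: "0 \<le> 1 / y ^ b * (\<Prod>j<k. g (card {v \<in> {..<n}. f v = j}))"
      using y g0 by (intro mult_nonneg_nonneg prod_nonneg) auto
    show "av ?Z (\<lambda>E. of_bool (f \<in> good_colourings n a b k E)) \<le> 1 / y ^ b * (\<Prod>j<k. g (card {v \<in> {..<n}. f v = j}))"
    proof (cases "(\<forall>j<k. 1 \<le> card (cls n f j) \<and> card (cls n f j) \<le> a) \<and> card {j \<in> {..<k}. card (cls n f j) = a} \<le> b")
      case False
      have "f \<notin> good_colourings n a b k E" for E
        using False by (auto simp: good_colourings_def Suc_le_eq card_gt_0_iff)
      then show ?thesis using rhs0 by simp
    next
      case True
      let ?m = "card {j \<in> {..<k}. card (cls n f j) = a}"
      have "f \<in> cols n k (\<lambda>j. card (cls n f j))"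
        using f by (fastforce simp: cols_def PiE_def Pi_def)
      from card_class_edges[OF this]
      have cE: "card (class_edges n k f) = (\<Sum>j<k. card (cls n f j) choose 2)" .
      have "av ?Z (\<lambda>E. of_bool (f \<in> good_colourings n a b k E)) \<le> av ?Z (\<lambda>E. of_bool (E \<inter> class_edges n k f = {}))"
        by (intro av_mono) (auto simp: good_colourings_def class_edges_def)
      also have "\<dots> = 1 / 2 ^ card (class_edges n k f)"
        by (rule av_avoid) (simp_all add: class_edges_subset)
      also have "\<dots> = (\<Prod>j<k. 1 / 2 ^ (card (cls n f j) choose 2))"
        by (simp add: cE power_sum prod_dividef)
      also have "\<dots> \<le> 1 / y ^ b * (y ^ ?m * (\<Prod>j<k. 1 / 2 ^ (card (cls n f j) choose 2)))"
      proof -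
        have "y ^ b \<le> y ^ ?m" using y True by (intro power_decreasing) auto
        then have "1 \<le> 1 / y ^ b * y ^ ?m" using y by (simp add: field_simps)
        then have "1 * (\<Prod>j<k. 1 / 2 ^ (card (cls n f j) choose 2)) \<le> (1 / y ^ b * y ^ ?m) * (\<Prod>j<k. 1 / (2::real) ^ (card (cls n f j) choose 2))"
          by (intro mult_right_mono prod_nonneg) auto
        then show ?thesis by (simp add: mult.assoc)
      qed
      also have "y ^ ?m * (\<Prod>j<k. 1 / 2 ^ (card (cls n f j) choose 2)) = (\<Prod>j<k. g (card (cls n f j)))"
      proof -
        have "y ^ ?m = (\<Prod>j<k. if card (cls n f j) = a then y else 1)"
          by (simp add: prod.If_cases Int_def)
        then have "y ^ ?m * (\<Prod>j<k. 1 / 2 ^ (card (cls n f j) choose 2)) = (\<Prod>j<k. (if card (cls n f j) = a then y else 1) * (1 / 2 ^ (card (cls n f j) choose 2)))"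
          by (simp only: prod.distrib)
        also have "\<dots> = (\<Prod>j<k. g (card (cls n f j)))" using True by (intro prod.cong refl) (auto simp: g_def)
        finally show ?thesis .
      qed
      finally show ?thesis by (simp only: ce)
    qed
  qed
  also have "\<dots> = 1 / y ^ b * (\<Sum>f\<in>?P. \<Prod>j<k. g (card {v \<in> {..<n}. f v = j}))" by (simp only: sum_distrib_left)
  also have "\<dots> \<le> 1 / y ^ b * (fact (card {..<n}) / \<rho> ^ card {..<n} * ?Y ^ k)"
  proof (intro mult_left_mono sum_colourings_le g0 \<rho>)
    fix N
    let ?h = "\<lambda>i. g i * \<rho> ^ i / fact i"
    have h0: "0 \<le> ?h i" for i using g0 \<rho> by simp
    have "(\<Sum>i\<le>N. ?h i) = (\<Sum>i\<in>{..N} \<inter> {1..a}. ?h i)"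
      by (intro sum.mono_neutral_right) (auto simp: g_def)
    also have "\<dots> \<le> (\<Sum>i\<in>{1..a}. ?h i)" using h0 by (intro sum_mono2) auto
    also have "{1..a} = insert a {1..<a}" using a by auto
    also have "(\<Sum>i\<in>insert a {1..<a}. ?h i) = ?Y"
    proof -
      have "(\<Sum>i=1..<a. ?h i) = (\<Sum>i=1..<a. \<rho> ^ i / dw i)"
        by (intro sum.cong refl) (simp add: g_def dw_def)
      then show ?thesis using a by (simp add: g_def dw_def)
    qed
    finally show "(\<Sum>i\<le>N. ?h i) \<le> ?Y" .
  qed (use y in auto)
  finally show ?thesis by simp
qed

text \<open>A colourable graph has more than \<open>b\<close> independent sets of size
  \<open>a\<close>, or an independent set of size a + 1, or a good colouring. In the last case there
  are at least k'! of them, so each counts 1 / k'!; multiplying by \<open>\<zeta>\<close>^(k' - k),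
  which is at least 1, turns the sum over k' into an exponential series.\<close>

lemma cp_first_moment:
  assumes y: "0 < y" "y \<le> 1" and \<rho>: "0 < \<rho>" and a: "1 \<le> a" and \<zeta>: "0 < \<zeta>" "\<zeta> \<le> 1"
  shows "cp n k \<le> real n ^ a / dw a / (real b + 1) + real n ^ Suc a / dw (Suc a)
     + fact n / (y ^ b * \<rho> ^ n * \<zeta> ^ k) * exp (\<zeta> * ((\<Sum>i=1..<a. \<rho> ^ i / dw i) + y * \<rho> ^ a / dw a))"
proof -
  let ?Z = "edges_in {..<n}" and ?Y = "(\<Sum>i=1..<a. \<rho> ^ i / dw i) + y * \<rho> ^ a / dw a"
  let ?c = "fact n / (y ^ b * \<rho> ^ n)"
  have Y0: "0 \<le> ?Y" using y \<rho> by (intro add_nonneg_nonneg sum_nonneg divide_nonneg_nonneg) (auto simp: less_imp_le)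
  have c0: "0 \<le> ?c" using y \<rho> by simp
  have "cp n k \<le> av ?Z (\<lambda>E. real (card (indep_sets n a E)) * (1 / (real b + 1)) + real (card (indep_sets n (Suc a) E))
      + (\<Sum>k'\<le>k. real (card (good_colourings n a b k' E)) * (1 / fact k')))"
    unfolding cp_def
  proof (rule av_mono)
    fix E
    have nn: "0 \<le> real (card (indep_sets n a E)) * (1 / (real b + 1))" "0 \<le> (\<Sum>k'\<le>k. real (card (good_colourings n a b k' E)) * (1 / fact k'))"
      by (auto intro!: sum_nonneg)
    have fin: "finite (indep_sets n (Suc a) E)"
      by (rule finite_subset[of _ "Pow {..<n}"]) (auto simp: indep_sets_def)
    have "1 \<le> real (card (indep_sets n a E)) * (1 / (real b + 1)) + real (card (indep_sets n (Suc a) E))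
      + (\<Sum>k'\<le>k. real (card (good_colourings n a b k' E)) * (1 / fact k'))" if col: "colorable {..<n} k E"
    proof -
      consider "b < card (indep_sets n a E)" | "indep_sets n (Suc a) E \<noteq> {}"
        | "card (indep_sets n a E) \<le> b" "indep_sets n (Suc a) E = {}" by linarith
      then show ?thesis
      proof cases
        case 1
        then have "1 \<le> real (card (indep_sets n a E)) * (1 / (real b + 1))" by simp
        then show ?thesis using nn by linarith
      next
        case 2
        then have "1 \<le> card (indep_sets n (Suc a) E)" using fin by (simp add: Suc_le_eq card_gt_0_iff)
        then show ?thesis using nn by linarith
      next
        case 3
        then obtain k' where k': "k' \<le> k" "good_colourings n a b k' E \<noteq> {}"
          using colorable_imp_good_colouring[OF col] by blast
        have "fact k' \<le> real (card (good_colourings n a b k' E))"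
          using of_nat_mono[OF fact_le_card_good_colourings[OF k'(2)], where 'a = real] by simp
        then have "1 \<le> real (card (good_colourings n a b k' E)) * (1 / fact k')" by simp
        also have "\<dots> \<le> (\<Sum>k'\<le>k. real (card (good_colourings n a b k' E)) * (1 / fact k'))"
          by (rule member_le_sum) (use k' in auto)
        finally show ?thesis using nn by linarith
      qed
    qed
    then show "of_bool (colorable {..<n} k E) \<le> real (card (indep_sets n a E)) * (1 / (real b + 1)) + real (card (indep_sets n (Suc a) E))
      + (\<Sum>k'\<le>k. real (card (good_colourings n a b k' E)) * (1 / fact k'))"
      using nn by (cases "colorable {..<n} k E") auto
  qed
  also have "\<dots> = av ?Z (\<lambda>E. real (card (indep_sets n a E))) * (1 / (real b + 1)) + av ?Z (\<lambda>E. real (card (indep_sets n (Suc a) E)))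
      + (\<Sum>k'\<le>k. av ?Z (\<lambda>E. real (card (good_colourings n a b k' E))) * (1 / fact k'))"
    by (simp only: av_add av_sum av_cmult_right)
  also have "\<dots> \<le> real n ^ a / dw a * (1 / (real b + 1)) + real n ^ Suc a / dw (Suc a) + (\<Sum>k'\<le>k. ?c * ?Y ^ k' * (1 / fact k'))"
    by (intro add_mono mult_right_mono sum_mono av_card_indep_sets av_card_good_colourings y \<rho> a) auto
  also have "(\<Sum>k'\<le>k. ?c * ?Y ^ k' * (1 / fact k')) \<le> (\<Sum>k'\<le>k. ?c / \<zeta> ^ k * ((\<zeta> * ?Y) ^ k' / fact k'))"
  proof (intro sum_mono)
    fix k' assume "k' \<in> {..k}"
    then have "\<zeta> ^ k \<le> \<zeta> ^ k'" using \<zeta> by (intro power_decreasing) auto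
    then have "1 \<le> \<zeta> ^ k' / \<zeta> ^ k" using \<zeta> by simp
    then have "(?c * ?Y ^ k' * (1 / fact k')) * 1 \<le> (?c * ?Y ^ k' * (1 / fact k')) * (\<zeta> ^ k' / \<zeta> ^ k)"
      using c0 Y0 by (intro mult_left_mono mult_nonneg_nonneg) auto
    then show "?c * ?Y ^ k' * (1 / fact k') \<le> ?c / \<zeta> ^ k * ((\<zeta> * ?Y) ^ k' / fact k')"
      by (simp add: power_mult_distrib mult_ac)
  qed
  also have "\<dots> = ?c / \<zeta> ^ k * (\<Sum>k'\<le>k. (\<zeta> * ?Y) ^ k' / fact k')" by (simp only: sum_distrib_left)
  also have "\<dots> \<le> ?c / \<zeta> ^ k * exp (\<zeta> * ?Y)"
  proof (rule mult_left_mono[OF sum_power_fact_le_exp])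
    show "0 \<le> \<zeta> * ?Y" using \<zeta> Y0 by (intro mult_nonneg_nonneg) auto
    show "0 \<le> ?c / \<zeta> ^ k" by (rule divide_nonneg_pos[OF c0]) (use \<zeta> in simp)
  qed
  finally show ?thesis by (simp add: mult.assoc)
qed

section \<open>Partial colourings with a given profile\<close>

text \<open>Both sides agree at 1, and the difference has derivative (s - 1)^2 / (s (s + 1)^2). The
  cruder bound t - 1 would yield only 55/100 instead of 7/10 in the case of a small covered part
  below.\<close>

lemma ln_le_quotient:
  fixes t :: real
  assumes "0 < t" "t \<le> 1"
  shows "ln t \<le> 2 * (t - 1) / (t + 1)"
proof -
  let ?f = "\<lambda>t::real. ln t - 2 * (t - 1) / (t + 1)"
  have "?f t \<le> ?f 1"
  proof (rule DERIV_nonneg_imp_nondecreasing[OF assms(2)])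
    fix s assume s: "t \<le> s" "s \<le> 1"
    then have s0: "0 < s" using assms by simp
    have "(?f has_real_derivative (1 / s - (2 * (s + 1) - 2 * (s - 1)) / (s + 1)\<^sup>2)) (at s)"
      using s0 by (auto intro!: derivative_eq_intros simp: power2_eq_square)
    moreover have "1 / s - (2 * (s + 1) - 2 * (s - 1)) / (s + 1)\<^sup>2 = (s - 1)\<^sup>2 / (s * (s + 1)\<^sup>2)"
    proof -
      have "s \<noteq> 0" "s + 1 \<noteq> 0" using s0 by auto
      then show ?thesis by (simp add: divide_simps) (simp add: power2_eq_square algebra_simps)
    qed
    moreover have "0 \<le> (s - 1)\<^sup>2 / (s * (s + 1)\<^sup>2)" using s0 by simp
    ultimately show "\<exists>y. (?f has_real_derivative y) (at s) \<and> 0 \<le> y" by metis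
  qed
  then show ?thesis by simp
qed

text \<open>Both a small and a large covered part are unlikely to be overrepresented. When more than
  about half of the vertices is uncovered, only the largest classes matter; otherwise the
  bound \<open>\<Sum> P g \<le> R ln (W n / R)\<close> of Gibbs is used with the weights \<open>exp (2 g)\<close>.\<close>

lemma profile_condition:
  fixes x q :: "nat \<Rightarrow> real" and a J \<Lambda> jb c n :: real
  assumes S: "finite S" "\<And>j. j \<in> S \<Longrightarrow> 1 \<le> real j \<and> real j \<le> J" "1 \<le> J" "J < a"
    and q: "\<And>j. j \<in> S \<Longrightarrow> 0 \<le> q j \<and> q j \<le> x j"
    and n: "n = (\<Sum>j\<in>S. (a - j) * x j)" "0 < n"
    and mean: "(\<Sum>j\<in>S. x j * (j - jb)) = 0"
    and \<Lambda>: "0 \<le> \<Lambda>" and jb: "1 \<le> jb" "jb \<le> a" and c: "0 \<le> c"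
    and hB: "\<Lambda> * (jb - 1) / (a - 1) + 2 * c / (a - J) \<le> 7 / 10"
    and hA: "(\<Sum>j\<in>S. (a - j) * x j * exp (2 * (\<Lambda> * (j - jb) / (a - j)))) \<le> 9 / 5 * n" "2 * c / (a - J) \<le> 1 / 200"
    and N: "N = (\<Sum>j\<in>S. (a - j) * q j)"
  shows "(n - N) * ln ((n - N) / n) + \<Lambda> * (\<Sum>j\<in>S. q j * (jb - j)) + 2 * c * (\<Sum>j\<in>S. min (q j) (x j - q j)) \<le> 0"
proof -
  have aj: "0 < a - j" "a - J \<le> a - j" if "j \<in> S" for j using S that by force+
  have N0: "0 \<le> N" unfolding N using aj q by (intro sum_nonneg mult_nonneg_nonneg) (auto simp: less_imp_le)
  have Nn: "N \<le> n" unfolding N n(1) using aj q by (intro sum_mono mult_left_mono) (auto simp: less_imp_le)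
  have cJ: "c * z \<le> (a - j) * z * (c / (a - J))" if "j \<in> S" "0 \<le> z" for j z
  proof -
    have "c * z * (a - J) \<le> c * z * (a - j)" using aj[OF that(1)] that(2) c by (intro mult_left_mono) auto
    then show ?thesis using S(4) by (simp add: field_simps)
  qed
  show ?thesis
  \<comment> \<open>The threshold serves both cases: from 55/100 on, 2 \<open>\<nu>\<close> /
    (\<open>\<nu>\<close> + 1) is at least 7/10, and below it 9/5 * R / n is less than
    99/100.\<close>
  proof (cases "55 / 100 * n \<le> n - N")
    case True
    define \<nu> where "\<nu> = (n - N) / n"
    have \<nu>: "55 / 100 \<le> \<nu>" "\<nu> \<le> 1" using True n N0 by (auto simp: \<nu>_def field_simps)
    have t1: "(n - N) * ln \<nu> \<le> - (7 / 10) * N"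
    proof -
      have "(n - N) * ln \<nu> \<le> (n - N) * (2 * (\<nu> - 1) / (\<nu> + 1))"
        using \<nu> Nn by (intro mult_left_mono ln_le_quotient) auto
      also have "\<dots> = - (2 * \<nu> / (\<nu> + 1)) * N"
      proof -
        have e: "n - N = n * \<nu>" "n * (1 - \<nu>) = N" using n by (auto simp: \<nu>_def field_simps)
        have "n * \<nu> * (2 * (\<nu> - 1) / (\<nu> + 1)) = - (2 * \<nu> / (\<nu> + 1)) * (n * (1 - \<nu>))"
          using \<nu> by (simp add: field_simps)
        then show ?thesis unfolding e .
      qed
      also have "\<dots> \<le> - (7 / 10) * N"
      proof (intro mult_right_mono N0)
        show "- (2 * \<nu> / (\<nu> + 1)) \<le> - (7 / 10)" using \<nu> by (simp add: field_simps)
      qed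
      finally show ?thesis .
    qed
    have "\<Lambda> * (\<Sum>j\<in>S. q j * (jb - j)) + 2 * c * (\<Sum>j\<in>S. min (q j) (x j - q j))
        = (\<Sum>j\<in>S. \<Lambda> * (q j * (jb - j)) + 2 * (c * min (q j) (x j - q j)))"
      by (simp add: sum_distrib_left sum.distrib mult.assoc)
    also have "\<dots> \<le> (\<Sum>j\<in>S. (a - j) * q j * (\<Lambda> * (jb - 1) / (a - 1)) + 2 * ((a - j) * q j * (c / (a - J))))"
    proof (intro sum_mono add_mono)
      fix j assume j: "j \<in> S"
      \<comment> \<open>The gain per covered vertex, (jb - j) / (a - j), is largest for the largest
        classes, j = 1.\<close>
      have "0 \<le> (real j - 1) * (a - jb)" using S(2)[OF j] jb by (intro mult_nonneg_nonneg) auto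
      then have "(jb - j) * (a - 1) \<le> (jb - 1) * (a - j)" by (simp add: algebra_simps)
      then have "(\<Lambda> * q j) * ((jb - j) * (a - 1)) \<le> (\<Lambda> * q j) * ((jb - 1) * (a - j))"
        using \<Lambda> q[OF j] by (intro mult_left_mono) auto
      then show "\<Lambda> * (q j * (jb - j)) \<le> (a - j) * q j * (\<Lambda> * (jb - 1) / (a - 1))"
        using S(3,4) by (simp add: field_simps)
      have "c * min (q j) (x j - q j) \<le> c * q j" using c by (intro mult_left_mono) auto
      also have "\<dots> \<le> (a - j) * q j * (c / (a - J))" using q[OF j] by (intro cJ j) auto
      finally show "2 * (c * min (q j) (x j - q j)) \<le> 2 * ((a - j) * q j * (c / (a - J)))" by simp
    qed
    also have "\<dots> = N * (\<Lambda> * (jb - 1) / (a - 1)) + 2 * (N * (c / (a - J)))"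
      unfolding N by (simp only: sum.distrib sum_distrib_right sum_distrib_left)
    also have "\<dots> = N * (\<Lambda> * (jb - 1) / (a - 1) + 2 * c / (a - J))"
      by (simp add: algebra_simps)
    also have "\<dots> \<le> N * (7 / 10)" using hB N0 by (intro mult_left_mono) auto
    finally show ?thesis using t1 by (simp add: \<nu>_def)
  next
    case False
    define R where "R = n - N"
    define p where "p j = x j - q j" for j
    define g where "g j = \<Lambda> * (j - jb) / (a - j)" for j :: nat
    have p0: "0 \<le> p j" if "j \<in> S" for j using q[OF that] by (simp add: p_def)
    have RP: "R = (\<Sum>j\<in>S. (a - j) * p j)"
      by (simp add: R_def N n(1) p_def right_diff_distrib sum_subtractf)
    \<comment> \<open>By the choice of the mean, the surplus of the covered classes equals the
      deficit of the uncovered ones, so the remaining argument concerns the uncovered classes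
      \<open>p\<close> only.\<close>
    have flip: "(\<Sum>j\<in>S. q j * (jb - j)) = (\<Sum>j\<in>S. p j * (j - jb))"
    proof -
      have "(\<Sum>j\<in>S. p j * (j - jb)) - (\<Sum>j\<in>S. q j * (jb - j)) = (\<Sum>j\<in>S. x j * (j - jb))"
        by (simp add: p_def sum_subtractf[symmetric] algebra_simps)
      then show ?thesis using mean by simp
    qed
    show ?thesis
    proof (cases "R = 0")
      case True
      have "p j = 0" if "j \<in> S" for j
      proof -
        have "(\<Sum>j\<in>S. (a - j) * p j) = 0" using RP True by simp
        then have "\<forall>j\<in>S. (a - j) * p j = 0"
          using sum_nonneg_eq_0_iff[OF S(1), of "\<lambda>j. (a - j) * p j"] aj(1) p0 by (simp add: less_imp_le)
        then show ?thesis using that aj(1)[OF that] by auto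
      qed
      then have "(\<Sum>j\<in>S. p j * (j - jb)) = 0" "(\<Sum>j\<in>S. min (q j) (x j - q j)) \<le> 0"
        by (auto intro!: sum.neutral sum_nonpos simp: p_def min_def)
      then show ?thesis using True flip c by (simp add: R_def mult_nonneg_nonpos)
    next
      case False': False
      then have R: "0 < R" "R < 55 / 100 * n" using Nn False by (auto simp: R_def)
      \<comment> \<open>The tangent point for Gibbs' inequality: 9/5 * n bounds the total of the
        weights exp (2 g), and \<open>R\<close> is the mass they are compared with.\<close>
      define \<tau> where "\<tau> = 9 / 5 * n / R"
      have \<tau>: "0 < \<tau>" using R n by (simp add: \<tau>_def)
      have gl: "2 * g j \<le> exp (2 * g j) / \<tau> + (ln \<tau> - 1)" for j
      proof -
        have "ln (exp (2 * g j) / \<tau>) \<le> exp (2 * g j) / \<tau> - 1" using \<tau> by (intro ln_le_minus_one) auto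
        then show ?thesis using \<tau> by (simp add: ln_div)
      qed
      have "2 * (\<Lambda> * (\<Sum>j\<in>S. p j * (j - jb))) = (\<Sum>j\<in>S. ((a - j) * p j) * (2 * g j))"
        unfolding sum_distrib_left
      proof (intro sum.cong refl)
        fix j assume "j \<in> S"
        then have "a - j \<noteq> 0" using aj by force
        then show "2 * (\<Lambda> * (p j * (j - jb))) = ((a - j) * p j) * (2 * g j)" by (simp add: g_def)
      qed
      also have "\<dots> \<le> (\<Sum>j\<in>S. ((a - j) * x j * exp (2 * g j)) * (1 / \<tau>) + ((a - j) * p j) * (ln \<tau> - 1))"
      proof (intro sum_mono)
        fix j assume j: "j \<in> S"
        have "((a - j) * p j) * (2 * g j) \<le> ((a - j) * p j) * (exp (2 * g j) / \<tau> + (ln \<tau> - 1))"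
          using aj[OF j] p0[OF j] gl by (intro mult_left_mono) auto
        also have "\<dots> = ((a - j) * p j) * (exp (2 * g j) / \<tau>) + ((a - j) * p j) * (ln \<tau> - 1)" by (simp only: distrib_left)
        also have "((a - j) * p j) * (exp (2 * g j) / \<tau>) \<le> ((a - j) * x j) * (exp (2 * g j) / \<tau>)"
          using aj[OF j] q[OF j] \<tau> by (intro mult_right_mono mult_left_mono) (auto simp: p_def)
        finally show "((a - j) * p j) * (2 * g j) \<le> ((a - j) * x j * exp (2 * g j)) * (1 / \<tau>) + ((a - j) * p j) * (ln \<tau> - 1)"
          by simp
      qed
      also have "\<dots> = (\<Sum>j\<in>S. (a - j) * x j * exp (2 * g j)) * (1 / \<tau>) + R * (ln \<tau> - 1)"
        unfolding RP by (simp only: sum.distrib sum_distrib_right)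
      also have "\<dots> \<le> (9 / 5 * n) * (1 / \<tau>) + R * (ln \<tau> - 1)"
        using hA(1) \<tau> unfolding g_def by (intro add_right_mono mult_right_mono) auto
      also have "(9 / 5 * n) * (1 / \<tau>) = R" using n R by (simp add: \<tau>_def)
      finally have t2: "\<Lambda> * (\<Sum>j\<in>S. p j * (j - jb)) \<le> R / 2 * ln \<tau>" by (simp add: algebra_simps)
      have t3: "2 * c * (\<Sum>j\<in>S. min (q j) (x j - q j)) \<le> R / 200"
      proof -
        have "c * (\<Sum>j\<in>S. min (q j) (x j - q j)) \<le> (\<Sum>j\<in>S. (a - j) * p j * (c / (a - J)))"
          unfolding sum_distrib_left
        proof (intro sum_mono)
          fix j assume j: "j \<in> S"
          have "c * min (q j) (x j - q j) \<le> c * p j" using c by (intro mult_left_mono) (auto simp: p_def)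
          also have "\<dots> \<le> (a - j) * p j * (c / (a - J))" using p0[OF j] by (intro cJ j) auto
          finally show "c * min (q j) (x j - q j) \<le> (a - j) * p j * (c / (a - J))" .
        qed
        also have "\<dots> = R * (c / (a - J))" unfolding RP by (simp only: sum_distrib_right)
        finally have "2 * (c * (\<Sum>j\<in>S. min (q j) (x j - q j))) \<le> 2 * (R * (c / (a - J)))" by (rule mult_left_mono) simp
        also have "2 * (R * (c / (a - J))) = R * (2 * c / (a - J))" by simp
        finally have "2 * c * (\<Sum>j\<in>S. min (q j) (x j - q j)) \<le> R * (2 * c / (a - J))" by (simp only: mult.assoc)
        also have "\<dots> \<le> R * (1 / 200)" using hA(2) R by (intro mult_left_mono) auto
        finally show ?thesis by simp
      qed
      have l: "ln (9 / 5 * (R / n)) \<le> - (1 / 100)"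
      proof -
        have "9 / 5 * (R / n) \<le> 99 / 100" using R n by (simp add: field_simps)
        then have "ln (9 / 5 * (R / n)) \<le> ln (99 / 100)" using R n by (subst ln_le_cancel_iff) auto
        also have "\<dots> \<le> 99 / 100 - 1" by (rule ln_le_minus_one) simp
        finally show ?thesis by simp
      qed
      \<comment> \<open>The exponent 2 g, divided by 2 again, costs only R / 2 * ln
        \<open>\<tau>\<close>. Half of the entropy term is left over and outweighs the constant 9/5;
        with weights exp g the terms in R / n would cancel completely.\<close>
      have "R * ln (R / n) + R / 2 * ln \<tau> = R / 2 * ln (9 / 5 * (R / n))"
      proof -
        have "ln \<tau> = ln (9 / 5) + ln n - ln R" using R n unfolding \<tau>_def by (simp add: ln_div ln_mult del: times_divide_eq_left)
        moreover have "ln (R / n) = ln R - ln n" using R n by (simp add: ln_div)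
        moreover have "ln (9 / 5 * (R / n)) = ln (9 / 5) + ln R - ln n" using R n by (subst ln_mult) (auto simp: ln_div)
        ultimately have "2 * ln (R / n) + ln \<tau> = ln (9 / 5 * (R / n))" by linarith
        moreover have "R * ln (R / n) + R / 2 * ln \<tau> = R / 2 * (2 * ln (R / n) + ln \<tau>)" by (simp add: algebra_simps)
        ultimately show ?thesis by (simp only:)
      qed
      also have "\<dots> \<le> R / 2 * (- (1 / 100))" using l R by (intro mult_left_mono) auto
      finally have "R * ln (R / n) + R / 2 * ln \<tau> \<le> - R / 200" by simp
      moreover have "\<Lambda> * (\<Sum>j\<in>S. q j * (jb - j)) \<le> R / 2 * ln \<tau>" using t2 flip by simp
      ultimately show ?thesis using t3 unfolding R_def by linarith
    qed
  qed
qed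

section \<open>Stirling and binomial estimates for the profile\<close>

lemma fact_le: "fact q \<le> exp 1 * (real q + 1) * (real q / exp 1) ^ q"
proof (cases "q = 0")
  case True
  then show ?thesis by simp
next
  case False
  then have "1 \<le> q" by simp
  then have "fact q \<le> exp 1 * real q * (real q / exp 1) ^ q"
  proof (induction q rule: dec_induct)
    case base
    then show ?case by simp
  next
    case (step q)
    have "real q / (real q + 1) \<le> exp (- (1 / (real q + 1)))"
      using exp_ge_add_one_self[of "- (1 / (real q + 1))"] by (simp add: field_simps)
    then have "(real q / (real q + 1)) ^ Suc q \<le> exp (- (1 / (real q + 1))) ^ Suc q"
      by (intro power_mono) auto
    also have "\<dots> = exp (- 1)" by (simp add: exp_of_nat_mult[symmetric] field_simps del: power_Suc)
    finally have k: "real q ^ Suc q * exp 1 \<le> (real q + 1) ^ Suc q"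
      by (simp add: power_divide exp_minus field_simps del: power_Suc)
    have "fact (Suc q) = (real q + 1) * fact q" by simp
    also have "\<dots> \<le> (real q + 1) * (exp 1 * real q * (real q / exp 1) ^ q)" using step by (intro mult_left_mono) auto
    also have "\<dots> = (real q + 1) * (real q ^ Suc q * exp 1) / exp 1 ^ q" by (simp add: power_divide)
    also have "\<dots> \<le> (real q + 1) * (real q + 1) ^ Suc q / exp 1 ^ q"
      using k by (intro divide_right_mono mult_left_mono) auto
    also have "\<dots> = exp 1 * real (Suc q) * (real (Suc q) / exp 1) ^ Suc q" by (simp add: power_divide add.commute)
    finally show ?case .
  qed
  also have "\<dots> \<le> exp 1 * (real q + 1) * (real q / exp 1) ^ q" by (intro mult_right_mono mult_left_mono) auto
  finally show ?thesis .
qed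

lemma fact_ge: "(real q / exp 1) ^ q \<le> fact q"
proof -
  have "real q ^ q / fact q \<le> (\<Sum>z\<le>q. real q ^ z / fact z)"
    by (rule member_le_sum[of q "{..q}" "\<lambda>z. real q ^ z / fact z"]) auto
  also have "\<dots> \<le> exp (real q)" by (rule sum_power_fact_le_exp) simp
  also have "exp (real q) = exp 1 ^ q" by (simp add: exp_of_nat_mult[symmetric])
  finally show ?thesis by (simp add: power_divide field_simps)
qed

text \<open>A single term of the expansion of (1 + exp (- c))^\<open>\<kappa>\<close>, together with
  the symmetry of binomial coefficients. For large \<open>c\<close> the entropy is replaced by a
  linear term and a tiny multiple of \<open>x\<close>.\<close>

lemma choose_le_exp:
  assumes "q \<le> \<kappa>" "real \<kappa> \<le> x" "0 \<le> c"
  shows "real (\<kappa> choose q) \<le> exp (exp (- c) * x + c * min (real q) (x - q))"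
proof -
  have b: "real (\<kappa> choose i) \<le> exp (exp (- c) * x + c * i)" if "i \<le> \<kappa>" for i
  proof -
    have "real (\<kappa> choose i) * exp (- c) ^ i = real (\<kappa> choose i) * exp (- c) ^ i * 1 ^ (\<kappa> - i)" by simp
    also have "\<dots> \<le> (\<Sum>i\<le>\<kappa>. real (\<kappa> choose i) * exp (- c) ^ i * 1 ^ (\<kappa> - i))"
      by (rule member_le_sum) (use that in auto)
    also have "\<dots> = (exp (- c) + 1) ^ \<kappa>" by (simp only: binomial_ring)
    also have "\<dots> \<le> exp (exp (- c)) ^ \<kappa>"
      using exp_ge_add_one_self[of "exp (- c)"] by (intro power_mono) (auto simp: add.commute add_nonneg_nonneg)
    also have "\<dots> = exp (exp (- c) * \<kappa>)" by (simp add: exp_of_nat_mult[symmetric] mult.commute)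
    also have "\<dots> \<le> exp (exp (- c) * x)" using assms(2) by simp
    finally have le: "real (\<kappa> choose i) * exp (- (c * i)) \<le> exp (exp (- c) * x)"
      by (simp add: exp_of_nat_mult[symmetric] mult.commute)
    have "real (\<kappa> choose i) = real (\<kappa> choose i) * exp (- (c * i)) * exp (c * i)" by (simp add: exp_minus)
    also have "\<dots> \<le> exp (exp (- c) * x) * exp (c * i)" using le by (intro mult_right_mono) auto
    finally show ?thesis by (simp only: exp_add)
  qed
  have "real (\<kappa> choose q) = real (\<kappa> choose (\<kappa> - q))" by (rule arg_cong[OF binomial_symmetric[OF assms(1)]])
  also have "\<dots> \<le> exp (exp (- c) * x + c * real (\<kappa> - q))" by (rule b) simp
  also have "\<dots> \<le> exp (exp (- c) * x + c * (x - q))" using assms by (auto intro!: mult_left_mono)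
  finally show ?thesis using b[OF assms(1)] by (simp add: min_def)
qed

lemma choose_ff_le:
  assumes "q \<le> \<kappa>" "real \<kappa> \<le> x" "0 \<le> c"
  shows "real (\<kappa> choose q) * ff \<kappa> q
     \<le> exp (2 * (exp (- c) * x + c * min (real q) (x - q))) * (exp 1 * (x + 1)) * (x / exp 1) ^ q"
proof -
  let ?E = "exp (exp (- c) * x + c * min (real q) (x - q))"
  have x0: "0 \<le> x" "real q \<le> x" using assms by linarith+
  have "ff \<kappa> q = fact q * real (\<kappa> choose q)" using assms(1) by (simp add: ff_fact binomial_fact)
  then have "real (\<kappa> choose q) * ff \<kappa> q = (real (\<kappa> choose q) * real (\<kappa> choose q)) * fact q" by simp
  also have "\<dots> \<le> (?E * ?E) * (exp 1 * (real q + 1) * (real q / exp 1) ^ q)"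
    using choose_le_exp[OF assms] fact_le[of q] by (intro mult_mono mult_nonneg_nonneg) auto
  also have "\<dots> \<le> (?E * ?E) * (exp 1 * (x + 1) * (x / exp 1) ^ q)"
    using x0 by (intro mult_left_mono mult_mono power_mono divide_right_mono) auto
  also have "?E * ?E = exp (2 * (exp (- c) * x + c * min (real q) (x - q)))" by (simp only: exp_double power2_eq_square)
  finally show ?thesis by (simp only: mult.assoc)
qed

text \<open>Supplies the bound \<open>B\<close> of the second moment. The relation \<open>xd\<close>
  is stationarity of the expected number of colourings: it collapses the product to powers of
  \<open>\<zeta>\<close> and \<open>\<rho>\<close> that depend only on the numbers of covered
  classes and vertices. The relation between \<open>\<zeta>\<close> and \<open>\<Lambda>\<close>
  says that the leading exponent of the expected number for the whole profile is 0. Stirling's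
  formula reduces the claim to \<open>profile_condition\<close>.\<close>

lemma profile_product:
  fixes x :: "nat \<Rightarrow> real" and a n :: nat and \<kappa> q :: "nat \<Rightarrow> nat" and J \<rho> \<zeta> jb c :: real
  assumes S: "finite S" "\<And>j. j \<in> S \<Longrightarrow> 1 \<le> real j \<and> real j \<le> J" "1 \<le> J" "J < a"
    and \<kappa>: "\<And>j. j \<in> S \<Longrightarrow> real (\<kappa> j) \<le> x j" and q: "\<And>j. j \<in> S \<Longrightarrow> q j \<le> \<kappa> j"
    and n: "real n = (\<Sum>j\<in>S. (real a - j) * x j)" "0 < n"
    and mean: "(\<Sum>j\<in>S. x j * (j - jb)) = 0"
    and jb: "1 \<le> jb" "jb \<le> a" and c: "0 \<le> c" and \<rho>: "0 < \<rho>" and \<zeta>: "0 < \<zeta>"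
    and xd: "\<And>j. j \<in> S \<Longrightarrow> x j * dw (a - j) = \<zeta> * \<rho> ^ (a - j)"
    and \<Lambda>: "\<Lambda> = 1 + ln (\<rho> / n)" "0 \<le> \<Lambda>" "1 - ln \<zeta> = (a - jb) * \<Lambda>"
    and hB: "\<Lambda> * (jb - 1) / (real a - 1) + 2 * c / (a - J) \<le> 7 / 10"
    and hA: "(\<Sum>j\<in>S. (real a - j) * x j * exp (2 * (\<Lambda> * (j - jb) / (real a - j)))) \<le> 9 / 5 * n" "2 * c / (a - J) \<le> 1 / 200"
  shows "(\<Prod>j\<in>S. real (\<kappa> j choose q j) * ff (\<kappa> j) (q j) * dw (a - j) ^ q j)
     \<le> exp (2 * exp (- c) * (\<Sum>j\<in>S. x j)) * (\<Prod>j\<in>S. exp 1 * (x j + 1)) * (exp 1 * (real n + 1)) * ff n (\<Sum>j\<in>S. (a - j) * q j)"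
proof -
  define N where "N = (\<Sum>j\<in>S. (a - j) * q j)"
  define Q where "Q = (\<Sum>j\<in>S. q j)"
  define m where "m = (\<Sum>j\<in>S. min (real (q j)) (x j - q j))"
  have ja: "j < a" if "j \<in> S" for j using S(2)[OF that] S(4) by linarith
  have qx: "real (q j) \<le> x j" if "j \<in> S" for j using \<kappa>[OF that] q[OF that] by linarith
  have x0: "0 \<le> x j" if "j \<in> S" for j using qx[OF that] by linarith
  have NR: "real N = (\<Sum>j\<in>S. (real a - j) * real (q j))"
    unfolding N_def using ja by (simp add: of_nat_diff less_imp_le)
  have "real N \<le> real n" unfolding NR n(1) using qx ja by (intro sum_mono mult_left_mono) (auto simp: less_imp_le)
  then have Nn: "N \<le> n" by simp
  define R where "R = n - N"
  have R: "real R = real n - real N" using Nn by (simp add: R_def of_nat_diff)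
  have cond: "(real n - N) * ln ((real n - N) / n) + \<Lambda> * (\<Sum>j\<in>S. real (q j) * (jb - j)) + 2 * c * m \<le> 0"
    unfolding m_def
    by (rule profile_condition[OF S _ n(1) _ mean \<Lambda>(2) jb c hB hA NR]) (use qx n(2) in auto)
  have RlnR: "real R * ln (real R / n) = real R * ln R - real R * ln n"
    using n(2) by (cases "R = 0") (simp_all add: ln_div algebra_simps)
  have sq: "(\<Sum>j\<in>S. real (q j) * (jb - j)) = real N - (a - jb) * Q"
  proof -
    have "(a - jb) * Q = (\<Sum>j\<in>S. (a - jb) * real (q j))" by (simp add: Q_def sum_distrib_left)
    then show ?thesis unfolding NR by (simp add: sum_subtractf[symmetric] algebra_simps)
  qed
  have le: "2 * c * m + real Q * (ln \<zeta> - 1) + real N * ln \<rho> + (real R * ln R - R) \<le> real n * ln n - n"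
  proof -
    have "\<Lambda> * (\<Sum>j\<in>S. real (q j) * (jb - j)) = \<Lambda> * N - (1 - ln \<zeta>) * Q"
      unfolding sq \<Lambda>(3) by (simp add: algebra_simps)
    also have "\<Lambda> * N = N + N * ln \<rho> - N * ln n" using \<rho> n(2) by (simp add: \<Lambda>(1) ln_div algebra_simps)
    finally have "real R * ln R - real R * ln n + (N + N * ln \<rho> - N * ln n - (1 - ln \<zeta>) * Q) + 2 * c * m \<le> 0"
      using cond unfolding R[symmetric] RlnR by simp
    moreover have "real R * ln n + N * ln n = n * ln n" by (simp add: R algebra_simps)
    ultimately show ?thesis by (simp add: R algebra_simps)
  qed
  have pw: "(real k / exp 1) ^ k = exp (real k * ln k - k)" for k :: nat
  proof (cases "k = 0")
    case False
    then have "exp (real k * ln k) = real k ^ k" by (simp only: exp_of_nat_mult) simp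
    moreover have "exp (real k) = exp 1 ^ k" by (simp add: exp_of_nat_mult[symmetric])
    ultimately show ?thesis by (simp only: exp_diff power_divide)
  qed simp
  have "exp (2 * c * m) * (\<zeta> / exp 1) ^ Q * \<rho> ^ N * (real R / exp 1) ^ R \<le> (real n / exp 1) ^ n"
  proof -
    have "(\<zeta> / exp 1) ^ Q = exp (real Q * (ln \<zeta> - 1))"
      using \<zeta> by (simp add: exp_of_nat_mult exp_diff)
    moreover have "\<rho> ^ N = exp (N * ln \<rho>)" using \<rho> by (simp add: exp_of_nat_mult)
    ultimately have "exp (2 * c * m) * (\<zeta> / exp 1) ^ Q * \<rho> ^ N * (real R / exp 1) ^ R
       = exp (2 * c * m + real Q * (ln \<zeta> - 1) + real N * ln \<rho> + (real R * ln R - R))"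
      by (simp only: pw exp_add)
    then show ?thesis using le by (simp only: pw exp_le_cancel_iff)
  qed
  also have "\<dots> \<le> fact n" by (rule fact_ge)
  also have "fact n = ff n N * fact R" using Nn by (simp add: ff_fact R_def)
  also have "\<dots> \<le> ff n N * (exp 1 * (real R + 1) * (real R / exp 1) ^ R)"
    by (intro mult_left_mono fact_le) auto
  finally have "exp (2 * c * m) * (\<zeta> / exp 1) ^ Q * \<rho> ^ N * (real R / exp 1) ^ R
      \<le> (ff n N * (exp 1 * (real R + 1))) * (real R / exp 1) ^ R" by (simp only: mult.assoc)
  moreover have "0 < (real R / exp 1) ^ R" by (cases "R = 0") auto
  ultimately have "exp (2 * c * m) * (\<zeta> / exp 1) ^ Q * \<rho> ^ N \<le> ff n N * (exp 1 * (real R + 1))"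
    by (simp only: mult_le_cancel_right_pos)
  also have "\<dots> \<le> ff n N * (exp 1 * (real n + 1))" by (intro mult_left_mono) (auto simp: R)
  finally have key: "exp (2 * c * m) * (\<zeta> / exp 1) ^ Q * \<rho> ^ N \<le> ff n N * (exp 1 * (real n + 1))" .
  have "(\<Prod>j\<in>S. real (\<kappa> j choose q j) * ff (\<kappa> j) (q j) * dw (a - j) ^ q j)
     \<le> (\<Prod>j\<in>S. exp (2 * exp (- c) * x j) * exp (2 * c * min (real (q j)) (x j - q j)) * (exp 1 * (x j + 1)) * ((\<zeta> / exp 1) ^ q j * \<rho> ^ ((a - j) * q j)))"
  proof (intro prod_mono conjI)
    fix j assume j: "j \<in> S"
    have "real (\<kappa> j choose q j) * ff (\<kappa> j) (q j) * dw (a - j) ^ q j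
       \<le> exp (2 * (exp (- c) * x j + c * min (real (q j)) (x j - q j))) * (exp 1 * (x j + 1)) * (x j / exp 1) ^ q j * dw (a - j) ^ q j"
      by (intro mult_right_mono choose_ff_le q \<kappa> c j) (auto simp: less_imp_le)
    also have "\<dots> = exp (2 * (exp (- c) * x j + c * min (real (q j)) (x j - q j))) * (exp 1 * (x j + 1)) * ((x j / exp 1) ^ q j * dw (a - j) ^ q j)"
      by (simp only: mult.assoc)
    also have "(x j / exp 1) ^ q j * dw (a - j) ^ q j = (\<zeta> / exp 1) ^ q j * \<rho> ^ ((a - j) * q j)"
    proof -
      have "(x j / exp 1) * dw (a - j) = (\<zeta> / exp 1) * \<rho> ^ (a - j)" using xd[OF j] by simp
      then show ?thesis by (simp only: power_mult_distrib[symmetric] power_mult)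
    qed
    also have "exp (2 * (exp (- c) * x j + c * min (real (q j)) (x j - q j))) = exp (2 * exp (- c) * x j) * exp (2 * c * min (real (q j)) (x j - q j))"
      by (simp only: exp_add[symmetric] distrib_left mult.assoc)
    finally show "real (\<kappa> j choose q j) * ff (\<kappa> j) (q j) * dw (a - j) ^ q j
      \<le> exp (2 * exp (- c) * x j) * exp (2 * c * min (real (q j)) (x j - q j)) * (exp 1 * (x j + 1)) * ((\<zeta> / exp 1) ^ q j * \<rho> ^ ((a - j) * q j))"
      .
  qed (auto intro!: mult_nonneg_nonneg simp: less_imp_le)
  also have "\<dots> = exp (2 * exp (- c) * (\<Sum>j\<in>S. x j)) * (\<Prod>j\<in>S. exp 1 * (x j + 1)) * (exp (2 * c * m) * (\<zeta> / exp 1) ^ Q * \<rho> ^ N)"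
  proof -
    have "(\<Prod>j\<in>S. exp (2 * exp (- c) * x j)) = exp (2 * exp (- c) * (\<Sum>j\<in>S. x j))"
      "(\<Prod>j\<in>S. exp (2 * c * min (real (q j)) (x j - q j))) = exp (2 * c * m)"
      unfolding m_def sum_distrib_left exp_sum[OF S(1)] by (rule refl)+
    moreover have "(\<Prod>j\<in>S. (\<zeta> / exp 1) ^ q j) = (\<zeta> / exp 1) ^ Q" "(\<Prod>j\<in>S. \<rho> ^ ((a - j) * q j)) = \<rho> ^ N"
      by (simp_all only: Q_def N_def power_sum)
    ultimately show ?thesis by (simp only: prod.distrib) (simp only: mult_ac)
  qed
  also have "\<dots> \<le> exp (2 * exp (- c) * (\<Sum>j\<in>S. x j)) * (\<Prod>j\<in>S. exp 1 * (x j + 1)) * (ff n N * (exp 1 * (real n + 1)))"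
    using key x0 by (intro mult_left_mono mult_nonneg_nonneg prod_nonneg) auto
  finally show ?thesis by (simp add: N_def mult_ac)
qed

lemma dw_nonzero [simp]: "dw u \<noteq> 0"
  by (simp add: dw_def)

lemma exists_profile:
  assumes "finite (S :: nat set)"
  shows "\<exists>(k::nat) (u::nat \<Rightarrow> nat). (\<forall>i<k. u i \<in> S) \<and> (\<forall>s\<in>S. card {i \<in> {..<k}. u i = s} = \<kappa> s)"
  using assms
proof (induction S rule: finite_induct)
  case empty
  show ?case by (intro exI[of _ "0::nat"]) auto
next
  case (insert s S)
  then obtain k :: nat and u :: "nat \<Rightarrow> nat" where ku: "\<forall>i<k. u i \<in> S" "\<forall>s\<in>S. card {i \<in> {..<k}. u i = s} = \<kappa> s" by blast
  define u' where "u' i = (if i < k then u i else s)" for i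
  have "u' i \<in> insert s S" for i using ku by (simp add: u'_def)
  moreover have "card {i \<in> {..<k + \<kappa> s}. u' i = r} = \<kappa> r" if r: "r \<in> insert s S" for r
  proof (cases "r = s")
    case True
    have "{i \<in> {..<k + \<kappa> s}. u' i = s} = {k..<k + \<kappa> s}"
    proof (intro equalityI subsetI)
      fix i assume i: "i \<in> {i \<in> {..<k + \<kappa> s}. u' i = s}"
      have "\<not> i < k"
      proof
        assume "i < k"
        then have "u i = s" "u i \<in> S" using i ku(1) by (auto simp: u'_def)
        then show False using insert.hyps by simp
      qed
      then show "i \<in> {k..<k + \<kappa> s}" using i by simp
    qed (simp add: u'_def)
    then show ?thesis using True by simp
  next
    case False
    then have "{i \<in> {..<k + \<kappa> s}. u' i = r} = {i \<in> {..<k}. u i = r}"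
      by (auto simp: u'_def split: if_splits)
    then show ?thesis using ku(2) r False by simp
  qed
  ultimately show ?case by blast
qed

text \<open>The term t = 2 dominates: raising \<open>t\<close> multiplies the bound by at most a^2 /
  M * 2 powr (a / 4), which is at most 1.\<close>

lemma pair_weight_le:
  assumes uv: "u \<le> a" "v \<le> a" and L: "2 * L \<le> a" and M: "0 < M" "2 powr (a / 2) \<le> real a ^ 10 * M"
    and a: "1 \<le> a" "real a ^ 12 * 2 powr (- real a / 4) \<le> 1"
  shows "pair_weight u v L (1 / M) \<le> real a ^ 5 / M\<^sup>2"
proof -
  have "pair_weight u v L (1 / M) \<le> (\<Sum>t=2..<L. 2 * real a ^ 4 / M\<^sup>2)"
    unfolding pair_weight_def
  proof (intro sum_mono)
    fix t assume t: "t \<in> {2..<L}"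
    define s where "s = t - 2"
    have s: "t = s + 2" using t unfolding s_def atLeastLessThan_iff by linarith
    have "real (u choose t) * ff v t * 2 ^ (t choose 2) * (1 / M) ^ t
       \<le> (real a ^ t * real a ^ t) * 2 ^ (t choose 2) * (1 / M) ^ t"
    proof (intro mult_right_mono mult_mono)
      show "real (u choose t) \<le> real a ^ t"
        by (rule order_trans[OF binomial_le_power_real]) (use uv in \<open>intro power_mono; simp\<close>)
      show "ff v t \<le> real a ^ t"
        by (rule order_trans[OF ff_le_power]) (use uv in \<open>intro power_mono; simp\<close>)
    qed (use M in auto)
    also have "\<dots> = (2 * real a ^ 4 / M\<^sup>2) * (real a ^ 2 * (1 / M) * 2 powr ((real t + 1) / 2)) ^ s"
    proof -
      \<comment> \<open>For t = s + 2, \<open>t choose 2\<close> is 1 + s (t + 1) / 2: the pair in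
        the term t = 2 is split off and the rest is an s-th power.\<close>
      have "(2::real) ^ (t choose 2) = 2 powr (1 + (real t + 1) / 2 * s)"
        unfolding two_power_choose_2 s by (simp add: field_simps)
      also have "\<dots> = 2 * (2 powr ((real t + 1) / 2)) ^ s" unfolding two_powr_power powr_add by simp
      finally have "(2::real) ^ (t choose 2) = 2 * (2 powr ((real t + 1) / 2)) ^ s" .
      moreover have "real a ^ t * real a ^ t = real a ^ 4 * (real a ^ 2) ^ s"
        unfolding s by (simp add: power_add power2_eq_square power4_eq_xxxx power_mult_distrib)
      moreover have "(1 / M) ^ t = (1 / M) ^ s * (1 / M\<^sup>2)" unfolding s by (simp add: power_add power_divide power2_eq_square)
      ultimately show ?thesis by (simp only: power_mult_distrib) (simp add: power_one_over mult_ac)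
    qed
    also have "\<dots> \<le> (2 * real a ^ 4 / M\<^sup>2) * 1"
    proof (intro mult_left_mono power_le_one)
      have "1 / M \<le> real a ^ 10 * 2 powr (- real a / 2)"
        using M by (simp add: powr_minus_divide field_simps)
      moreover have "2 powr ((real t + 1) / 2) \<le> 2 powr (real a / 4)"
        using t L by (intro powr_mono) auto
      ultimately have "real a ^ 2 * (1 / M) * 2 powr ((real t + 1) / 2)
         \<le> real a ^ 2 * (real a ^ 10 * 2 powr (- real a / 2)) * 2 powr (real a / 4)"
        using M by (intro mult_mono) auto
      also have "\<dots> = real a ^ 12 * (2 powr (- real a / 2) * 2 powr (real a / 4))"
        by (simp add: power_add[symmetric] mult_ac)
      also have "2 powr (- real a / 2) * 2 powr (real a / 4) = 2 powr (- real a / 4)"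
        by (simp add: powr_add[symmetric])
      finally show "real a ^ 2 * (1 / M) * 2 powr ((real t + 1) / 2) \<le> 1" using a(2) by linarith
    qed (use M in auto)
    finally show "real (u choose t) * ff v t * 2 ^ (t choose 2) * (1 / M) ^ t \<le> 2 * real a ^ 4 / M\<^sup>2" by simp
  qed
  also have "\<dots> = real (card {2..<L}) * (2 * real a ^ 4 / M\<^sup>2)" by simp
  also have "\<dots> \<le> (real a / 2) * (2 * real a ^ 4 / M\<^sup>2)"
    using L by (intro mult_right_mono) auto
  also have "\<dots> = real a ^ 5 / M\<^sup>2" by (simp add: power_add[symmetric] eval_nat_numeral)
  finally show ?thesis .
qed

text \<open>Each term factorises as \<open>R u t * R v t\<close> with R w w = 1 and R w t <= sqrt X
  for t < w. Hence only complete coincidence, t = u = v, contributes 1, and each of the other terms,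
  at most \<open>a\<close> in number, contributes at most sqrt X.\<close>

lemma sum_overlap_ratio_le:
  assumes uv: "a - J \<le> u" "u < a" "a - J \<le> v" "v < a" and L: "a = 2 * L" and J: "J \<le> a"
    and n: "real n \<le> 2 * a * 2 powr (a / 2)"
    and x: "2 * real a ^ 3 * 2 powr ((real J + 1) / 2 - real a / 4) \<le> 1"
  shows "(\<Sum>t\<in>{L..u}. real (u choose t) * overlap_ratio n u v t)
     \<le> of_bool (u = v) + a * sqrt (2 * real a ^ 3 * 2 powr ((real J + 1) / 2 - real a / 4))"
proof -
  define X where "X = 2 * real a ^ 3 * 2 powr ((real J + 1) / 2 - real a / 4)"
  have X: "0 \<le> X" "X \<le> 1" using x by (auto simp: X_def)
  define R where "R w t = real (w choose t) * sqrt (dw t * real n ^ (w - t) / dw w)" for w t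
  have R0: "0 \<le> R w t" for w t by (simp add: R_def less_imp_le)
  have Rw: "R w w = 1" for w using dw_pos[of w] by (simp add: R_def)
  have Rle: "R w t \<le> sqrt X" if w: "a - J \<le> w" "w < a" "L \<le> t" "t < w" for w t
  proof -
    define s where "s = w - t"
    have s: "1 \<le> s" "w = t + s" using w by (auto simp: s_def)
    have ch: "real (w choose t) \<le> real a ^ s"
    proof -
      have "real (w choose t) = real (w choose s)" using binomial_symmetric[of t w] w by (simp add: s_def)
      also have "\<dots> \<le> real w ^ s" by (rule binomial_le_power_real)
      also have "\<dots> \<le> real a ^ s" using w by (intro power_mono) auto
      finally show ?thesis .
    qed
    have d: "dw t / dw w \<le> (2 powr (- (real w + t - 1) / 2)) ^ s"
    proof -
      have "dw t / dw w = (fact t / fact w) * (2 powr (real t * (real t - 1) / 2) / 2 powr (real w * (real w - 1) / 2))"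
        by (simp add: dw_def two_power_choose_2)
      also have "\<dots> \<le> 1 * (2 powr (real t * (real t - 1) / 2) / 2 powr (real w * (real w - 1) / 2))"
        using w by (intro mult_right_mono) (auto simp: fact_mono)
      also have "\<dots> = 2 powr (real t * (real t - 1) / 2 - real w * (real w - 1) / 2)" by (simp add: powr_diff)
      also have "real t * (real t - 1) / 2 - real w * (real w - 1) / 2 = (- (real w + t - 1) / 2) * s"
        unfolding s(2) by (simp add: field_simps)
      finally show ?thesis unfolding two_powr_power .
    qed
    have "(R w t)\<^sup>2 = (real (w choose t))\<^sup>2 * (dw t / dw w) * real n ^ s"
      using dw_pos[of t] dw_pos[of w] by (simp add: R_def power_mult_distrib s_def less_imp_le)
    also have "\<dots> \<le> (real a ^ s)\<^sup>2 * (2 powr (- (real w + t - 1) / 2)) ^ s * (2 * a * 2 powr (real a / 2)) ^ s"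
      using ch d n by (intro mult_mono power_mono mult_nonneg_nonneg) (auto simp: less_imp_le)
    also have "\<dots> = ((real a)\<^sup>2 * 2 powr (- (real w + t - 1) / 2) * (2 * a * 2 powr (real a / 2))) ^ s"
      by (simp add: power_mult_distrib power_mult[symmetric] mult.commute)
    also have "\<dots> \<le> X ^ s"
    proof (intro power_mono)
      have "(real a)\<^sup>2 * 2 powr (- (real w + t - 1) / 2) * (2 * a * 2 powr (real a / 2))
          = 2 * real a ^ 3 * 2 powr (- (real w + t - 1) / 2 + real a / 2)"
        by (simp add: powr_add power2_eq_square power3_eq_cube)
      also have "\<dots> \<le> X" unfolding X_def
      proof (intro mult_left_mono powr_mono)
        have "real a - real J \<le> real w" using w(1) J by linarith
        moreover have "real a / 2 \<le> real t" using w(3) L by linarith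
        ultimately have "0 \<le> ((real w + t) - (3 / 2 * real a - J)) / 2" by simp
        then show "- (real w + t - 1) / 2 + real a / 2 \<le> (real J + 1) / 2 - real a / 4" by (simp add: field_simps)
      qed auto
      finally show "(real a)\<^sup>2 * 2 powr (- (real w + t - 1) / 2) * (2 * a * 2 powr (real a / 2)) \<le> X" .
    qed auto
    also have "\<dots> \<le> X" using power_decreasing[OF s(1) X] by simp
    finally show ?thesis by (rule real_le_rsqrt)
  qed
  have sX: "0 \<le> sqrt X" "sqrt X \<le> 1" using X by auto
  have bound: "real (u choose t) * overlap_ratio n u v t \<le> of_bool (u = v \<and> t = u) + sqrt X" if t: "t \<in> {L..u}" for t
  proof (cases "t \<le> v")
    case False
    then show ?thesis using sX by (simp add: overlap_ratio_def ff_eq_0)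
  next
    case True
    have "ff v t = real (v choose t) * fact t" using True by (simp add: ff_fact binomial_fact)
    then have "real (u choose t) * overlap_ratio n u v t
       = real (u choose t) * real (v choose t) * (dw t * sqrt (real n ^ (u - t) * real n ^ (v - t) / (dw u * dw v)))"
      by (simp add: overlap_ratio_def dw_def)
    also have "dw t * sqrt (real n ^ (u - t) * real n ^ (v - t) / (dw u * dw v))
       = sqrt (dw t * real n ^ (u - t) / dw u) * sqrt (dw t * real n ^ (v - t) / dw v)"
    proof -
      have sq: "sqrt (dw t * dw t) = dw t" by (simp add: abs_of_pos[OF dw_pos])
      have "dw t * sqrt (real n ^ (u - t) * real n ^ (v - t) / (dw u * dw v))
         = sqrt (dw t * dw t) * sqrt (real n ^ (u - t) * real n ^ (v - t) / (dw u * dw v))"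
        by (simp only: sq)
      also have "\<dots> = sqrt ((dw t * dw t) * (real n ^ (u - t) * real n ^ (v - t) / (dw u * dw v)))"
        by (rule real_sqrt_mult[symmetric])
      also have "(dw t * dw t) * (real n ^ (u - t) * real n ^ (v - t) / (dw u * dw v))
         = (dw t * real n ^ (u - t) / dw u) * (dw t * real n ^ (v - t) / dw v)" by simp
      finally show ?thesis by (simp only: real_sqrt_mult)
    qed
    finally have e: "real (u choose t) * overlap_ratio n u v t = R u t * R v t" by (simp only: R_def mult_ac)
    have Lt: "L \<le> t" "t \<le> u" using t by auto
    show ?thesis
    proof (cases "t = u")
      case tu: True
      show ?thesis
      proof (cases "u = v")
        case True
        then show ?thesis using e tu Rw sX by simp
      next
        case False
        then have "R v t \<le> sqrt X" using tu True Lt uv by (intro Rle) auto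
        then show ?thesis using e tu Rw False by simp
      qed
    next
      case False
      then have "R u t \<le> sqrt X" using Lt uv by (intro Rle) auto
      moreover have "R v t \<le> 1"
      proof (cases "t = v")
        case False
        then have "R v t \<le> sqrt X" using True Lt uv by (intro Rle) auto
        then show ?thesis using sX by linarith
      qed (simp add: Rw)
      ultimately have "R u t * R v t \<le> sqrt X * 1" using R0 sX by (intro mult_mono) auto
      then show ?thesis using e False by simp
    qed
  qed
  have "(\<Sum>t\<in>{L..u}. real (u choose t) * overlap_ratio n u v t) \<le> (\<Sum>t\<in>{L..u}. of_bool (u = v \<and> t = u) + sqrt X)"
    by (intro sum_mono bound)
  also have "\<dots> = (\<Sum>t\<in>{L..u}. of_bool (u = v \<and> t = u)) + real (card {L..u}) * sqrt X" by (simp only: sum.distrib sum_constant)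
  also have "(\<Sum>t\<in>{L..u}. of_bool (u = v \<and> t = u)) \<le> (of_bool (u = v) :: real)"
    by (cases "u = v") (auto simp: of_bool_def sum.If_cases)
  also have "real (card {L..u}) * sqrt X \<le> real a * sqrt X"
    using uv L sX by (intro mult_right_mono) (auto simp: of_nat_diff)
  finally show ?thesis by (simp add: X_def)
qed

section \<open>The optimal profile\<close>

text \<open>The class size \<open>a\<close> is the parameter; \<open>n0\<close> is chosen such that the expected number \<open>mu\<close> of
  independent sets of size \<open>a\<close> is about \<open>n0 / (100 a\<^sup>2)\<close>. The colour classes have sizes
  \<open>a - j\<close> for \<open>1 \<le> j \<le> J\<close>, and \<open>x b j\<close> is the number of classes of size \<open>a - j\<close>; these numbers
  maximise the expected number of colourings for a given number of classes, and \<open>b\<close> is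
  fixed by the requirement that the expected number of colourings is about \<open>1\<close>.\<close>

lemma ln2_bounds: "693 / 1000 \<le> ln (2::real)" "ln (2::real) \<le> 7 / 10"
proof -
  have "ln (2::real) \<in> {307/443<..<4615/6658}"
    using ln_approx_bounds[of 2 3] by (simp add: eval_nat_numeral)
  then show "693 / 1000 \<le> ln (2::real)" "ln (2::real) \<le> 7 / 10" by simp_all
qed

lemma sqrt2_bounds: "14142 / 10000 \<le> sqrt 2" "sqrt 2 \<le> 14143 / 10000"
proof -
  show "14142 / 10000 \<le> sqrt 2" by (rule real_le_rsqrt) (simp add: power2_eq_square)
  show "sqrt 2 \<le> 14143 / 10000" by (rule real_le_lsqrt) (simp_all add: power2_eq_square)
qed

lemma powr_half: "(2::real) powr (1 / 2) = sqrt 2"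
  by (simp add: powr_half_sqrt)

lemma sum_half_powers: "(\<Sum>j=1..m. (1 / 2) ^ j) \<le> (1::real)"
proof -
  have "(\<Sum>j=1..m. (1 / 2) ^ j) = (1::real) - (1 / 2) ^ m" by (induction m) auto
  then show ?thesis by simp
qed

text \<open>The fourth power fits two demands: J^2 is small compared with \<open>a\<close>, so the
  shape of the profile is nearly Gaussian, and 2 powr (J^2 / 2) is large compared with
  \<open>a\<close>, so sizes below a - J are negligible. Moreover a / 2 = J^4 is an integer and can
  serve as the threshold \<open>L\<close>. The numbered inequalities are growth conditions that hold
  for all large \<open>J\<close>.\<close>

locale large =
  fixes J a :: nat
  assumes a_eq: "a = 2 * J ^ 4" and J16: "16 \<le> J"
    and L1: "300 * real a \<le> 2 powr (real a - 1)"
    and L2: "ln (200 * real a) + 20 \<le> 48 / 10000 * real a"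
    and L3: "4100 * ln (real a) \<le> real a"
    and L4: "real a ^ 100 * 2 powr (- real a / 8) \<le> 1"
    and L5: "30 \<le> ln (real a)"
    and L6: "real a * 2 powr (- (real J * (real J / 2 - 4))) \<le> 1"
begin

abbreviation "A \<equiv> real a"

definition "v = 2 powr (A / 2)"

lemma J4: "512 * (real J)\<^sup>2 \<le> A"
proof -
  have "(16::real)\<^sup>2 \<le> (real J)\<^sup>2" using J16 by (intro power_mono) auto
  then have "256 * (real J)\<^sup>2 \<le> (real J)\<^sup>2 * (real J)\<^sup>2" by (intro mult_right_mono) auto
  then show ?thesis by (simp add: a_eq power_add[symmetric])
qed

lemma A_large: "131072 \<le> A"
proof -
  have "(16::real)\<^sup>2 \<le> (real J)\<^sup>2" using J16 by (intro power_mono) auto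
  then show ?thesis using J4 by simp
qed

lemma J_le: "real J \<le> A / 8192" "J < a"
proof -
  have "16 * real J \<le> (real J)\<^sup>2" using J16 by (simp add: power2_eq_square)
  then show "real J \<le> A / 8192" using J4 by simp
  then show "J < a" using A_large by linarith
qed

lemma v_large: "4096 \<le> v"
proof -
  have "(2::real) powr 12 \<le> v" unfolding v_def using A_large by (intro powr_mono) auto
  then show ?thesis by simp
qed

text \<open>Consequently mu / n0 = (n0 / v)^(a - 1) / a!, which places \<open>n0\<close> near a v /
  e.\<close>

lemma dw_a: "dw a = fact a * v ^ (a - 1)"
proof -
  have "real (a - 1) = A - 1" using A_large by (simp add: of_nat_diff)
  then show ?thesis unfolding dw_def two_power_choose_2 v_def two_powr_power by (simp add: field_simps)
qed

section \<open>The number of vertices belonging to the class size\<close>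

definition n0 :: nat where
  "n0 = (LEAST n. dw a / (100 * A\<^sup>2) \<le> real n ^ (a - 1))"

lemma power_a: "z ^ a = z * z ^ (a - 1)" for z :: real
  using A_large by (cases a) auto

lemma n0_upper: "dw a / (100 * A\<^sup>2) \<le> real n0 ^ (a - 1)" "real n0 \<le> A * v + 1"
proof -
  define m where "m = nat \<lceil>A * v\<rceil>"
  have Av: "0 \<le> A * v" using v_large by simp
  have m: "A * v \<le> real m" "real m \<le> A * v + 1" using Av unfolding m_def by linarith+
  have "fact a \<le> A ^ a" using ff_le_power[of a a] by (simp add: ff_fact)
  then have "dw a / (100 * A\<^sup>2) \<le> A ^ a * v ^ (a - 1) / (100 * A\<^sup>2)"
    unfolding dw_a using v_large by (intro divide_right_mono mult_right_mono) auto
  also have "\<dots> = (A * v) ^ (a - 1) * (A / (100 * A\<^sup>2))" by (simp add: power_a power_mult_distrib)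
  also have "\<dots> \<le> (A * v) ^ (a - 1) * 1"
    by (intro mult_left_mono zero_le_power Av) (use A_large in \<open>simp add: power2_eq_square field_simps\<close>)
  also have "\<dots> \<le> real m ^ (a - 1)" using m Av by (auto intro!: power_mono)
  finally have P: "dw a / (100 * A\<^sup>2) \<le> real m ^ (a - 1)" .
  then show "dw a / (100 * A\<^sup>2) \<le> real n0 ^ (a - 1)" unfolding n0_def by (rule LeastI)
  have "n0 \<le> m" unfolding n0_def by (rule Least_le) (rule P)
  then show "real n0 \<le> A * v + 1" using m by linarith
qed

lemma n0_le: "real n0 \<le> 2 * A * v"
proof -
  have "1 * 1 \<le> A * v" using A_large v_large by (intro mult_mono) auto
  then show ?thesis using n0_upper(2) by simp
qed

text \<open>From a! >= (a / e)^a and e <= 3; replacing 3 by 6 gains 2^(a - 1), which absorbs the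
  polynomial factors.\<close>

lemma n0_ge: "A * v / 6 \<le> real n0"
proof -
  have e: "exp (1::real) \<le> 3" by (rule exp_le)
  have a1: "0 < a - 1" using A_large by linarith
  have "300 * A \<le> 2 ^ (a - 1)"
  proof -
    have "2 powr (A - 1) = 2 ^ (a - 1)" using a1 by (simp add: powr_realpow[symmetric] of_nat_diff)
    then show ?thesis using L1 by simp
  qed
  then have "(A / 6) ^ (a - 1) * (300 * A) \<le> (A / 6) ^ (a - 1) * 2 ^ (a - 1)" by (intro mult_left_mono) auto
  also have "\<dots> = (A / 3) ^ (a - 1)" by (simp add: power_mult_distrib[symmetric])
  also have "\<dots> \<le> (A / exp 1) ^ (a - 1)" using e by (intro power_mono divide_left_mono) auto
  finally have "(A / 6) ^ (a - 1) * (300 * A) \<le> (A / exp 1) ^ (a - 1)" .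
  then have "(A / 6) ^ (a - 1) * (300 * A) * (A / 3) \<le> (A / exp 1) ^ (a - 1) * (A / exp 1)"
    using e by (intro mult_mono divide_left_mono) auto
  also have "\<dots> = (A / exp 1) ^ a" using power_a[of "A / exp 1"] by (simp only: mult.commute)
  also have "\<dots> \<le> fact a" by (rule fact_ge)
  finally have "(A / 6) ^ (a - 1) * (100 * A\<^sup>2) \<le> fact a" by (simp add: power2_eq_square mult_ac)
  then have "(A / 6) ^ (a - 1) \<le> fact a / (100 * A\<^sup>2)"
    using A_large by (simp add: pos_le_divide_eq)
  then have "(A / 6) ^ (a - 1) * v ^ (a - 1) \<le> fact a / (100 * A\<^sup>2) * v ^ (a - 1)"
    using v_large by (intro mult_right_mono) auto
  also have "\<dots> = dw a / (100 * A\<^sup>2)" by (simp add: dw_a)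
  also have "\<dots> \<le> real n0 ^ (a - 1)" by (rule n0_upper)
  finally have "(A * v / 6) ^ (a - 1) \<le> real n0 ^ (a - 1)" by (simp add: power_mult_distrib power_divide)
  then show ?thesis using a1 v_large by (subst (asm) power_mono_iff) auto
qed

lemma n0_big: "600 * A \<le> real n0" "v \<le> real n0" "1000 \<le> real n0"
proof -
  have "A * 4096 \<le> A * v" using v_large by (intro mult_left_mono) auto
  then show 1: "600 * A \<le> real n0" using n0_ge by simp
  have "131072 * v \<le> A * v" using A_large v_large by (intro mult_right_mono) auto
  then show "v \<le> real n0" using n0_ge v_large by linarith
  show "1000 \<le> real n0" using 1 A_large by linarith
qed

definition "mu = real n0 ^ a / dw a"

lemma mu_ge: "real n0 / (100 * A\<^sup>2) \<le> mu"
proof -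
  have "real n0 * (dw a / (100 * A\<^sup>2)) \<le> real n0 * real n0 ^ (a - 1)"
    using n0_upper by (intro mult_left_mono) auto
  then have "real n0 / (100 * A\<^sup>2) * dw a \<le> real n0 ^ a" by (simp add: power_a)
  then show ?thesis unfolding mu_def by (simp add: pos_le_divide_eq)
qed

lemma mu_pos: "0 < mu"
  unfolding mu_def using n0_big by (intro divide_pos_pos zero_less_power) auto

text \<open>Minimality of \<open>n0\<close>: passing from n0 - 1 to n0 at most doubles the power
  with exponent a - 1, by Bernoulli's inequality and n0 >= 600 a.\<close>

lemma mu_le: "mu \<le> real n0 / (50 * A\<^sup>2)"
proof -
  have n: "1 \<le> n0" "real (n0 - 1) = real n0 - 1" using n0_big by (auto simp: of_nat_diff)
  have "n0 - 1 < n0" using n by simp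
  then have lt: "real (n0 - 1) ^ (a - 1) < dw a / (100 * A\<^sup>2)"
    using not_less_Least[of "n0 - 1" "\<lambda>n. dw a / (100 * A\<^sup>2) \<le> real n ^ (a - 1)"] unfolding n0_def by auto
  have "1 - real (a - 1) * (1 / real n0) \<le> (1 - 1 / real n0) ^ (a - 1)"
    using Bernoulli_inequality[of "- (1 / real n0)" "a - 1"] n0_big by (simp add: field_simps)
  moreover have "real (a - 1) * (1 / real n0) \<le> 1 / 2" using n0_big A_large by (simp add: field_simps of_nat_diff)
  ultimately have "1 / 2 \<le> (1 - 1 / real n0) ^ (a - 1)" by linarith
  then have "real n0 ^ (a - 1) * (1 / 2) \<le> real n0 ^ (a - 1) * (1 - 1 / real n0) ^ (a - 1)"
    by (intro mult_left_mono) auto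
  also have "\<dots> = real (n0 - 1) ^ (a - 1)"
    unfolding power_mult_distrib[symmetric] n(2) using n0_big by (simp add: right_diff_distrib)
  finally have "real n0 ^ (a - 1) \<le> 2 * (dw a / (100 * A\<^sup>2))" using lt by linarith
  then have "real n0 * real n0 ^ (a - 1) \<le> real n0 * (2 * (dw a / (100 * A\<^sup>2)))" by (intro mult_left_mono) auto
  then have "real n0 ^ a \<le> real n0 / (50 * A\<^sup>2) * dw a" by (simp add: power_a field_simps)
  then show ?thesis unfolding mu_def by (simp add: pos_divide_le_eq)
qed

section \<open>The tilted Gaussian profile and its multipliers\<close>

text \<open>The ratio of the number of classes of size a - j to that of size \<open>a\<close> in a
  stationary profile: a discrete Gaussian with tilt \<open>b\<close>, times a factorial correction
  between 998/1000 and 1 for j <= J.\<close>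

definition h :: "real \<Rightarrow> nat \<Rightarrow> real" where
  "h b j = 2 powr (b * j - (real j)\<^sup>2 / 2) * (ff a j / A ^ j)"

definition "Z b = (\<Sum>j=1..J. h b j)"
definition "T b = (\<Sum>j=1..J. real j * h b j)"
definition "jb b = T b / Z b"
text \<open>Normalises the number of covered vertices to \<open>n0\<close>. Since h b 0 = 1, it is
  also the number of classes of size \<open>a\<close> that the profile would contain if it were
  extended to j = 0.\<close>

definition "K b = real n0 / (A * Z b - T b)"
text \<open>\<open>rho\<close> and \<open>zeta\<close> are the exponentials of the Lagrange
  multipliers for vertices and colours: x b j * dw (a - j) = zeta b * rho b ^ (a - j).\<close>

definition "rho b = A * 2 powr (A - 1 / 2 - b)"
definition "zeta b = K b * dw a / rho b ^ a"
definition "Lam b = 1 + ln (rho b / n0)"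
definition "x b j = K b * h b j"

lemma fr_le: "ff a j / A ^ j \<le> 1"
  using ff_le_power[of a j] A_large by (simp add: divide_le_eq)

lemma fr_ge: "998 / 1000 \<le> ff a j / A ^ j" if "j \<le> J"
proof -
  have q: "0 \<le> real J / A" "real J / A \<le> 1" using J_le A_large by auto
  have "1 - real j * (real J / A) \<le> (1 - real J / A) ^ j"
    using Bernoulli_inequality[of "- (real J / A)" j] q by simp
  moreover have "real j * (real J / A) \<le> 2 / 1000"
  proof -
    have "real j * real J \<le> (real J)\<^sup>2" using that by (simp add: power2_eq_square mult_right_mono)
    then have "512 * (real j * real J) \<le> A" using J4 by linarith
    then show ?thesis using A_large by (simp add: field_simps)
  qed
  moreover have "(1 - real J / A) ^ j \<le> ff a j / A ^ j"
  proof -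
    have "(1 - real J / A) ^ j = (\<Prod>i<j. 1 - real J / A)" by simp
    also have "\<dots> \<le> (\<Prod>i<j. (A - real i) / A)"
      using q that A_large by (intro prod_mono) (auto simp: diff_divide_distrib intro!: divide_right_mono)
    also have "\<dots> = ff a j / A ^ j" by (simp add: ff_def prod_dividef)
    finally show ?thesis .
  qed
  ultimately show ?thesis by linarith
qed

lemma h_pos: "0 < h b j" if "j \<le> a"
  unfolding h_def using that A_large by (intro mult_pos_pos divide_pos_pos ff_pos) auto

lemma h_nonneg: "0 \<le> h b j"
  unfolding h_def by (intro mult_nonneg_nonneg divide_nonneg_nonneg) auto

lemma h_le: "h b j \<le> 2 powr (b * j - (real j)\<^sup>2 / 2)"
  unfolding h_def using mult_left_mono[OF fr_le[of j], of "2 powr (b * j - (real j)\<^sup>2 / 2)"] by simp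

lemma h_ge: "998 / 1000 * 2 powr (b * j - (real j)\<^sup>2 / 2) \<le> h b j" if "j \<le> J"
  unfolding h_def using fr_ge[OF that] by (subst mult.commute) (intro mult_left_mono; simp)

lemma h_le_geometric: "h b j \<le> 256 * (1 / 2) ^ j" if "b \<le> 3"
proof -
  have "b * j \<le> 3 * real j" using that by (intro mult_right_mono) auto
  moreover have "0 \<le> (real j - 4)\<^sup>2" by simp
  ultimately have "b * j - (real j)\<^sup>2 / 2 \<le> 8 - real j" by (simp add: power2_eq_square algebra_simps)
  then have "2 powr (b * j - (real j)\<^sup>2 / 2) \<le> 2 powr (8 - real j)" by (intro powr_mono) auto
  also have "\<dots> = 256 * (1 / 2) ^ j" by (simp add: powr_diff powr_realpow power_divide)
  finally show ?thesis using h_le[of b j] by linarith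
qed

lemma h1: "h b 1 = 2 powr (b - 1 / 2)"
  using A_large by (simp add: h_def ff_def)

lemma Z_bounds: assumes "0 \<le> b" "b \<le> 3" shows "7 / 10 \<le> Z b" "Z b \<le> 256"
proof -
  have "7 / 10 \<le> 2 powr (- 1 / 2 :: real)"
    using sqrt2_bounds by (simp add: powr_minus_divide powr_half field_simps)
  also have "\<dots> \<le> 2 powr (b - 1 / 2)" using assms by (intro powr_mono) auto
  also have "\<dots> = h b 1" by (simp only: h1)
  also have "\<dots> \<le> Z b" unfolding Z_def using J16 by (intro member_le_sum h_nonneg) auto
  finally show "7 / 10 \<le> Z b" .
  have "Z b \<le> (\<Sum>j=1..J. 256 * (1 / 2) ^ j)" unfolding Z_def by (intro sum_mono h_le_geometric assms)
  also have "\<dots> = 256 * (\<Sum>j=1..J. (1 / 2) ^ j)" by (simp only: sum_distrib_left)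
  also have "\<dots> \<le> 256" using sum_half_powers[of J] by simp
  finally show "Z b \<le> 256" .
qed

lemma Z_pos: "0 < Z b"
  unfolding Z_def using J16 J_le(2) by (intro sum_pos h_pos) auto

lemma T_bounds: "Z b \<le> T b" "T b \<le> J * Z b"
proof -
  show "Z b \<le> T b" unfolding Z_def T_def
  proof (intro sum_mono)
    fix j assume "j \<in> {1..J}"
    then have "1 * h b j \<le> real j * h b j" by (intro mult_right_mono h_nonneg) auto
    then show "h b j \<le> real j * h b j" by simp
  qed
  show "T b \<le> J * Z b" unfolding Z_def T_def sum_distrib_left
    by (intro sum_mono mult_right_mono h_nonneg) auto
qed

lemma jb_bounds: "1 \<le> jb b" "jb b \<le> J"
  unfolding jb_def using T_bounds[of b] Z_pos[of b] by (auto simp: field_simps)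

lemma AZT: "A * Z b - T b = Z b * (A - jb b)"
  unfolding jb_def using Z_pos[of b] by (simp add: right_diff_distrib mult.commute)

lemma AZT_pos: "0 < A * Z b - T b"
  unfolding AZT using Z_pos[of b] jb_bounds[of b] J_le A_large by (intro mult_pos_pos) linarith+

lemma K_pos: "0 < K b"
  unfolding K_def using AZT_pos n0_big by (intro divide_pos_pos) auto

lemma K_bounds: assumes "0 \<le> b" "b \<le> 3" shows "real n0 / (256 * A) \<le> K b" "K b \<le> 2 * real n0 / A"
proof -
  have "A * Z b - T b \<le> 256 * A"
    using Z_bounds[OF assms] T_bounds(1)[of b] mult_left_mono[of "Z b" 256 A] by simp
  then show "real n0 / (256 * A) \<le> K b" unfolding K_def
    using AZT_pos[of b] A_large by (intro divide_left_mono) auto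
  have jb': "jb b \<le> A / 8192" using jb_bounds(2)[of b] J_le(1) by linarith
  have "A / 2 \<le> 7 / 10 * (A - jb b)" using jb' A_large by simp
  also have "\<dots> \<le> Z b * (A - jb b)" using Z_bounds[OF assms] jb' A_large by (intro mult_right_mono) auto
  finally have "A / 2 \<le> A * Z b - T b" by (simp add: AZT)
  then have "K b \<le> real n0 / (A / 2)" unfolding K_def using A_large AZT_pos[of b] by (intro divide_left_mono) auto
  then show "K b \<le> 2 * real n0 / A" by (simp add: mult.commute)
qed

lemma rho_pos: "0 < rho b"
  using A_large by (simp add: rho_def)

text \<open>Since \<open>n0\<close> lies between A v / 6 and 2 A v, the quotient rho / n0 is 2 powr
  (A / 2) up to a bounded factor.\<close>

lemma Lam_bounds: assumes "0 \<le> b" "b \<le> 3"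
  shows "A / 2 * ln 2 - 4 \<le> Lam b" "Lam b \<le> A / 2 * ln 2 + 3"
proof -
  have n: "0 < real n0" using n0_big by simp
  have lnv: "ln v = A / 2 * ln 2" by (simp add: v_def ln_powr)
  have lA: "0 < A" "0 < v" using A_large v_large by auto
  have lr: "ln (rho b / n0) = ln A + (A - 1 / 2 - b) * ln 2 - ln n0"
    using n lA by (simp add: rho_def ln_div ln_mult ln_powr)
  have "ln n0 \<le> ln (2 * A * v)" using n0_le n by (subst ln_le_cancel_iff) auto
  also have "\<dots> = ln 2 + ln A + ln v" using lA by (simp add: ln_mult)
  finally have 1: "ln n0 \<le> ln 2 + ln A + ln v" .
  have "ln (A * v / 6) \<le> ln n0" using n0_ge n lA by (subst ln_le_cancel_iff) auto
  moreover have "ln (A * v / 6) = ln A + ln v - ln 6" using lA by (simp add: ln_mult ln_div)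
  ultimately have 2: "ln A + ln v - ln 6 \<le> ln n0" by simp
  have ln6: "ln (6::real) \<le> 21 / 10"
  proof -
    have "ln (6::real) \<le> ln (2 * 2 * 2)" by (subst ln_le_cancel_iff) auto
    also have "\<dots> = 3 * ln 2" by (simp only: ln_mult) simp
    finally show ?thesis using ln2_bounds by linarith
  qed
  have "b * ln 2 \<le> 3 * ln 2" "0 \<le> b * ln 2" using assms by (auto intro: mult_right_mono)
  moreover have "Lam b = 1 + ln A + A * ln 2 - ln 2 / 2 - b * ln 2 - ln n0"
    unfolding Lam_def lr by (simp add: algebra_simps)
  moreover have "A / 2 * ln 2 = A * ln 2 / 2" by simp
  ultimately show "A / 2 * ln 2 - 4 \<le> Lam b" "Lam b \<le> A / 2 * ln 2 + 3"
    using 1 2 ln6 ln2_bounds lnv by linarith+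
qed

lemma K_mu: assumes "0 \<le> b" "b \<le> 3"
  shows "0 \<le> ln (K b / mu)" "ln (K b / mu) \<le> ln (200 * A)"
proof -
  have Ap: "0 < A" using A_large by simp
  have n: "0 < real n0" using n0_big by simp
  have "mu \<le> real n0 / (50 * A\<^sup>2)" by (rule mu_le)
  also have "\<dots> \<le> real n0 / (256 * A)"
    using A_large n by (intro divide_left_mono) (auto simp: power2_eq_square)
  also have "\<dots> \<le> K b" by (rule K_bounds[OF assms])
  finally have "1 \<le> K b / mu" using mu_pos by (simp add: pos_le_divide_eq)
  then show "0 \<le> ln (K b / mu)" by simp
  have "K b / mu \<le> (2 * real n0 / A) / (real n0 / (100 * A\<^sup>2))"
    using K_bounds[OF assms] mu_ge K_pos[of b] n Ap by (intro frac_le) auto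
  also have "\<dots> = 200 * A" using n Ap by (simp add: power2_eq_square)
  finally show "ln (K b / mu) \<le> ln (200 * A)" using K_pos[of b] mu_pos Ap by (subst ln_le_cancel_iff) auto
qed

text \<open>At tilt 0 the class j = 1, of weight 2 powr (-1/2), outweighs the total excess over 2 of
  all j >= 3, which is at most 1/2.\<close>

lemma jb_0: "jb 0 \<le> 2"
proof -
  have "T 0 - 2 * Z 0 = (\<Sum>j=1..J. (real j - 2) * h 0 j)"
    by (simp add: T_def Z_def sum_distrib_left sum_subtractf[symmetric] left_diff_distrib)
  also have "{1..J} = insert 1 {2..J}" using J16 by auto
  also have "(\<Sum>j\<in>insert 1 {2..J}. (real j - 2) * h 0 j) = - h 0 1 + (\<Sum>j=2..J. (real j - 2) * h 0 j)" by simp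
  also have "(\<Sum>j=2..J. (real j - 2) * h 0 j) \<le> (\<Sum>j=2..J. 1 / 2 * (1 / 2) ^ j)"
  proof (intro sum_mono)
    fix j assume "j \<in> {2..J}"
    then have j: "2 \<le> j" by simp
    show "(real j - 2) * h 0 j \<le> 1 / 2 * (1 / 2) ^ j"
    proof (cases "j = 2")
      case False
      have "j - 3 + 1 \<le> 2 ^ (j - 3)" using less_exp[of "j - 3"] by (simp add: Suc_le_eq)
      then have "real (j - 3 + 1) \<le> real (2 ^ (j - 3))" by (rule of_nat_mono)
      then have "real j - 2 \<le> 2 ^ (j - 3)" using j False by (simp add: of_nat_diff)
      also have "(2::real) ^ (j - 3) = 2 powr (real j - 3)" using j False by (simp add: powr_realpow[symmetric] of_nat_diff)
      finally have "(real j - 2) * h 0 j \<le> 2 powr (real j - 3) * 2 powr (0 * real j - (real j)\<^sup>2 / 2)"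
        by (rule mult_mono[OF _ h_le]) (use h_nonneg in auto)
      also have "\<dots> = 2 powr (real j - 3 - (real j)\<^sup>2 / 2)" by (simp add: powr_add[symmetric])
      also have "\<dots> \<le> 2 powr (- 1 - real j)"
      proof (intro powr_mono)
        have "0 \<le> (real j - 2)\<^sup>2" by simp
        then show "real j - 3 - (real j)\<^sup>2 / 2 \<le> - 1 - real j" by (simp add: power2_eq_square algebra_simps)
      qed simp
      also have "\<dots> = 1 / 2 * (1 / 2) ^ j" by (simp add: powr_diff powr_realpow power_divide powr_minus_divide)
      finally show ?thesis .
    qed simp
  qed
  also have "(\<Sum>j=2..J. 1 / 2 * (1 / 2) ^ j) \<le> (\<Sum>j=1..J. 1 / 2 * (1 / 2 :: real) ^ j)" by (intro sum_mono2) auto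
  also have "\<dots> = 1 / 2 * (\<Sum>j=1..J. (1 / 2) ^ j)" by (simp only: sum_distrib_left)
  also have "\<dots> \<le> 1 / 2" using sum_half_powers[of J] by simp
  also have "- h 0 1 + 1 / 2 \<le> 0"
    unfolding h1 using sqrt2_bounds by (simp add: powr_minus_divide powr_half field_simps)
  finally have "T 0 \<le> 2 * Z 0" by simp
  then show ?thesis unfolding jb_def using Z_pos[of 0] by (simp add: divide_le_eq)
qed

text \<open>At tilt 3 the Gaussian weights are symmetric about j = 3. The five central terms already
  give the bound, the difference between 3 and 29/10 absorbing the factor 998/1000, and the terms
  from 6 on only help.\<close>

lemma jb_3: "29 / 10 \<le> jb 3"
proof -
  let ?f = "\<lambda>j. (real j - 29 / 10) * h 3 j"
  have "T 3 - 29 / 10 * Z 3 = (\<Sum>j=1..J. ?f j)"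
    by (simp add: T_def Z_def sum_distrib_left sum_subtractf[symmetric] left_diff_distrib)
  also have "{1..J} = {1, 2, 3, 4, 5} \<union> {6..J}" using J16 by auto
  also have "(\<Sum>j\<in>{1, 2, 3, 4, 5} \<union> {6..J}. ?f j) = (\<Sum>j\<in>{1, 2, 3, 4, 5}. ?f j) + (\<Sum>j=6..J. ?f j)"
    by (intro sum.union_disjoint) auto
  finally have e: "T 3 - 29 / 10 * Z 3 = (\<Sum>j\<in>{1, 2, 3, 4, 5}. ?f j) + (\<Sum>j=6..J. ?f j)" .
  have tail: "0 \<le> (\<Sum>j=6..J. ?f j)" by (intro sum_nonneg mult_nonneg_nonneg h_nonneg) auto
  have p: "(2::real) powr (5 / 2) = 4 * sqrt 2" "(2::real) powr (9 / 2) = 16 * sqrt 2"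
    using powr_add[of 2 2 "1 / 2 :: real"] powr_add[of 2 4 "1 / 2 :: real"] by (simp_all add: powr_half)
  have g: "998 / 1000 * 2 powr (3 * j - (real j)\<^sup>2 / 2) \<le> h 3 j" if "j \<le> 5" for j
    using h_ge[of j 3] that J16 by simp
  have "h 3 1 \<le> 4 * sqrt 2" "h 3 2 \<le> 16"
    using h_le[of 3 1] h_le[of 3 2] p by simp_all
  moreover have "998 / 1000 * (16 * sqrt 2) \<le> h 3 3" "998 / 1000 * 16 \<le> h 3 4" "998 / 1000 * (4 * sqrt 2) \<le> h 3 5"
    using g[of 3] g[of 4] g[of 5] p by simp_all
  ultimately have "0 \<le> (\<Sum>j\<in>{1, 2, 3, 4, 5}. ?f j)" using sqrt2_bounds by simp
  then have "29 / 10 * Z 3 \<le> T 3" using e tail by simp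
  then show ?thesis unfolding jb_def using Z_pos[of 3] by (simp add: le_divide_eq)
qed

text \<open>Since \<open>Lam\<close> is about A ln 2 / 2, the equation asks for a mean
  \<open>jb\<close> near 2 / ln 2, about 2.885. This lies between the means at the tilts 0 and 3, so
  the intermediate value theorem applies.\<close>

lemma exists_tilt: "\<exists>b. 0 \<le> b \<and> b \<le> 3 \<and> Lam b * jb b = A - 1 + ln (K b / mu)"
proof -
  define \<Psi> where "\<Psi> b = Lam b * jb b - (A - 1) - ln (K b / mu)" for b
  have "\<Psi> 0 \<le> 0"
  proof -
    have "Lam 0 * jb 0 \<le> (A / 2 * ln 2 + 3) * 2"
      using Lam_bounds[of 0] jb_0 jb_bounds(1)[of 0] ln2_bounds A_large by (intro mult_mono) auto
    also have "\<dots> = A * ln 2 + 6" by simp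
    also have "A * ln 2 \<le> A * (7 / 10)" using ln2_bounds by (intro mult_left_mono) auto
    finally show ?thesis unfolding \<Psi>_def using K_mu(1)[of 0] A_large by simp
  qed
  moreover have "0 \<le> \<Psi> 3"
  proof -
    have "A * (693 / 1000) \<le> A * ln 2" using ln2_bounds by (intro mult_left_mono) auto
    then have l: "A * (693 / 2000) - 4 \<le> Lam 3" using Lam_bounds(1)[of 3] by simp
    have "(A * (693 / 2000) - 4) * (29 / 10) \<le> Lam 3 * jb 3"
      using l jb_3 A_large by (intro mult_mono) auto
    then show ?thesis unfolding \<Psi>_def using K_mu(2)[of 3] L2 by simp
  qed
  moreover have "continuous_on {0..3} \<Psi>"
  proof -
    have h: "continuous_on {0..3} (\<lambda>b. h b j)" for j unfolding h_def by (intro continuous_intros) auto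
    have Z: "continuous_on {0..3} Z" unfolding Z_def by (intro continuous_intros h)
    have T: "continuous_on {0..3} T" unfolding T_def by (intro continuous_intros h)
    have jb: "continuous_on {0..3} jb" unfolding jb_def
      by (intro continuous_intros Z T) (use Z_pos in \<open>auto simp: less_le\<close>)
    have K: "continuous_on {0..3} K" unfolding K_def
      by (intro continuous_intros Z T) (use AZT_pos in \<open>auto simp: less_le\<close>)
    have rho: "continuous_on {0..3} rho" unfolding rho_def by (intro continuous_intros) auto
    have Lam: "continuous_on {0..3} Lam" unfolding Lam_def
      by (intro continuous_intros rho) (use rho_pos n0_big in \<open>auto simp: less_le\<close>)
    show ?thesis unfolding \<Psi>_def
      by (intro continuous_intros Lam jb K) (use K_pos mu_pos in \<open>auto simp: less_le\<close>)
  qed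
  ultimately obtain b where "0 \<le> b" "b \<le> 3" "\<Psi> b = 0"
    using IVT'[of \<Psi> 0 0 3] by auto
  then show ?thesis unfolding \<Psi>_def by (intro exI[of _ b]) auto
qed

lemma mean_x: "(\<Sum>j\<in>{1..J}. x b j * (real j - jb b)) = 0"
proof -
  have "(\<Sum>j\<in>{1..J}. x b j * (real j - jb b)) = K b * (\<Sum>j=1..J. real j * h b j - jb b * h b j)"
    unfolding sum_distrib_left x_def by (intro sum.cong refl) (simp add: algebra_simps)
  also have "(\<Sum>j=1..J. real j * h b j - jb b * h b j) = T b - jb b * Z b"
    by (simp add: T_def Z_def sum_subtractf sum_distrib_left)
  also have "\<dots> = 0" unfolding jb_def using Z_pos[of b] by simp
  finally show ?thesis by simp
qed

lemma sum_x: "(\<Sum>j\<in>{1..J}. x b j) = K b * Z b"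
  by (simp add: x_def Z_def sum_distrib_left)

lemma n0_eq: "real n0 = (\<Sum>j\<in>{1..J}. (A - real j) * x b j)"
proof -
  have "(\<Sum>j\<in>{1..J}. (A - real j) * x b j) = K b * (\<Sum>j=1..J. A * h b j - real j * h b j)"
    unfolding sum_distrib_left x_def by (intro sum.cong refl) (simp add: algebra_simps)
  also have "(\<Sum>j=1..J. A * h b j - real j * h b j) = A * Z b - T b"
    by (simp add: T_def Z_def sum_subtractf sum_distrib_left)
  also have "K b * (A * Z b - T b) = real n0" unfolding K_def using AZT_pos[of b] by simp
  finally show ?thesis by simp
qed

lemma x_nonneg: "0 \<le> x b j"
  unfolding x_def using K_pos[of b] h_nonneg[of b j] by simp

lemma x_dw: "x b j * dw (a - j) = zeta b * rho b ^ (a - j)" if "j \<le> a"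
proof -
  have r: "rho b ^ a = rho b ^ (a - j) * rho b ^ j" using that by (simp add: power_add[symmetric])
  have aj: "real (a - j) = A - real j" using that by (simp add: of_nat_diff)
  have "dw a = dw (a - j) * (ff a j * 2 powr (real j * (2 * A - j - 1) / 2))"
  proof -
    have "fact a = fact (a - j) * ff a j" using that by (simp add: ff_fact)
    moreover have "(2::real) ^ (a choose 2) = 2 ^ ((a - j) choose 2) * 2 powr (real j * (2 * A - j - 1) / 2)"
      unfolding two_power_choose_2 aj powr_add[symmetric] by (intro arg_cong[where f = "\<lambda>z. 2 powr z"]) (simp add: field_simps)
    ultimately show ?thesis by (simp add: dw_def)
  qed
  moreover have "rho b ^ j = A ^ j * 2 powr ((A - 1 / 2 - b) * j)"
    unfolding rho_def power_mult_distrib two_powr_power ..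
  moreover have "2 powr (real j * (2 * A - j - 1) / 2) = 2 powr ((A - 1 / 2 - b) * j) * 2 powr (b * j - (real j)\<^sup>2 / 2)"
    unfolding powr_add[symmetric] by (intro arg_cong[where f = "\<lambda>z. 2 powr z"]) (simp add: field_simps power2_eq_square)
  ultimately show ?thesis
    unfolding zeta_def r x_def h_def using rho_pos[of b] A_large by (simp add: field_simps)
qed

lemma zeta_pos: "0 < zeta b"
  unfolding zeta_def using K_pos[of b] rho_pos[of b] by simp

text \<open>Always ln zeta + A Lam = A + ln (K / mu), so the tilt equation is equivalent to the
  claim. The claim in turn says that the leading exponent of the expected number of colourings with
  this profile is 0.\<close>

lemma ln_zeta: assumes "Lam b * jb b = A - 1 + ln (K b / mu)"
  shows "1 - ln (zeta b) = (A - jb b) * Lam b"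
proof -
  have n: "0 < real n0" using n0_big by simp
  have "ln (zeta b) = ln (K b) + ln (dw a) - A * ln (rho b)"
    unfolding zeta_def using K_pos[of b] rho_pos[of b] by (simp add: ln_div ln_mult ln_realpow)
  moreover have "ln mu = A * ln n0 - ln (dw a)" unfolding mu_def using n by (simp add: ln_div ln_realpow)
  moreover have "ln (K b / mu) = ln (K b) - ln mu" using K_pos[of b] mu_pos by (simp add: ln_div)
  moreover have "Lam b = 1 + ln (rho b) - ln n0" unfolding Lam_def using rho_pos[of b] n by (simp add: ln_div)
  moreover from this have "A * Lam b = A * (1 + ln (rho b) - ln n0)" by (simp only:)
  moreover have "A * (1 + ln (rho b) - ln n0) = A + A * ln (rho b) - A * ln n0" by (simp add: algebra_simps)
  moreover have "(A - jb b) * Lam b = A * Lam b - Lam b * jb b" by (simp add: algebra_simps)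
  ultimately show ?thesis using assms by linarith
qed

end

lemma exp_1_ge: "27166 / 10000 \<le> exp (1::real)"
  using sum_power_fact_le_exp[of 1 5] by (simp add: eval_nat_numeral)

locale tilted = large +
  fixes b :: real
  assumes b: "0 \<le> b" "b \<le> 3" and tilt: "Lam b * jb b = A - 1 + ln (K b / mu)"
begin

section \<open>Numerical estimates for the tilted profile\<close>

definition "lA = A * ln 2"

lemma lA_bounds: "693 / 1000 * A \<le> lA" "lA \<le> 7 / 10 * A"
proof -
  have "A * (693 / 1000) \<le> A * ln 2" using ln2_bounds by (intro mult_left_mono) auto
  then show "693 / 1000 * A \<le> lA" by (simp only: lA_def mult.commute)
  have "A * ln 2 \<le> A * (7 / 10)" using ln2_bounds by (intro mult_left_mono) auto
  then show "lA \<le> 7 / 10 * A" by (simp only: lA_def mult.commute)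
qed

lemma Lam_lA: "lA / 2 - 4 \<le> Lam b" "Lam b \<le> lA / 2 + 3"
  using Lam_bounds[OF b] by (simp_all add: lA_def)

lemma ln_v: "ln v = lA / 2"
  by (simp add: v_def ln_powr lA_def)

lemma Lam_pos: "0 < Lam b"
  using Lam_lA lA_bounds A_large by linarith

lemma jb_small: "jb b \<le> A / 8192"
  using jb_bounds(2)[of b] J_le(1) by linarith

text \<open>By the tilt equation Lam (jb - 1) is about A - Lam, that is (1 - ln 2 / 2) A or roughly
  0.654 A. This leaves room below 7/10 for the logarithmic terms.\<close>

lemma large_classes_slack: "Lam b * (jb b - 1) / (A - 1) + 2 * (10 * ln A) / (A - J) \<le> 7 / 10"
  and small_loss: "2 * (10 * ln A) / (A - J) \<le> 1 / 200"
proof -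
  have "2 * (10 * ln A) \<le> 1 / 200 * (A - J)" using L3 J_le(1) A_large by simp
  then show 1: "2 * (10 * ln A) / (A - J) \<le> 1 / 200" using J_le A_large by (simp add: pos_divide_le_eq)
  have "Lam b * (jb b - 1) = A - 1 + ln (K b / mu) - Lam b" using tilt by (simp add: algebra_simps)
  also have "\<dots> \<le> A - 1 + ln (200 * A) - (lA / 2 - 4)" using K_mu(2)[OF b] Lam_lA(1) by linarith
  also have "\<dots> \<le> 69 / 100 * (A - 1)" using L2 lA_bounds(1) A_large by argo
  finally have "Lam b * (jb b - 1) / (A - 1) \<le> 69 / 100" using A_large by (simp add: pos_divide_le_eq)
  then show "Lam b * (jb b - 1) / (A - 1) + 2 * (10 * ln A) / (A - J) \<le> 7 / 10" using 1 by linarith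
qed

lemma jb_ln2: "2 - 3 / 10000 \<le> jb b * ln 2"
proof -
  have "A - 1 \<le> Lam b * jb b" using tilt K_mu(1)[OF b] by simp
  also have "\<dots> \<le> (lA / 2 + 3) * jb b"
    using Lam_lA(2) jb_bounds(1)[of b] by (intro mult_right_mono) auto
  finally have "(A - 1) * ln 2 \<le> (lA / 2 + 3) * jb b * ln 2" by (rule mult_right_mono) simp
  then have "(A - 1) * ln 2 \<le> (lA / 2 + 3) * (jb b * ln 2)" by (simp only: mult.assoc)
  moreover have "(A - 1) * ln 2 = lA - ln 2" by (simp add: left_diff_distrib lA_def)
  moreover have "(lA / 2 + 3) * (2 - 3 / 10000) = 19997 / 20000 * lA + 59991 / 10000" by (simp add: field_simps)
  ultimately have "(lA / 2 + 3) * (2 - 3 / 10000) \<le> (lA / 2 + 3) * (jb b * ln 2)"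
    using lA_bounds(1) A_large ln2_bounds by linarith
  moreover have "0 < lA / 2 + 3" using lA_bounds(1) A_large by linarith
  ultimately show ?thesis by (simp only: mult_le_cancel_left_pos)
qed

text \<open>Multiplying the Gaussian weight by 2 powr j shifts its index by one, up to the factor 2
  powr (b + 1 / 2). With 2 powr b at most 8 and at most 100/95 of the Gaussian sum, the constant is
  sqrt 2 * (100/95 + 8) * 1000/998.\<close>

lemma sum_h_two_powr: "(\<Sum>j=1..J. h b j * 2 powr j) \<le> 1283 / 100 * Z b"
proof -
  define g where "g l = 2 powr (b * l - (real l)\<^sup>2 / 2)" for l :: nat
  define Z1 where "Z1 = (\<Sum>l=1..J. g l)"
  have g0: "0 \<le> g l" for l by (simp add: g_def)
  have shift: "2 powr (b * Suc l - (real (Suc l))\<^sup>2 / 2) * 2 powr (Suc l) = 2 powr (b + 1 / 2) * g l" for l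
    unfolding g_def powr_add[symmetric] by (intro arg_cong[where f = "\<lambda>z. 2 powr z"]) (simp add: power2_eq_square field_simps)
  have "(\<Sum>j=1..J. h b j * 2 powr j) \<le> (\<Sum>j=1..J. 2 powr (b * j - (real j)\<^sup>2 / 2) * 2 powr j)"
    by (intro sum_mono mult_right_mono h_le) auto
  also have "\<dots> = (\<Sum>l<J. 2 powr (b * Suc l - (real (Suc l))\<^sup>2 / 2) * 2 powr (Suc l))"
    by (rule sum.reindex_bij_witness[of _ Suc "\<lambda>j. j - 1"]) auto
  also have "\<dots> = 2 powr (b + 1 / 2) * (\<Sum>l<J. g l)" unfolding shift sum_distrib_left ..
  also have "(\<Sum>l<J. g l) \<le> (\<Sum>l\<in>insert 0 {1..J}. g l)" using g0 by (intro sum_mono2) auto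
  also have "\<dots> = 1 + Z1" by (simp add: Z1_def g_def)
  finally have "(\<Sum>j=1..J. h b j * 2 powr j) \<le> 2 powr (b + 1 / 2) * (1 + Z1)" by (simp add: mult_left_mono)
  also have "\<dots> = sqrt 2 * (2 powr b * (1 + Z1))" by (simp add: powr_add powr_half)
  finally have 1: "(\<Sum>j=1..J. h b j * 2 powr j) \<le> sqrt 2 * (2 powr b * (1 + Z1))" .
  have b8: "2 powr b \<le> 8" using powr_mono[of b 3 "2::real"] b by simp
  have Z12: "95 / 100 * 2 powr b \<le> Z1"
  proof -
    have "95 / 100 \<le> 1 / sqrt 2 + 2 powr (b - 2)"
    proof -
      have "(2::real) powr (- 2) \<le> 2 powr (b - 2)" using b by (intro powr_mono) auto
      moreover have "7 / 10 \<le> 1 / sqrt 2" using sqrt2_bounds by (simp add: field_simps)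
      ultimately show ?thesis by (simp add: powr_minus_divide)
    qed
    then have "95 / 100 * 2 powr b \<le> (1 / sqrt 2 + 2 powr (b - 2)) * 2 powr b" by (intro mult_right_mono) auto
    also have "\<dots> = g 1 + g 2"
    proof -
      have "g 1 = 1 / sqrt 2 * 2 powr b" by (simp add: g_def powr_diff powr_half)
      moreover have "g 2 = 2 powr (b - 2) * 2 powr b" by (simp add: g_def powr_add[symmetric] mult.commute)
      ultimately show ?thesis by (simp add: distrib_right)
    qed
    also have "\<dots> = (\<Sum>l\<in>{1, 2}. g l)" by simp
    also have "\<dots> \<le> Z1" unfolding Z1_def using J16 g0 by (intro sum_mono2) auto
    finally show ?thesis .
  qed
  then have Z1p: "0 \<le> Z1" using powr_ge_zero[of 2 b] by linarith
  have "2 powr b * (1 + Z1) \<le> Z1 * (100 / 95) + 8 * Z1"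
    using Z12 mult_right_mono[OF b8 Z1p] by (simp add: distrib_left)
  then have "sqrt 2 * (2 powr b * (1 + Z1)) \<le> 14143 / 10000 * (Z1 * (100 / 95) + 8 * Z1)"
    using sqrt2_bounds Z1p by (intro mult_mono) auto
  also have "\<dots> \<le> 1283 / 100 * (998 / 1000 * Z1)" using Z1p by simp
  finally have 2: "(\<Sum>j=1..J. h b j * 2 powr j) \<le> 1283 / 100 * (998 / 1000 * Z1)" using 1 by (rule order_trans[rotated])
  have "998 / 1000 * Z1 \<le> Z b"
    unfolding Z1_def Z_def sum_distrib_left g_def by (intro sum_mono h_ge) auto
  then show ?thesis using 2 by linarith
qed

text \<open>As 2 Lam is about A ln 2 and jb ln 2 is about 2, the exponential is nearly 2 powr j *
  exp (-2). The previous lemma then gives about 12.83 exp (-2) < 1.74 times \<open>n0\<close>, and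
  the remaining room up to 9/5 covers the approximations.\<close>

lemma gibbs_weight: "(\<Sum>j\<in>{1..J}. (A - real j) * x b j * exp (2 * (Lam b * (real j - jb b) / (A - real j)))) \<le> 9 / 5 * real n0"
proof -
  have e: "exp (2 * (Lam b * (real j - jb b) / (A - real j))) \<le> exp (3 / 1000) * (2 powr j * exp (- (2 - 3 / 10000)))"
    if j: "j \<in> {1..J}" for j
  proof -
    have Aj: "A * (8191 / 8192) \<le> A - real j" using j J_le(1) by simp
    have Ajp: "0 < A - real j" using Aj A_large by linarith
    have d: "2 * (Lam b * (real j - jb b) / (A - real j)) - ln 2 * (real j - jb b)
        = (real j - jb b) * (2 * Lam b - lA + real j * ln 2) / (A - real j)"
      unfolding lA_def using Ajp by (simp add: field_simps)
    have "\<bar>real j - jb b\<bar> \<le> real J" using j jb_bounds[of b] by auto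
    moreover have "\<bar>2 * Lam b - lA + real j * ln 2\<bar> \<le> 8 + real J"
    proof -
      have "real j * ln 2 \<le> real J * 1" by (rule mult_mono) (use j ln2_bounds in auto)
      moreover have "0 \<le> real j * ln 2" by simp
      ultimately show ?thesis using Lam_lA unfolding abs_le_iff by (intro conjI; linarith)
    qed
    ultimately have "\<bar>(real j - jb b) * (2 * Lam b - lA + real j * ln 2)\<bar> \<le> real J * (8 + real J)"
      unfolding abs_mult by (intro mult_mono) auto
    also have "real J * (8 + real J) \<le> 3 / 2 * (real J)\<^sup>2"
      using J16 mult_left_mono[of 16 "real J" "real J"] by (simp add: power2_eq_square algebra_simps)
    also have "\<dots> \<le> 3 / 2 * (A / 512)" using J4 by simp
    also have "\<dots> \<le> 3 / 1000 * (A - real j)" using Aj A_large by simp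
    finally have "(real j - jb b) * (2 * Lam b - lA + real j * ln 2) / (A - real j) \<le> 3 / 1000"
      using Ajp by (simp add: pos_divide_le_eq)
    then have "2 * (Lam b * (real j - jb b) / (A - real j)) - ln 2 * (real j - jb b) \<le> 3 / 1000" unfolding d .
    moreover have "ln 2 * (real j - jb b) = real j * ln 2 - jb b * ln 2" by (simp add: right_diff_distrib mult.commute)
    ultimately have "2 * (Lam b * (real j - jb b) / (A - real j)) \<le> 3 / 1000 + (real j * ln 2 - (2 - 3 / 10000))"
      using jb_ln2 by linarith
    then have "exp (2 * (Lam b * (real j - jb b) / (A - real j))) \<le> exp (3 / 1000 + (real j * ln 2 - (2 - 3 / 10000)))" by simp
    also have "\<dots> = exp (3 / 1000) * (2 powr j * exp (- (2 - 3 / 10000)))"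
      by (simp only: exp_add diff_conv_add_uminus powr_def) simp
    finally show ?thesis .
  qed
  define E where "E = exp (3 / 1000 :: real) * exp (- (2 - 3 / 10000))"
  have E: "1283 / 100 * E \<le> 9 / 5 * (8191 / 8192)"
  proof -
    have "E = exp (33 / 10000) / (exp 1)\<^sup>2" unfolding E_def by (simp add: exp_add[symmetric] exp_diff[symmetric] exp_double[symmetric])
    also have "\<dots> \<le> (10034 / 10000) / (27166 / 10000)\<^sup>2"
    proof (intro frac_le power_mono exp_1_ge)
      show "exp (33 / 10000 :: real) \<le> 10034 / 10000"
        using exp_bound[of "33 / 10000"] by (simp add: power2_eq_square)
    qed auto
    finally show ?thesis by (simp add: power2_eq_square)
  qed
  have "(\<Sum>j\<in>{1..J}. (A - real j) * x b j * exp (2 * (Lam b * (real j - jb b) / (A - real j))))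
     \<le> (\<Sum>j\<in>{1..J}. A * K b * E * (h b j * 2 powr j))"
  proof (intro sum_mono)
    fix j assume j: "j \<in> {1..J}"
    have "(A - real j) * x b j * exp (2 * (Lam b * (real j - jb b) / (A - real j)))
       \<le> A * x b j * (exp (3 / 1000) * (2 powr j * exp (- (2 - 3 / 10000))))"
      using e[OF j] x_nonneg[of b j] by (intro mult_mono mult_nonneg_nonneg) auto
    then show "(A - real j) * x b j * exp (2 * (Lam b * (real j - jb b) / (A - real j))) \<le> A * K b * E * (h b j * 2 powr j)"
      by (simp add: E_def x_def mult_ac)
  qed
  also have "\<dots> = A * K b * E * (\<Sum>j=1..J. h b j * 2 powr j)" by (simp only: sum_distrib_left)
  also have "\<dots> \<le> A * K b * E * (1283 / 100 * Z b)"
    using sum_h_two_powr K_pos[of b] by (intro mult_left_mono mult_nonneg_nonneg) (auto simp: E_def)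
  also have "\<dots> = A * K b * Z b * (1283 / 100 * E)" by simp
  also have "\<dots> \<le> A * K b * Z b * (9 / 5 * (8191 / 8192))"
    using E K_pos[of b] Z_pos[of b] by (intro mult_left_mono) auto
  also have "\<dots> = 9 / 5 * (K b * Z b * (A * (8191 / 8192)))" by simp
  also have "\<dots> \<le> 9 / 5 * (K b * Z b * (A - jb b))"
    using jb_small K_pos[of b] Z_pos[of b] by (intro mult_left_mono) auto
  also have "K b * Z b * (A - jb b) = real n0"
    unfolding K_def AZT[symmetric] mult.assoc using AZT_pos[of b] by simp
  finally show ?thesis .
qed

section \<open>A nearly optimal colouring before planting\<close>

lemma v_ge: "A ^ 100 \<le> v"
proof -
  have "2 powr (A / 8) \<le> v" unfolding v_def by (intro powr_mono) auto
  moreover have "A ^ 100 \<le> 2 powr (A / 8)"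
    using L4 by (simp add: powr_minus_divide field_simps)
  ultimately show ?thesis by linarith
qed

lemma A_powers: "A ^ i * 2 powr (- A / 8) \<le> 1 / A ^ (100 - i)" if "i \<le> 100"
proof -
  have "A ^ 100 = A ^ i * A ^ (100 - i)" using that by (simp add: power_add[symmetric])
  then show ?thesis using L4 A_large by (simp add: field_simps)
qed

lemma n0_ge_power: "A ^ 100 \<le> real n0"
  using v_ge n0_big(2) by linarith

lemma ln_n0_le: "ln (real n0 + 1) \<le> A"
proof -
  have lA: "0 < A" "0 < v" using A_large v_large by auto
  have "1 * 1 \<le> A * v" using A_large v_large by (intro mult_mono) auto
  then have "ln (real n0 + 1) \<le> ln (3 * A * v)" using n0_le by (subst ln_le_cancel_iff) auto
  also have "\<dots> = ln 3 + ln A + ln v" using lA by (simp add: ln_mult)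
  also have "ln (3::real) \<le> 2" using ln_le_minus_one[of "3::real"] by simp
  also have "ln v = lA / 2" by (rule ln_v)
  finally show ?thesis using L3 lA_bounds A_large by linarith
qed

lemma KZ: "K b * Z b * (A - jb b) = real n0"
  unfolding K_def AZT[symmetric] mult.assoc using AZT_pos[of b] by simp

lemma KZ_le: "K b * Z b \<le> 2 * real n0 / A"
proof -
  have "K b * Z b * (A / 2) \<le> K b * Z b * (A - jb b)"
    using jb_small A_large K_pos[of b] Z_pos[of b] by (intro mult_left_mono) auto
  then show ?thesis using KZ A_large by (simp add: field_simps)
qed

text \<open>The profile is rounded down to integers. The second moment loses a factor exp (4 n /
  A^10); concentration converts this into about 2 sqrt (n * 4 n / A^10) = 4 n / A^5 additional
  colours. Left-over vertices and rounding fit into the remaining 2 n / A^5.\<close>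

lemma cp_n0: "\<exists>k::nat. real k \<le> K b * Z b + 6 * real n0 / A ^ 5 \<and> 1 / 2 \<le> cp n0 k"
proof -
  let ?n = n0
  define \<kappa> where "\<kappa> j = nat \<lfloor>x b j\<rfloor>" for j
  have \<kappa>: "real (\<kappa> j) \<le> x b j" "x b j - 1 \<le> real (\<kappa> j)" for j
    using x_nonneg[of b j] by (auto simp: \<kappa>_def)
  define S where "S = (\<lambda>j. a - j) ` {1..J}"
  have injS: "inj_on (\<lambda>j. a - j) {1..J}" using J_le(2) by (auto simp: inj_on_def)
  have finS: "finite S" by (simp add: S_def)
  obtain k :: nat and u :: "nat \<Rightarrow> nat" where u: "\<forall>i<k. u i \<in> S" "\<forall>s\<in>S. card {i \<in> {..<k}. u i = s} = \<kappa> (a - s)"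
    using exists_profile[OF finS, of "\<lambda>s. \<kappa> (a - s)"] by blast
  have cu: "card {i \<in> {..<k}. u i = a - j} = \<kappa> j" if "j \<in> {1..J}" for j
    using u(2) that J_le(2) by (auto simp: S_def)
  have uS: "u ` {..<k} \<subseteq> S" using u(1) by auto
  have cardS: "card (u ` {..<k}) \<le> J"
  proof -
    have "card (u ` {..<k}) \<le> card S" using uS finS by (intro card_mono)
    also have "\<dots> \<le> card {1..J}" unfolding S_def by (rule card_image_le) simp
    finally show ?thesis by simp
  qed
  have group_sum: "(\<Sum>i\<in>I. g (u i)) = (\<Sum>j=1..J. real (card {i \<in> I. u i = a - j}) * g (a - j))" if I: "I \<subseteq> {..<k}" for I and g :: "nat \<Rightarrow> real"
  proof -
    have finI: "finite I" using I finite_subset by blast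
    have "(\<Sum>i\<in>I. g (u i)) = (\<Sum>s\<in>S. \<Sum>i\<in>{i \<in> I. u i = s}. g (u i))"
      using I u(1) finI finS by (intro sum.group[symmetric]) auto
    also have "\<dots> = (\<Sum>s\<in>S. real (card {i \<in> I. u i = s}) * g s)" by (intro sum.cong refl) simp
    also have "\<dots> = (\<Sum>j=1..J. real (card {i \<in> I. u i = a - j}) * g (a - j))"
      unfolding S_def sum.reindex[OF injS] o_def ..
    finally show ?thesis .
  qed
  have ksum: "real k = (\<Sum>j=1..J. real (\<kappa> j))"
    using group_sum[of "{..<k}" "\<lambda>_. 1"] cu by simp
  have usum: "real (\<Sum>i<k. u i) = (\<Sum>j=1..J. real (\<kappa> j) * (A - j))"
  proof -
    have "real (\<Sum>i<k. u i) = (\<Sum>j=1..J. real (card {i \<in> {..<k}. u i = a - j}) * real (a - j))"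
      using group_sum[of "{..<k}" real] by simp
    also have "\<dots> = (\<Sum>j=1..J. real (\<kappa> j) * (A - j))"
      using cu J_le(2) by (intro sum.cong refl) (auto simp: of_nat_diff)
    finally show ?thesis .
  qed
  have Aj: "0 \<le> A - real j" "A - real j \<le> A" if "j \<in> {1..J}" for j using that J_le(2) by auto
  have "real (\<Sum>i<k. u i) \<le> real ?n"
    unfolding usum n0_eq[of b]
  proof (intro sum_mono)
    fix j assume "j \<in> {1..J}"
    then have "(A - real j) * real (\<kappa> j) \<le> (A - real j) * x b j" by (intro mult_left_mono \<kappa>(1) Aj)
    then show "real (\<kappa> j) * (A - real j) \<le> (A - real j) * x b j" by (simp only: mult.commute)
  qed
  then have un: "(\<Sum>i<k. u i) \<le> ?n" by (simp only: of_nat_le_iff)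
  have left: "real (?n - (\<Sum>i<k. u i)) \<le> J * A"
  proof -
    have "real ?n - real (\<Sum>i<k. u i) = (\<Sum>j=1..J. (A - real j) * (x b j - \<kappa> j))"
      unfolding usum n0_eq[of b] by (simp add: sum_subtractf[symmetric] algebra_simps)
    also have "\<dots> \<le> (\<Sum>j=1..J. A * 1)" using Aj \<kappa> by (intro sum_mono mult_mono) (auto simp: algebra_simps)
    finally show ?thesis using un by (simp add: of_nat_diff)
  qed
  have kx: "real k \<le> K b * Z b" unfolding ksum sum_x[symmetric] using \<kappa>(1) by (intro sum_mono)
  have KZn: "K b * Z b \<le> real ?n"
  proof -
    have "2 * real n0 / A \<le> real n0" using A_large n0_big by (simp add: divide_le_eq)
    then show ?thesis using KZ_le by linarith
  qed
  have kn: "real k \<le> real ?n" using kx KZn by linarith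
  have ub: "a - J \<le> u i \<and> u i < a" if i: "i < k" for i
  proof -
    obtain j where "j \<in> {1..J}" "u i = a - j" using u(1) i unfolding S_def by blast
    then show ?thesis using J_le(2) by auto
  qed
  define L where "L = J ^ 4"
  have aL: "a = 2 * L" by (simp add: L_def a_eq)
  have L0: "0 < L" using J16 by (simp add: L_def)
  \<comment> \<open>Small enough for exp M to be affordable, yet large enough that the small
    overlaps, with exponent at most n^2 A^5 / M^2 = A^25, are negligible.\<close>
  define M where "M = real ?n / A ^ 10"
  have Ap: "0 < A" and np: "0 < real ?n" using A_large n0_big by auto
  have M: "0 < M" "A ^ 10 * M = real ?n" using Ap np by (auto simp: M_def)
  define \<beta> where "\<beta> = A ^ 5 / M\<^sup>2"
  define \<epsilon> where "\<epsilon> = A * sqrt (2 * A ^ 3 * 2 powr ((real J + 1) / 2 - A / 4))"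
  have Jx: "2 powr ((real J + 1) / 2 - A / 4) \<le> 2 powr (- A / 8)"
  proof (rule powr_mono)
    show "(real J + 1) / 2 - A / 4 \<le> - A / 8" using J_le(1) A_large by argo
  qed simp
  have X: "2 * A ^ 3 * 2 powr ((real J + 1) / 2 - A / 4) \<le> 1 / A ^ 96"
  proof -
    have "2 * A ^ 3 * 2 powr ((real J + 1) / 2 - A / 4) \<le> A ^ 4 * 2 powr (- A / 8)"
    proof (rule mult_mono)
      have "2 * A ^ 3 \<le> A * A ^ 3" using A_large by (intro mult_right_mono) auto
      also have "A * A ^ 3 = A ^ 4" by (rule power_Suc[symmetric, of A 3, simplified])
      finally show "2 * A ^ 3 \<le> A ^ 4" .
    qed (use Jx Ap in auto)
    also have "\<dots> \<le> 1 / A ^ (100 - 4)" by (rule A_powers) simp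
    finally show ?thesis by simp
  qed
  have X1: "2 * A ^ 3 * 2 powr ((real J + 1) / 2 - A / 4) \<le> 1"
    using X A_large by (smt (verit) divide_le_eq_1 one_le_power)
  have \<epsilon>: "0 \<le> \<epsilon>" "sqrt \<epsilon> \<le> 1 / A ^ 23"
  proof -
    show "0 \<le> \<epsilon>" by (simp add: \<epsilon>_def)
    have "\<epsilon> \<le> A * sqrt (1 / A ^ 96)" unfolding \<epsilon>_def using X by (intro mult_left_mono) auto
    also have "sqrt (1 / A ^ 96) = 1 / A ^ 48"
      using Ap by (intro real_sqrt_unique) (auto simp: power_divide power_mult[symmetric])
    also have "A * (1 / A ^ 48) = 1 / A ^ 47" using Ap power_Suc[of A 47] by simp
    also have "\<dots> \<le> 1 / A ^ 46" using A_large by (intro divide_left_mono power_increasing) auto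
    also have "1 / A ^ 46 = (1 / A ^ 23)\<^sup>2" by (simp add: power_divide power_mult[symmetric])
    finally show "sqrt \<epsilon> \<le> 1 / A ^ 23" using Ap by (intro real_le_lsqrt) auto
  qed
  \<comment> \<open>This makes exp (- c) = 1 / A^10, so the binomial coefficients in
    \<open>B\<close> cost at most 2 n / A^10 in the exponent, while the linear penalty stays within
    the slack for logarithmic terms.\<close>
  define c where "c = 10 * ln A"
  have c: "0 \<le> c" "exp (- c) = 1 / A ^ 10"
  proof -
    show "0 \<le> c" using A_large by (simp add: c_def)
    have "exp c = exp (ln A) ^ 10" using exp_of_nat_mult[of 10 "ln A"] by (simp add: c_def)
    then show "exp (- c) = 1 / A ^ 10" using Ap by (simp add: exp_minus inverse_eq_divide)
  qed
  define B where "B = exp (2 * exp (- c) * (\<Sum>j\<in>{1..J}. x b j)) * (\<Prod>j\<in>{1..J}. exp 1 * (x b j + 1)) * (exp 1 * (real ?n + 1))"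
  have B0: "0 \<le> B" unfolding B_def using x_nonneg by (intro mult_nonneg_nonneg prod_nonneg) auto
  have Bcond: "(\<Prod>s\<in>u ` {..<k}. real (card {j \<in> {..<k}. u j = s} choose card {i \<in> I. u i = s}) * ff (card {j \<in> {..<k}. u j = s}) (card {i \<in> I. u i = s}))
        * subset_weight ?n u I \<le> B" if I: "I \<subseteq> {..<k}" for I
  proof -
    have finI: "finite I" using I finite_subset by blast
    define q where "q j = card {i \<in> I. u i = a - j}" for j
    let ?F = "\<lambda>s. real (card {j \<in> {..<k}. u j = s} choose card {i \<in> I. u i = s}) * ff (card {j \<in> {..<k}. u j = s}) (card {i \<in> I. u i = s})"
    have "(\<Prod>s\<in>u ` {..<k}. ?F s) = (\<Prod>s\<in>S. ?F s)"
    proof (rule prod.mono_neutral_left[OF finS uS], rule ballI)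
      fix s assume "s \<in> S - u ` {..<k}"
      then have "{j \<in> {..<k}. u j = s} = {}" "{i \<in> I. u i = s} = {}" using I by auto
      then show "?F s = 1" by (simp only: card.empty) simp
    qed
    also have "\<dots> = (\<Prod>j=1..J. real (\<kappa> j choose q j) * ff (\<kappa> j) (q j))"
      unfolding S_def prod.reindex[OF injS] o_def q_def using cu by (intro prod.cong refl) simp
    finally have 1: "(\<Prod>s\<in>u ` {..<k}. ?F s) = (\<Prod>j=1..J. real (\<kappa> j choose q j) * ff (\<kappa> j) (q j))" .
    have 2: "(\<Prod>i\<in>I. dw (u i)) = (\<Prod>j=1..J. dw (a - j) ^ q j)"
    proof -
      have "(\<Prod>i\<in>I. dw (u i)) = (\<Prod>s\<in>S. \<Prod>i\<in>{i \<in> I. u i = s}. dw (u i))"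
        using I u(1) finI finS by (intro prod.group[symmetric]) auto
      also have "\<dots> = (\<Prod>s\<in>S. dw s ^ card {i \<in> I. u i = s})" by (intro prod.cong refl) simp
      also have "\<dots> = (\<Prod>j=1..J. dw (a - j) ^ q j)" unfolding S_def q_def prod.reindex[OF injS] o_def ..
      finally show ?thesis .
    qed
    have 3: "(\<Sum>i\<in>I. u i) = (\<Sum>j\<in>{1..J}. (a - j) * q j)"
    proof -
      have "real (\<Sum>i\<in>I. u i) = real (\<Sum>j\<in>{1..J}. (a - j) * q j)"
        using group_sum[OF I, of real] by (simp add: q_def mult.commute)
      then show ?thesis by (simp only: of_nat_eq_iff)
    qed
    have "(\<Sum>i\<in>I. u i) \<le> (\<Sum>i<k. u i)" using I by (intro sum_mono2) auto
    then have pos: "0 < ff ?n (\<Sum>i\<in>I. u i)" using un by (intro ff_pos) simp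
    have "(\<Prod>j\<in>{1..J}. real (\<kappa> j choose q j) * ff (\<kappa> j) (q j) * dw (a - j) ^ q j) \<le> B * ff ?n (\<Sum>j\<in>{1..J}. (a - j) * q j)"
      unfolding B_def
    proof (rule profile_product[where jb = "jb b" and \<rho> = "rho b" and \<zeta> = "zeta b" and J = "real J" and \<Lambda> = "Lam b"])
      show "q j \<le> \<kappa> j" if "j \<in> {1..J}" for j
        unfolding q_def cu[OF that, symmetric] using I by (intro card_mono) auto
      show "jb b \<le> real a" using jb_small by linarith
      show "x b j * dw (a - j) = zeta b * rho b ^ (a - j)" if "j \<in> {1..J}" for j
        using that J_le(2) by (intro x_dw) auto
      show "1 - ln (zeta b) = (A - jb b) * Lam b" by (rule ln_zeta[OF tilt])
      show "Lam b * (jb b - 1) / (A - 1) + 2 * c / (A - J) \<le> 7 / 10" unfolding c_def by (rule large_classes_slack)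
      show "2 * c / (A - J) \<le> 1 / 200" unfolding c_def by (rule small_loss)
      show "real ?n = (\<Sum>j\<in>{1..J}. (A - real j) * x b j)" by (rule n0_eq)
      show "0 < ?n" using np by simp
    qed (use J16 J_le(2) \<kappa>(1) mean_x jb_bounds(1) c(1) rho_pos zeta_pos Lam_pos gibbs_weight in \<open>auto simp: Lam_def less_imp_le\<close>)
    then have "(\<Prod>s\<in>u ` {..<k}. ?F s) * (\<Prod>i\<in>I. dw (u i)) \<le> B * ff ?n (\<Sum>i\<in>I. u i)"
      by (simp only: 1 2 3 prod.distrib[symmetric])
    then show ?thesis unfolding subset_weight_def using pos by (simp add: pos_divide_le_eq)
  qed
  \<comment> \<open>The at most J A vertices left by rounding each receive a colour of their own, so
    the remainder is coloured with certainty.\<close>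
  define f where "f = ?n - (\<Sum>i<k. u i)"
  have "(cp f f)\<^sup>2 \<le> exp (M + real k ^ 2 * \<beta>) * (exp (2 * real k * sqrt \<epsilon>) * (real k + 1)) ^ card (u ` {..<k}) * B * cp ?n (f + k)"
    unfolding f_def
  proof (rule second_moment_profile[OF un L0 _ M(1) _ _ \<epsilon>(1) _ B0 Bcond])
    show "u i < 2 * L" if "i < k" for i using ub[OF that] aL by simp
    show "0 \<le> \<beta>" by (simp add: \<beta>_def)
    show "pair_weight (u i) (u j) L (1 / M) \<le> \<beta>" if "i < k" "j < k" for i j
      unfolding \<beta>_def
    proof (rule pair_weight_le)
      show "2 powr (A / 2) \<le> A ^ 10 * M" unfolding M(2) v_def[symmetric] by (rule n0_big(2))
      have "2 powr (- A / 4) \<le> 2 powr (- A / 8)" by (intro powr_mono) auto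
      then have "A ^ 12 * 2 powr (- A / 4) \<le> A ^ 12 * 2 powr (- A / 8)" by (intro mult_left_mono) auto
      also have "\<dots> \<le> 1 / A ^ 88" using A_powers[of 12] by simp
      also have "\<dots> \<le> 1" using A_large by (simp add: divide_le_eq_1 one_le_power)
      finally show "A ^ 12 * 2 powr (- A / 4) \<le> 1" .
    qed (use ub[OF that(1)] ub[OF that(2)] aL M(1) A_large in auto)
    show "(\<Sum>t\<in>{L..u i}. real (u i choose t) * overlap_ratio ?n (u i) (u j) t) \<le> of_bool (u i = u j) + \<epsilon>" if "i < k" "j < k" for i j
      unfolding \<epsilon>_def
    proof (rule sum_overlap_ratio_le)
      show "real ?n \<le> 2 * A * 2 powr (A / 2)" using n0_le by (simp add: v_def)
    qed (use ub[OF that(1)] ub[OF that(2)] aL J_le(2) X1 in auto)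
  qed
  moreover have "cp f f = 1" by (rule cp_eq_1) simp
  ultimately have 1: "1 \<le> exp (M + real k ^ 2 * \<beta>) * (exp (2 * real k * sqrt \<epsilon>) * (real k + 1)) ^ card (u ` {..<k}) * B * cp ?n (f + k)"
    by simp
  \<comment> \<open>\<open>M\<close> and the entropy in \<open>B\<close> contribute 3 n / A^10 to
    the exponent; all other terms are of lower order and fit into one further n / A^10.\<close>
  define s where "s = 4 * real ?n / A ^ 10"
  have nA: "A ^ i \<le> real ?n / A ^ 90" if "i \<le> 10" for i
  proof -
    have "A ^ i \<le> A ^ 10" using that A_large by (intro power_increasing) auto
    also have "A ^ 10 = A ^ 100 / A ^ 90" using Ap by (simp add: power_diff[symmetric])
    also have "\<dots> \<le> real ?n / A ^ 90" using n0_ge_power Ap by (intro divide_right_mono) auto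
    finally show ?thesis .
  qed
  have lnk: "real k + 1 \<le> exp A"
  proof -
    have "real k + 1 \<le> real ?n + 1" using kn by simp
    also have "\<dots> = exp (ln (real ?n + 1))" by (simp add: add_pos_nonneg)
    also have "\<dots> \<le> exp A" by (simp only: exp_le_cancel_iff ln_n0_le)
    finally show ?thesis .
  qed
  have lnn: "real ?n + 1 \<le> exp A"
  proof -
    have "real ?n + 1 = exp (ln (real ?n + 1))" by (simp add: add_pos_nonneg)
    also have "\<dots> \<le> exp A" by (simp only: exp_le_cancel_iff ln_n0_le)
    finally show ?thesis .
  qed
  have JA: "real J \<le> A" using J_le A_large by simp
  have "(exp (2 * real k * sqrt \<epsilon>) * (real k + 1)) ^ card (u ` {..<k}) \<le> exp (real J * (2 * real k * sqrt \<epsilon> + A))"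
  proof -
    have "(exp (2 * real k * sqrt \<epsilon>) * (real k + 1)) ^ card (u ` {..<k}) \<le> (exp (2 * real k * sqrt \<epsilon> + A)) ^ card (u ` {..<k})"
      unfolding exp_add using lnk by (intro power_mono mult_left_mono) auto
    also have "\<dots> \<le> (exp (2 * real k * sqrt \<epsilon> + A)) ^ J"
      using cardS \<epsilon>(1) by (intro power_increasing) (auto intro: add_nonneg_nonneg)
    also have "\<dots> = exp (real J * (2 * real k * sqrt \<epsilon> + A))" by (simp only: exp_of_nat_mult)
    finally show ?thesis .
  qed
  moreover have "B \<le> exp (2 * real ?n / A ^ 10 + real J * (1 + A) + (1 + A))"
  proof -
    have "2 * exp (- c) * (\<Sum>j\<in>{1..J}. x b j) \<le> 2 * (1 / A ^ 10) * real ?n"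
      unfolding c(2) sum_x using KZn Ap by (intro mult_left_mono) auto
    then have "exp (2 * exp (- c) * (\<Sum>j\<in>{1..J}. x b j)) \<le> exp (2 * real ?n / A ^ 10)" by simp
    moreover have "(\<Prod>j\<in>{1..J}. exp 1 * (x b j + 1)) \<le> (\<Prod>j\<in>{1..J}. exp (1 + A))"
    proof (intro prod_mono conjI)
      fix j assume j: "j \<in> {1..J}"
      have "x b j \<le> (\<Sum>j\<in>{1..J}. x b j)" using j x_nonneg by (intro member_le_sum) auto
      then have "x b j + 1 \<le> exp A" using KZn lnn unfolding sum_x by linarith
      then show "exp 1 * (x b j + 1) \<le> exp (1 + A)" unfolding exp_add by (intro mult_left_mono) auto
      show "0 \<le> exp 1 * (x b j + 1)" using x_nonneg[of b j] by simp
    qed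
    moreover have "exp 1 * (real ?n + 1) \<le> exp (1 + A)" unfolding exp_add using lnn by (intro mult_left_mono) auto
    ultimately have "B \<le> exp (2 * real ?n / A ^ 10) * (\<Prod>j\<in>{1..J}. exp (1 + A)) * exp (1 + A)"
      unfolding B_def using x_nonneg by (intro mult_mono mult_nonneg_nonneg prod_nonneg) (auto intro!: add_nonneg_nonneg)
    also have "(\<Prod>j\<in>{1..J}. exp (1 + A)) = exp (real J * (1 + A))" by (simp add: exp_of_nat_mult)
    finally show ?thesis by (simp only: exp_add)
  qed
  ultimately have "exp (M + real k ^ 2 * \<beta>) * (exp (2 * real k * sqrt \<epsilon>) * (real k + 1)) ^ card (u ` {..<k}) * B
     \<le> exp (M + real k ^ 2 * \<beta>) * exp (real J * (2 * real k * sqrt \<epsilon> + A)) * exp (2 * real ?n / A ^ 10 + real J * (1 + A) + (1 + A))"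
    using B0 by (intro mult_mono mult_nonneg_nonneg) auto
  also have "\<dots> = exp (M + real k ^ 2 * \<beta> + real J * (2 * real k * sqrt \<epsilon> + A) + (2 * real ?n / A ^ 10 + real J * (1 + A) + (1 + A)))"
    by (simp only: exp_add)
  also have "\<dots> \<le> exp s"
  proof -
    have t1: "real k ^ 2 * \<beta> \<le> real ?n / A ^ 75"
    proof -
      have "real k ^ 2 * \<beta> \<le> (real ?n)\<^sup>2 * \<beta>" using kn by (intro mult_right_mono power_mono) (auto simp: \<beta>_def)
      also have "\<dots> = A ^ 25" using Ap np by (simp add: \<beta>_def M_def power_divide power_mult[symmetric] power_add[symmetric])
      also have "A ^ 25 = A ^ 100 / A ^ 75" using Ap by (simp add: power_diff[symmetric])
      also have "\<dots> \<le> real ?n / A ^ 75" using n0_ge_power Ap by (intro divide_right_mono) auto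
      finally show ?thesis .
    qed
    have t2: "real J * (2 * real k * sqrt \<epsilon>) \<le> 2 * (real ?n / A ^ 22)"
    proof -
      have "real J * (2 * real k * sqrt \<epsilon>) \<le> A * (2 * real ?n * (1 / A ^ 23))"
        using JA kn \<epsilon> by (intro mult_mono mult_nonneg_nonneg) auto
      also have "\<dots> = 2 * (real ?n / A ^ 22)" using Ap power_Suc[of A 22] by simp
      finally show ?thesis .
    qed
    have t3: "real J * A + (real J * (1 + A) + (1 + A)) \<le> 6 * (real ?n / A ^ 90)"
    proof -
      have "real J * A \<le> A * A" using JA Ap by (intro mult_right_mono) auto
      moreover have "A * A = A ^ 2" by (simp add: power2_eq_square)
      moreover have "1 * A \<le> A * A" using A_large by (intro mult_right_mono) auto
      moreover have "real J * (1 + A) = real J + real J * A" by (simp add: algebra_simps)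
      ultimately have "real J * A + (real J * (1 + A) + (1 + A)) \<le> 6 * A ^ 2" using JA A_large by linarith
      then show ?thesis using nA[of 2] by linarith
    qed
    have le: "real ?n / A ^ i \<le> real ?n / A ^ 11" if "11 \<le> i" for i
      using that A_large by (intro divide_left_mono power_increasing) auto
    have "real ?n / A ^ 11 = (real ?n / A ^ 10) / A" using power_Suc[of A 10] by simp
    also have "\<dots> \<le> (real ?n / A ^ 10) / 100" using A_large by (intro divide_left_mono) auto
    finally have d: "real ?n / A ^ 11 \<le> (real ?n / A ^ 10) / 100" .
    have gen: "m + p + (q + r1) + (2 * m + r2 + r3) \<le> 4 * m"
      if "p \<le> d" "q \<le> 2 * d" "r1 + (r2 + r3) \<le> 6 * d" "d \<le> m / 100" "0 \<le> m" for m p q r1 r2 r3 d :: real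
      using that by linarith
    have "real ?n / A ^ 10 + real k ^ 2 * \<beta> + (real J * (2 * real k * sqrt \<epsilon>) + real J * A)
        + (2 * (real ?n / A ^ 10) + real J * (1 + A) + (1 + A)) \<le> 4 * (real ?n / A ^ 10)"
    proof (rule gen)
      show "real k ^ 2 * \<beta> \<le> real ?n / A ^ 11" using t1 le[of 75] by (rule order_trans) simp
      show "real J * (2 * real k * sqrt \<epsilon>) \<le> 2 * (real ?n / A ^ 11)"
        using t2 by (rule order_trans) (use le[of 22] in simp)
      show "real J * A + (real J * (1 + A) + (1 + A)) \<le> 6 * (real ?n / A ^ 11)"
        using t3 by (rule order_trans) (use le[of 90] in simp)
    qed (use d in auto)
    then have "M + real k ^ 2 * \<beta> + real J * (2 * real k * sqrt \<epsilon> + A) + (2 * real ?n / A ^ 10 + real J * (1 + A) + (1 + A)) \<le> s"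
      by (simp only: M_def s_def distrib_left times_divide_eq_right)
    then show ?thesis by simp
  qed
  finally have "1 \<le> exp s * cp ?n (f + k)"
    using 1 mult_right_mono[OF _ cp_nonneg[of ?n "f + k"]] by (meson order_trans)
  then have cpge: "exp (- s) \<le> cp ?n (f + k)" by (simp add: exp_minus field_simps)
  define m where "m = nat \<lceil>2 * sqrt (?n * s) + 2 * sqrt ?n\<rceil>"
  have s0: "0 < s" "s \<le> real ?n"
  proof -
    show "0 < s" using np Ap by (simp add: s_def)
    have "4 \<le> A ^ 1" using A_large by simp
    also have "A ^ 1 \<le> A ^ 10" by (rule power_increasing) (use A_large in auto)
    finally have "4 \<le> A ^ 10" .
    then show "s \<le> real ?n" using np Ap by (simp add: s_def divide_le_eq)
  qed
  have half: "1 / 2 \<le> cp ?n (f + k + m)"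
  proof (rule cp_concentration[OF cpge s0])
    show "2 * sqrt (?n * s) + 2 * sqrt ?n \<le> real m" unfolding m_def by linarith
  qed
  have sq1: "sqrt (?n * s) = 2 * real ?n / A ^ 5"
    using Ap by (intro real_sqrt_unique) (auto simp: s_def power_divide power_mult_distrib power_mult[symmetric] power2_eq_square)
  have sq2: "sqrt ?n \<le> real ?n / A ^ 50"
  proof -
    have "A ^ 50 \<le> sqrt ?n" using n0_ge_power by (intro real_le_rsqrt) (simp add: power_mult[symmetric])
    then have "sqrt ?n * A ^ 50 \<le> sqrt ?n * sqrt ?n" by (intro mult_left_mono) auto
    then show ?thesis using Ap by (simp add: pos_le_divide_eq)
  qed
  have small: "real ?n / A ^ 50 \<le> real ?n / A ^ 5 / 100" "real ?n / A ^ 90 \<le> real ?n / A ^ 5 / 100"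
  proof -
    have s: "real ?n / A ^ i \<le> real ?n / A ^ 5 / 100" if "6 \<le> i" for i
    proof -
      have "real ?n / A ^ i \<le> real ?n / A ^ 6" using that A_large by (intro divide_left_mono power_increasing) auto
      also have "\<dots> = real ?n / A ^ 5 / A" by (simp add: eval_nat_numeral)
      also have "\<dots> \<le> real ?n / A ^ 5 / 100" using A_large by (intro divide_left_mono) auto
      finally show ?thesis .
    qed
    show "real ?n / A ^ 50 \<le> real ?n / A ^ 5 / 100" "real ?n / A ^ 90 \<le> real ?n / A ^ 5 / 100" by (rule s; simp)+
  qed
  have "real m \<le> 2 * sqrt (?n * s) + 2 * sqrt ?n + 1" unfolding m_def using s0 np by (simp add: add_nonneg_nonneg)
  moreover have "real f \<le> J * A" using left by (simp add: f_def)
  moreover have "real J * A \<le> A ^ 2" using JA by (simp add: power2_eq_square mult_right_mono)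
  moreover have "A ^ 2 \<le> real ?n / A ^ 90" "1 \<le> real ?n / A ^ 90" using nA[of 2] nA[of 0] by simp_all
  ultimately have "real (f + k + m) \<le> K b * Z b + 6 * real ?n / A ^ 5"
    using kx sq1 sq2 small by simp
  then show ?thesis using half by blast
qed

section \<open>The lower bound after planting\<close>

lemma zeta_le_1: "zeta b \<le> 1"
proof -
  have "1 * 1 \<le> (A - jb b) * Lam b"
  proof (intro mult_mono)
    show "1 \<le> A - jb b" using jb_small A_large by linarith
    then show "0 \<le> A - jb b" by simp
    show "1 \<le> Lam b" using A_large Lam_lA(1) lA_bounds by linarith
  qed auto
  then have "ln (zeta b) \<le> 0" using ln_zeta[OF tilt] by simp
  then show ?thesis using zeta_pos[of b] by simp
qed

text \<open>This is the amount by which one additional colour raises the exponent in the first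
  moment bound; it converts a deficit in the exponent into a number of colours.\<close>

lemma minus_ln_zeta: "0 \<le> - ln (zeta b)" "- ln (zeta b) \<le> A\<^sup>2 / 2"
proof -
  show "0 \<le> - ln (zeta b)" using zeta_le_1 zeta_pos[of b] by simp
  have "- ln (zeta b) \<le> (A - jb b) * Lam b" using ln_zeta[OF tilt] by simp
  also have "\<dots> \<le> A * (A / 2)"
  proof (intro mult_mono)
    show "Lam b \<le> A / 2" using A_large Lam_lA(2) lA_bounds by linarith
  qed (use jb_bounds(1)[of b] Lam_pos in auto)
  finally show "- ln (zeta b) \<le> A\<^sup>2 / 2" by (simp add: power2_eq_square)
qed

lemma tail_h: "(\<Sum>j\<in>{Suc J..<a}. h b j) \<le> 1 / A"
proof -
  have "(\<Sum>j\<in>{Suc J..<a}. h b j) \<le> (\<Sum>j\<in>{Suc J..<a}. 2 powr (- (real J * (real J / 2 - 4))) * (1 / 2) ^ j)"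
  proof (intro sum_mono)
    fix j assume "j \<in> {Suc J..<a}"
    then have j: "real J \<le> real j" by simp
    have "real J * (real J / 2 - 4) \<le> real j * (real j / 2 - 4)" using j J16 by (intro mult_mono) auto
    moreover have "b * j \<le> 3 * real j" using b by (intro mult_right_mono) auto
    ultimately have "b * j - (real j)\<^sup>2 / 2 \<le> - (real J * (real J / 2 - 4)) - j"
      by (simp add: power2_eq_square algebra_simps)
    then have "2 powr (b * j - (real j)\<^sup>2 / 2) \<le> 2 powr (- (real J * (real J / 2 - 4)) - j)" by (intro powr_mono) auto
    also have "\<dots> = 2 powr (- (real J * (real J / 2 - 4))) * (1 / 2) ^ j"
      by (simp add: powr_diff powr_realpow power_divide)
    finally show "h b j \<le> 2 powr (- (real J * (real J / 2 - 4))) * (1 / 2) ^ j" using h_le[of b j] by linarith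
  qed
  also have "\<dots> = 2 powr (- (real J * (real J / 2 - 4))) * (\<Sum>j\<in>{Suc J..<a}. (1 / 2) ^ j)" by (simp only: sum_distrib_left)
  also have "(\<Sum>j\<in>{Suc J..<a}. (1 / 2) ^ j) \<le> (\<Sum>j=1..a. (1 / 2 :: real) ^ j)" by (intro sum_mono2) auto
  also have "\<dots> \<le> 1" by (rule sum_half_powers)
  finally have "(\<Sum>j\<in>{Suc J..<a}. h b j) \<le> 2 powr (- (real J * (real J / 2 - 4)))" by (simp add: mult_left_le)
  also have "\<dots> \<le> 1 / A" using L6 A_large by (simp add: field_simps)
  finally show ?thesis .
qed

text \<open>By stationarity \<open>zeta b * rho b ^ i / dw i\<close> is the number of classes of
  size \<open>i\<close> in the profile extended to all sizes. The sum is therefore the number of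
  colours of the profile, plus a negligible tail, plus K / A for the size \<open>a\<close> with its
  weight 1 / A.\<close>

lemma zeta_Y: "zeta b * ((\<Sum>i=1..<a. rho b ^ i / dw i) + 1 / A * rho b ^ a / dw a) \<le> K b * Z b + 4 * real n0 / A\<^sup>2"
proof -
  have xi: "zeta b * (rho b ^ i / dw i) = x b (a - i)" if "i \<le> a" for i
    using x_dw[of "a - i" b] that dw_pos[of i] by (simp add: field_simps)
  have "zeta b * ((\<Sum>i=1..<a. rho b ^ i / dw i) + 1 / A * rho b ^ a / dw a)
     = (\<Sum>i=1..<a. zeta b * (rho b ^ i / dw i)) + 1 / A * (zeta b * (rho b ^ a / dw a))"
    by (simp add: distrib_left sum_distrib_left)
  also have "zeta b * (rho b ^ a / dw a) = K b" using xi[of a] by (simp add: x_def h_def)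
  also have "(\<Sum>i=1..<a. zeta b * (rho b ^ i / dw i)) = (\<Sum>i=1..<a. x b (a - i))"
    by (intro sum.cong refl xi) auto
  also have "\<dots> = (\<Sum>j=1..<a. x b j)"
    by (rule sum.reindex_bij_witness[of _ "\<lambda>j. a - j" "\<lambda>j. a - j"]) auto
  also have "\<dots> = (\<Sum>j\<in>{1..J} \<union> {Suc J..<a}. x b j)" using J_le(2) by (intro sum.cong) auto
  also have "\<dots> = (\<Sum>j\<in>{1..J}. x b j) + (\<Sum>j\<in>{Suc J..<a}. x b j)" by (intro sum.union_disjoint) auto
  also have "(\<Sum>j\<in>{1..J}. x b j) = K b * Z b" by (rule sum_x)
  also have "(\<Sum>j\<in>{Suc J..<a}. x b j) = K b * (\<Sum>j\<in>{Suc J..<a}. h b j)" by (simp add: x_def sum_distrib_left)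
  also have "\<dots> \<le> K b * (1 / A)" using tail_h K_pos[of b] by (intro mult_left_mono) auto
  finally have "zeta b * ((\<Sum>i=1..<a. rho b ^ i / dw i) + 1 / A * rho b ^ a / dw a) \<le> K b * Z b + 2 * (K b / A)" by simp
  also have "K b / A \<le> (2 * real n0 / A) / A" using K_bounds(2)[OF b] by (intro divide_right_mono) auto
  finally show ?thesis by (simp add: power2_eq_square)
qed

text \<open>If \<open>R\<close> classes of size \<open>a\<close> are added to the balanced profile,
  each lowers the exponent by about ln A. A graph with at most \<open>B\<close> independent sets of
  that size allows only B ln A of this to be recovered through the weight y = 1 / A, and
  \<open>B\<close> is well below \<open>R\<close>; the extra colours \<open>\<Delta>\<close> recover
  too little of the rest.\<close>

lemma cp_upper:
  fixes R k :: nat and \<Delta> :: real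
  assumes R: "9 / 10 * (real n0 / A\<^sup>2) \<le> real R" "real R \<le> real n0 / A\<^sup>2"
    and k: "real k \<le> K b * Z b + R + \<Delta>" and \<Delta>: "0 \<le> \<Delta>" "\<Delta> \<le> 1 / 10 * (real n0 * ln A / A ^ 4)"
  shows "cp (n0 + a * R) k < 1 / 2"
proof -
  define n1 where "n1 = n0 + a * R"
  define n' where "n' = real n0 / A\<^sup>2"
  have Ap: "0 < A" and np: "0 < real n0" using A_large n0_big by auto
  have n1: "real n1 = real n0 + A * R" by (simp add: n1_def)
  have AR: "A * R \<le> real n0 / A"
  proof -
    have "A * R \<le> A * (real n0 / A\<^sup>2)" using R(2) by (intro mult_left_mono) auto
    then show ?thesis using Ap by (simp add: power2_eq_square)
  qed
  have n1le: "real n1 \<le> 2 * real n0"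
  proof -
    have "real n0 / A \<le> real n0" using A_large np by (simp add: divide_le_eq)
    then show ?thesis using AR n1 by linarith
  qed
  have n1p: "0 < real n1" using n1 np by (simp add: add_pos_nonneg)
  have n'big: "100 * A \<le> n'"
  proof -
    have "A * (100 * A\<^sup>2) \<le> A ^ 100"
    proof -
      have "100 \<le> A" using A_large by simp
      then have "A * (100 * A\<^sup>2) \<le> A * (A * A\<^sup>2)" by (intro mult_left_mono mult_right_mono) auto
      also have "\<dots> = A ^ 4" by (simp add: power2_eq_square power4_eq_xxxx)
      also have "\<dots> \<le> A ^ 100" using A_large by (intro power_increasing) auto
      finally show ?thesis .
    qed
    then have "100 * A * A\<^sup>2 \<le> real n0" using n0_ge_power by linarith
    then show ?thesis unfolding n'_def using Ap by (simp add: pos_le_divide_eq)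
  qed
  define mu1 where "mu1 = real n1 ^ a / dw a"
  have mu1p: "0 < mu1" using n1p by (simp add: mu1_def)
  \<comment> \<open>The a R <= n0 / a additional vertices multiply n0^a by at most e.\<close>
  have mu1: "mu1 \<le> 3 * mu"
  proof -
    have "real n1 = real n0 * (1 + A * R / n0)" using np by (simp add: n1 field_simps)
    then have "real n1 ^ a = real n0 ^ a * (1 + A * R / n0) ^ a" by (simp add: power_mult_distrib)
    also have "(1 + A * R / n0) ^ a \<le> exp (A * R / n0) ^ a" using np by (intro power_mono) (auto simp: add_nonneg_nonneg)
    also have "\<dots> = exp (A * (A * R / n0))" by (rule exp_of_nat_mult[symmetric])
    also have "\<dots> \<le> exp 1"
    proof -
      have "A * (A * R) \<le> A * (real n0 / A)" using AR by (intro mult_left_mono) auto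
      then show ?thesis using np Ap by (simp add: field_simps)
    qed
    also have "exp (1::real) \<le> 3" by (rule exp_le)
    finally have "real n1 ^ a \<le> real n0 ^ a * 3" by (simp add: mult_left_mono)
    then have "real n1 ^ a / dw a \<le> real n0 ^ a * 3 / dw a" by (intro divide_right_mono) (auto simp: less_imp_le)
    then show ?thesis unfolding mu1_def mu_def by (simp add: mult.commute)
  qed
  have mu1n: "mu1 \<le> 3 / 50 * n'" using mu1 mu_le by (simp add: n'_def)
  \<comment> \<open>24/50 is eight times 3/50, so Markov's inequality bounds the probability of more
    than \<open>B\<close> independent sets of size \<open>a\<close> by 1/8.\<close>
  define B where "B = nat \<lceil>24 / 50 * n'\<rceil>"
  have n'0: "0 < n'" using n'big Ap by linarith
  have B: "24 / 50 * n' \<le> real B" "real B \<le> 24 / 50 * n' + 1" unfolding B_def using n'0 by linarith+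
  have p1: "mu1 / (real B + 1) \<le> 1 / 8" using mu1n B n'0 by (simp add: pos_divide_le_eq)
  have p2: "real n1 ^ Suc a / dw (Suc a) \<le> 1 / 8"
  proof -
    have dS: "dw (Suc a) = dw a * ((A + 1) * 2 powr A)"
    proof -
      have "Suc a choose 2 = a + (a choose 2)" by (simp add: numeral_2_eq_2)
      then show ?thesis by (simp add: dw_def power_add powr_realpow)
    qed
    have "real n1 ^ Suc a / dw (Suc a) = mu1 * (real n1 / ((A + 1) * 2 powr A))"
      unfolding dS mu1_def by simp
    also have "\<dots> \<le> (3 / 50 * n') * (2 * real n0 / (A * 2 powr A))"
      using mu1n n1le mu1p n'0 np Ap by (intro mult_mono frac_le) auto
    also have "\<dots> = 3 / 25 * ((real n0)\<^sup>2 / (A ^ 3 * 2 powr A))"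
      using Ap by (simp add: n'_def power2_eq_square power3_eq_cube)
    also have "\<dots> \<le> 3 / 25 * ((2 * A * v)\<^sup>2 / (A ^ 3 * 2 powr A))"
      using n0_le Ap by (intro mult_left_mono divide_right_mono power_mono) auto
    also have "\<dots> = 12 / 25 / A"
    proof -
      have "v\<^sup>2 = 2 powr A" unfolding v_def two_powr_power by simp
      then show ?thesis using Ap by (simp add: power_mult_distrib power2_eq_square power3_eq_cube)
    qed
    also have "\<dots> \<le> 1 / 8" using A_large by (simp add: divide_le_eq)
    finally show ?thesis .
  qed
  let ?Y = "(\<Sum>i=1..<a. rho b ^ i / dw i) + 1 / A * rho b ^ a / dw a"
  have p3: "fact n1 / ((1 / A) ^ B * rho b ^ n1 * zeta b ^ k) * exp (zeta b * ?Y) \<le> 1 / 8"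
  proof -
    define E where "E = 1 + ln (real n1 + 1) + (n1 * ln n1 - n1) + B * ln A - n1 * ln (rho b) - k * ln (zeta b) + zeta b * ?Y"
    have "fact n1 / ((1 / A) ^ B * rho b ^ n1 * zeta b ^ k) * exp (zeta b * ?Y) \<le> exp E"
    proof -
      have "fact n1 \<le> exp 1 * (real n1 + 1) * (real n1 / exp 1) ^ n1" by (rule fact_le)
      also have "\<dots> = exp (1 + ln (real n1 + 1) + (n1 * ln n1 - n1))"
      proof -
        have "(real n1 / exp 1) ^ n1 = exp (ln n1) ^ n1 / exp 1 ^ n1" using n1p by (simp add: power_divide)
        also have "\<dots> = exp (n1 * ln n1 - n1)" by (simp only: exp_diff exp_of_nat_mult[symmetric]) simp
        finally show ?thesis using n1p by (simp add: exp_add)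
      qed
      finally have f: "fact n1 \<le> exp (1 + ln (real n1 + 1) + (n1 * ln n1 - n1))" .
      have "(1 / A) ^ B * rho b ^ n1 * zeta b ^ k = exp (- (B * ln A) + n1 * ln (rho b) + k * ln (zeta b))"
      proof -
        have pw: "y ^ m = exp (real m * ln y)" if "0 < y" for y :: real and m
          using that by (simp add: exp_of_nat_mult)
        have "(1 / A) ^ B = exp (- (B * ln A))" using pw[of "1 / A" B] Ap by (simp add: ln_div)
        then show ?thesis by (simp only: exp_add pw[OF rho_pos] pw[OF zeta_pos])
      qed
      then have "fact n1 / ((1 / A) ^ B * rho b ^ n1 * zeta b ^ k) * exp (zeta b * ?Y)
          \<le> exp (1 + ln (real n1 + 1) + (n1 * ln n1 - n1)) / exp (- (B * ln A) + n1 * ln (rho b) + k * ln (zeta b)) * exp (zeta b * ?Y)"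
        using f by (intro mult_right_mono) (auto intro!: divide_right_mono)
      also have "\<dots> = exp E" unfolding E_def exp_diff[symmetric] exp_add[symmetric] by (simp add: algebra_simps)
      finally show ?thesis .
    qed
    also have "E \<le> - 3"
    proof -
      have l0: "ln (real n0 / rho b) = 1 - Lam b" using np rho_pos[of b] by (simp add: Lam_def ln_div)
      \<comment> \<open>The convex function z ln z - z lies above its tangent at
        \<open>n1\<close>.\<close>
      have conv: "n1 * ln n1 - n1 \<le> n0 * ln n0 - n0 + A * R * ln n1"
      proof -
        have "ln (real n1 / n0) \<le> real n1 / n0 - 1" using n1p np by (intro ln_le_minus_one) auto
        then have "real n0 * ln (real n1 / n0) \<le> real n0 * (real n1 / n0 - 1)" by (intro mult_left_mono) auto
        also have "\<dots> = real n1 - n0" using np by (simp add: right_diff_distrib)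
        finally show ?thesis using n1p np by (simp add: ln_div n1 algebra_simps)
      qed
      have kz: "- (k * ln (zeta b)) \<le> (real n0 * Lam b - K b * Z b) + R * (- ln (zeta b)) + \<Delta> * (A\<^sup>2 / 2)"
      proof -
        have "- (k * ln (zeta b)) = k * (- ln (zeta b))" by simp
        also have "\<dots> \<le> (K b * Z b + R + \<Delta>) * (- ln (zeta b))" using k minus_ln_zeta(1) by (intro mult_right_mono) auto
        also have "\<dots> = K b * Z b * (- ln (zeta b)) + R * (- ln (zeta b)) + \<Delta> * (- ln (zeta b))" by (simp only: distrib_right)
        also have "K b * Z b * (- ln (zeta b)) = K b * Z b * ((A - jb b) * Lam b) - K b * Z b"
        proof -
          have "- ln (zeta b) = (A - jb b) * Lam b - 1" using ln_zeta[OF tilt] by simp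
          then show ?thesis by (simp only: right_diff_distrib mult_1_right)
        qed
        also have "K b * Z b * ((A - jb b) * Lam b) = real n0 * Lam b" unfolding KZ[symmetric] by simp
        also have "\<Delta> * (- ln (zeta b)) \<le> \<Delta> * (A\<^sup>2 / 2)" using \<Delta>(1) minus_ln_zeta(2) by (intro mult_left_mono) auto
        finally show ?thesis by simp
      qed
      \<comment> \<open>A planted class adds one colour and \<open>a\<close> vertices. By the
        definition of \<open>zeta\<close> its total contribution to the exponent is ln (mu1 / K),
        and this is at most ln (16 / A).\<close>
      have plant: "R * (- ln (zeta b)) + A * R * ln n1 - A * R * ln (rho b) \<le> - (R * (ln A - 3))"
      proof -
        have "- ln (zeta b) + A * ln n1 - A * ln (rho b) = ln mu1 - ln (K b)"
          unfolding mu1_def zeta_def using K_pos[of b] rho_pos[of b] n1p by (simp add: ln_div ln_mult ln_realpow)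
        also have "ln mu1 - ln (K b) = ln (mu1 / K b)" using mu1p K_pos[of b] by (simp add: ln_div)
        also have "\<dots> \<le> ln (16 / A)"
        proof -
          have "mu1 * A \<le> 3 / 50 * n' * A" using mu1n by (intro mult_right_mono) auto
          also have "\<dots> = 3 / 50 * (real n0 / A)" using Ap by (simp add: n'_def power2_eq_square)
          also have "\<dots> \<le> 16 * (real n0 / (256 * A))" using np Ap by (simp add: field_simps)
          also have "\<dots> \<le> 16 * K b" using K_bounds(1)[OF b] by (intro mult_left_mono) auto
          finally have "mu1 / K b \<le> 16 / A" using K_pos[of b] Ap by (simp add: field_simps)
          then show ?thesis using mu1p K_pos[of b] Ap by (subst ln_le_cancel_iff) auto
        qed
        also have "\<dots> \<le> - (ln A - 3)"
        proof -
          have "ln (16::real) = 4 * ln 2" using ln_realpow[of 2 4] by simp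
          then show ?thesis using Ap ln2_bounds by (simp add: ln_div)
        qed
        finally have "R * (- ln (zeta b) + A * ln n1 - A * ln (rho b)) \<le> R * (- (ln A - 3))" by (intro mult_left_mono) auto
        then show ?thesis by (simp add: algebra_simps)
      qed
      \<comment> \<open>This cancels the term n0 * Lam of \<open>kz\<close>: before planting the
        exponent is balanced, by the choice of the tilt.\<close>
      have base: "n0 * ln n0 - n0 - n0 * ln (rho b) = - (real n0 * Lam b)"
        using arg_cong[OF l0, of "\<lambda>t. real n0 * t"] np rho_pos[of b] by (simp add: ln_div right_diff_distrib)
      have lnn1: "ln (real n1 + 1) \<le> 2 * A"
      proof -
        have "ln (real n1 + 1) \<le> ln (2 * (real n0 + 1))" using n1le n1p by (subst ln_le_cancel_iff) auto
        also have "\<dots> = ln 2 + ln (real n0 + 1)" by (subst ln_mult) auto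
        finally show ?thesis using ln_n0_le ln2_bounds A_large by linarith
      qed
      have BA: "B * ln A \<le> (24 / 50 * n' + 1) * ln A" using B L5 by (intro mult_right_mono) auto
      have Rl: "9 / 10 * n' * (ln A - 3) \<le> R * (ln A - 3)" using R(1) L5 by (intro mult_right_mono) (auto simp: n'_def)
      have Dl: "\<Delta> * (A\<^sup>2 / 2) \<le> 1 / 20 * (n' * ln A)"
      proof -
        have "\<Delta> * (A\<^sup>2 / 2) \<le> 1 / 10 * (real n0 * ln A / A ^ 4) * (A\<^sup>2 / 2)" using \<Delta>(2) by (intro mult_right_mono) auto
        also have "\<dots> = 1 / 20 * (n' * ln A)" using Ap by (simp add: n'_def power2_eq_square power4_eq_xxxx)
        finally show ?thesis .
      qed
      have n0A: "4 * real n0 / A\<^sup>2 = 4 * n'" by (simp add: n'_def)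
      have e: "real n1 * ln (rho b) = real n0 * ln (rho b) + A * R * ln (rho b)" by (simp add: n1 algebra_simps)
      have "E \<le> 1 + 2 * A + (24 / 50 * n' + 1) * ln A + 4 * n' - 9 / 10 * n' * (ln A - 3) + 1 / 20 * (n' * ln A)"
        unfolding E_def using conv kz plant base lnn1 BA Rl Dl zeta_Y n0A e by linarith
      \<comment> \<open>Here 37/100 = 9/10 - 24/50 - 1/20 collects the planted classes, the
        permitted ones and \<open>\<Delta>\<close>, and 67/10 = 4 + 3 * 9/10. The assumption ln A >=
        30 makes the bracket smaller than -4.\<close>
      also have "\<dots> = 1 + 2 * A + ln A + n' * (67 / 10 - 37 / 100 * ln A)" by (simp add: field_simps)
      also have "\<dots> \<le> 1 + 2 * A + ln A + n' * (- 4)" using L5 n'0 by (intro add_left_mono mult_left_mono) auto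
      also have "\<dots> \<le> - 3" using n'big L3 A_large L5 by linarith
      finally show ?thesis .
    qed
    then have "exp E \<le> exp (- 3)" by simp
    also have "exp (- 3 :: real) \<le> 1 / 8"
    proof -
      have "(2::real) ^ 3 \<le> exp 1 ^ 3" using exp_1_ge by (intro power_mono) auto
      then show ?thesis by (simp add: exp_minus exp_of_nat_mult[of 3 1, simplified] field_simps)
    qed
    finally show ?thesis .
  qed
  have "cp n1 k \<le> real n1 ^ a / dw a / (real B + 1) + real n1 ^ Suc a / dw (Suc a)
     + fact n1 / ((1 / A) ^ B * rho b ^ n1 * zeta b ^ k) * exp (zeta b * ?Y)"
    using A_large rho_pos[of b] zeta_pos[of b] zeta_le_1 by (intro cp_first_moment) auto
  then show ?thesis using p1 p2 p3 unfolding mu1_def n1_def[symmetric] by linarith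
qed

end

section \<open>The gap between the chromatic and the cochromatic number\<close>

context tilted
begin

lemma gap_not_small:
  assumes g: "\<And>n. prob_Gn_half n (\<lambda>E. int (chromatic_number n E) - int (cochromatic_number n E) \<le> g n) > 0.999"
    and small: "\<And>n. n0 \<le> n \<Longrightarrow> real_of_int (g n) \<le> 1 / 20000 * sqrt (real n) * ln (ln (real n)) / (ln (real n)) ^ 3"
  shows False
proof -
  obtain k0 where k0: "real k0 \<le> K b * Z b + 6 * real n0 / A ^ 5" "1 / 2 \<le> cp n0 k0" using cp_n0 by blast
  have Ap: "0 < A" and np: "0 < real n0" using A_large n0_big by auto
  define w where "w = sqrt (real n0)"
  have w2: "w * w = real n0" by (simp add: w_def)
  have w0: "0 < w" using np by (simp add: w_def)
  have wbig: "A ^ 50 \<le> w" unfolding w_def using n0_ge_power by (intro real_le_rsqrt) (simp add: power_mult[symmetric])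
  have wA: "A ^ i \<le> w" if "i \<le> 50" for i
  proof -
    have "A ^ i \<le> A ^ 50" using that A_large by (intro power_increasing) auto
    then show ?thesis using wbig by linarith
  qed
  \<comment> \<open>Then r^2 <= n0 / (100 A^2) <= mu, the condition under which one portion can be
    planted at bounded cost.\<close>
  define r where "r = nat \<lfloor>w / (10 * A)\<rfloor>"
  have "110 * A \<le> w"
  proof -
    have "110 * A \<le> A * A" using A_large by (intro mult_right_mono) auto
    then show ?thesis using wA[of 2] by (simp add: power2_eq_square)
  qed
  then have "1 \<le> w / (110 * A)" using Ap by (simp add: pos_le_divide_eq)
  moreover have "w / (10 * A) = w / (11 * A) + w / (110 * A)" using Ap by (simp add: field_simps)
  moreover have "real r \<le> w / (10 * A)" "w / (10 * A) - 1 \<le> real r" unfolding r_def using w0 Ap by (auto simp: of_nat_nat)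
  ultimately have r: "real r \<le> w / (10 * A)" "w / (11 * A) \<le> real r" by linarith+
  have rp: "0 < real r"
  proof -
    have "0 < w / (11 * A)" using w0 Ap by simp
    then show ?thesis using r(2) by linarith
  qed
  have r2: "real r ^ 2 \<le> real n0 / (100 * A\<^sup>2)"
  proof -
    have "real r ^ 2 \<le> (w / (10 * A)) ^ 2" using r by (intro power_mono) auto
    then show ?thesis using w2 by (simp add: power_divide power_mult_distrib power2_eq_square)
  qed
  \<comment> \<open>Altogether T r, about n0 / A^2, sets are planted: more than the independent sets
    of size \<open>a\<close> available at the end, but so few vertices that their expected number
    grows only by a constant factor.\<close>
  define T where "T = nat \<lfloor>real n0 / (A\<^sup>2 * r)\<rfloor>"
  have T: "real T \<le> real n0 / (A\<^sup>2 * r)" "real n0 / (A\<^sup>2 * r) - 1 \<le> real T"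
    unfolding T_def by (auto simp: of_nat_nat)
  have Tr: "real (T * r) \<le> real n0 / A\<^sup>2" "9 / 10 * (real n0 / A\<^sup>2) \<le> real (T * r)"
  proof -
    have "real T * real r \<le> real n0 / (A\<^sup>2 * r) * real r" using T(1) by (intro mult_right_mono) auto
    then show "real (T * r) \<le> real n0 / A\<^sup>2" using rp by simp
    have "(real n0 / (A\<^sup>2 * r) - 1) * real r \<le> real T * real r" using T(2) by (intro mult_right_mono) auto
    then have "real n0 / A\<^sup>2 - real r \<le> real (T * r)" using rp by (simp add: left_diff_distrib)
    moreover have "real r \<le> 1 / 10 * (real n0 / A\<^sup>2)"
    proof -
      have "w / (10 * A) \<le> w / 10" using w0 A_large by (intro divide_left_mono) auto
      moreover have "w * A\<^sup>2 \<le> w * w" using wA[of 2] w0 by (intro mult_left_mono) auto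
      then have "w \<le> real n0 / A\<^sup>2" unfolding w2 using Ap by (simp add: pos_le_divide_eq)
      ultimately show ?thesis using r(1) by linarith
    qed
    ultimately show "9 / 10 * (real n0 / A\<^sup>2) \<le> real (T * r)" by linarith
  qed
  have Tle: "real T \<le> 11 * w / A"
  proof -
    have "real n0 / (A\<^sup>2 * r) \<le> real n0 / (A\<^sup>2 * (w / (11 * A)))"
      using r(2) w0 Ap rp np by (intro divide_left_mono mult_left_mono mult_pos_pos) auto
    also have "\<dots> = 11 * w / A" using w0 Ap w2[symmetric] by (simp add: power2_eq_square)
    finally show ?thesis using T(1) by linarith
  qed
  \<comment> \<open>The constant 35 bounds sqrt 2 / (693/2000)^3, which arises from sqrt m <= sqrt 2
    * w and ln m >= 693/2000 * A for all sizes \<open>m\<close> that occur.\<close>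
  define sb where "sb = 35 / 20000 * (w * ln A / A ^ 3)"
  define s where "s = nat \<lceil>sb\<rceil>"
  have sb0: "0 \<le> sb" unfolding sb_def using w0 L5 Ap by (intro mult_nonneg_nonneg divide_nonneg_nonneg) auto
  have s: "sb \<le> real s" "real s \<le> sb + 1" unfolding s_def using sb0 by linarith+
  have gs: "g m \<le> int s" if m: "n0 \<le> m" "real m \<le> 2 * real n0" for m
  proof -
    have mp: "0 < real m" using m(1) np by linarith
    have l1: "693 / 2000 * A \<le> ln m"
    proof -
      have "ln v \<le> ln m" using n0_big(2) m(1) v_large by (subst ln_le_cancel_iff) auto
      then show ?thesis using ln_v lA_bounds(1) by linarith
    qed
    have l2: "ln m \<le> A"
    proof -
      have "ln m \<le> ln (4 * A * v)" using m(2) n0_le mp by (subst ln_le_cancel_iff) auto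
      also have "\<dots> = ln 4 + ln A + ln v" using Ap v_large by (simp add: ln_mult)
      also have "ln (4::real) \<le> 3" using ln_le_minus_one[of "4::real"] by simp
      finally show ?thesis using ln_v L3 lA_bounds(2) A_large by linarith
    qed
    have l3: "0 \<le> ln (ln m)" "ln (ln m) \<le> ln A"
    proof -
      have "1 \<le> ln m" using l1 A_large by simp
      then show "0 \<le> ln (ln m)" "ln (ln m) \<le> ln A" using l2 Ap by (auto simp: ln_le_cancel_iff)
    qed
    have sm: "sqrt m \<le> 14143 / 10000 * w"
    proof -
      have "sqrt m \<le> sqrt (2 * real n0)" using m(2) by simp
      also have "\<dots> = sqrt 2 * w" by (simp add: real_sqrt_mult w_def)
      also have "\<dots> \<le> 14143 / 10000 * w" using sqrt2_bounds w0 by (intro mult_right_mono) auto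
      finally show ?thesis .
    qed
    have "real_of_int (g m) \<le> 1 / 20000 * sqrt m * ln (ln m) / (ln m) ^ 3" by (rule small[OF m(1)])
    also have "\<dots> \<le> (1 / 20000 * (14143 / 10000 * w) * ln A) / (693 / 2000 * A) ^ 3"
      using sm l1 l3 w0 Ap L5 by (intro frac_le mult_mono power_mono mult_nonneg_nonneg) auto
    also have "\<dots> = (14143 / 10000 / (693 / 2000) ^ 3 / 20000) * (w * ln A / A ^ 3)"
      unfolding power_mult_distrib by simp
    also have "\<dots> \<le> sb" unfolding sb_def using w0 L5 Ap
      by (intro mult_right_mono divide_nonneg_nonneg mult_nonneg_nonneg) (auto simp: power3_eq_cube)
    finally have "real_of_int (g m) \<le> real s" using s(1) by linarith
    then show ?thesis by linarith
  qed
  have n0A: "real n0 / A \<le> real n0" using A_large np by (simp add: divide_le_eq)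
  have step: "1 / 2 \<le> cp (m + a * r) (f + r + s)"
    if m: "n0 \<le> m" "real (m + a * r) \<le> real n0 + real n0 / A" and f: "1 / 2 \<le> cp m f" for m f
  proof -
    let ?m = "m + a * r"
    have mle: "real m \<le> real n0 + real n0 / A"
    proof -
      have "real m \<le> real (m + a * r)" by (intro of_nat_mono) simp
      then show ?thesis using m(2) by linarith
    qed
    have m2: "real ?m \<le> 2 * real n0" using m(2) n0A by linarith
    have mp: "0 < m" using m(1) np by simp
    have "real r ^ 2 * pair_weight a a (Suc a) (1 / m) \<le> 2"
    proof (rule plant_weight)
      show "4 \<le> a" using A_large by linarith
      have "2 powr (- A / 4) \<le> 2 powr (- A / 8)" by (intro powr_mono) auto
      then have "A ^ 4 * 2 powr (- A / 4) \<le> A ^ 4 * 2 powr (- A / 8)" by (intro mult_left_mono) auto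
      also have "\<dots> \<le> 1 / A ^ (100 - 4)" by (rule A_powers) simp
      also have "\<dots> \<le> 1 / A ^ 1" using A_large by (intro divide_left_mono power_increasing) auto
      finally show "A ^ 4 * 2 powr (- A / 4) \<le> 1 / A" by simp
      show "2 powr (A / 2) \<le> real m" using n0_big(2) m(1) by (simp add: v_def)
      show "real m \<le> 2 * A * 2 powr (A / 2)"
      proof -
        have "real n0 / A \<le> real n0 / 4" using A_large np by (intro divide_left_mono) auto
        moreover have "131072 * 1 \<le> A * v" using A_large v_large by (intro mult_mono) auto
        ultimately show ?thesis using mle n0_upper(2) by (simp add: v_def)
      qed
      have "1 \<le> A\<^sup>2" using A_large by (intro one_le_power) simp
      then have "1 \<le> 100 * A\<^sup>2" by linarith
      then have "real n0 / (100 * A\<^sup>2) \<le> real n0 / 1" using np Ap by (intro divide_left_mono) auto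
      then show "real r ^ 2 \<le> m" using r2 m(1) by linarith
      have "real r ^ 2 \<le> mu" using r2 mu_ge by linarith
      then have "real r ^ 2 * dw a \<le> real n0 ^ a" unfolding mu_def by (simp add: pos_le_divide_eq)
      also have "\<dots> \<le> real m ^ a" using m(1) by (intro power_mono) auto
      finally show "real r ^ 2 * dw a \<le> real m ^ a" .
    qed
    then have "exp (real r ^ 2 * pair_weight a a (Suc a) (1 / m)) \<le> exp 2" by simp
    also have "exp (2::real) = exp 1 ^ 2" by (simp add: exp_double[symmetric])
    also have "\<dots> \<le> 3 ^ 2" by (intro power_mono exp_le) auto
    finally have e9: "exp (real r ^ 2 * pair_weight a a (Suc a) (1 / m)) \<le> 9" by simp
    have "(1 / 2)\<^sup>2 \<le> (cp m f)\<^sup>2" using f by (intro power_mono) auto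
    also have "\<dots> \<le> exp (real r ^ 2 * pair_weight a a (Suc a) (1 / m)) * cp ?m (f + r)" by (rule cp_plant[OF mp])
    also have "\<dots> \<le> 9 * cp ?m (f + r)" using e9 by (intro mult_right_mono cp_nonneg)
    \<comment> \<open>The second moment leaves (1/2)^2 / 9 with 9 >= exp 2. With \<open>s\<close>
      more colours the failure probability is at most 36 * 0.001, so the bound 1/2 is restored for
      the next portion.\<close>
    finally have c36: "1 / 36 \<le> cp ?m (f + r)" by (simp add: power2_eq_square)
    have "g ?m \<le> int s" using m m2 by (intro gs) auto
    then have "cp ?m (f + r) * (1 - cp ?m (f + r + s)) \<le> 0.001" by (intro cp_product_bound[OF g])
    moreover have "1 / 36 * (1 - cp ?m (f + r + s)) \<le> cp ?m (f + r) * (1 - cp ?m (f + r + s))"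
      using c36 cp_le_1[of ?m "f + r + s"] by (intro mult_right_mono) auto
    ultimately show ?thesis by simp
  qed
  have ATr: "A * real (T * r) \<le> real n0 / A"
  proof -
    have "A * real (T * r) \<le> A * (real n0 / A\<^sup>2)" using Tr(1) by (intro mult_left_mono) auto
    then show ?thesis using Ap by (simp add: power2_eq_square)
  qed
  have "1 / 2 \<le> cp (n0 + a * (t * r)) (k0 + t * (r + s))" if "t \<le> T" for t
    using that
  proof (induction t)
    case 0
    then show ?case using k0 by simp
  next
    case (Suc t)
    have e: "n0 + a * (Suc t * r) = (n0 + a * (t * r)) + a * r" by (simp add: algebra_simps)
    have k: "k0 + Suc t * (r + s) = (k0 + t * (r + s)) + r + s" by (simp add: algebra_simps)
    have "Suc t * r \<le> T * r" using Suc.prems by (intro mult_right_mono) auto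
    then have "A * real (Suc t * r) \<le> A * real (T * r)" by (intro mult_left_mono of_nat_mono) auto
    then have "real (n0 + a * (t * r) + a * r) \<le> real n0 + real n0 / A"
      unfolding e[symmetric] using ATr by simp
    then show ?case unfolding e k using Suc by (intro step) auto
  qed
  then have half: "1 / 2 \<le> cp (n0 + a * (T * r)) (k0 + T * (r + s))" by simp
  define \<Delta> where "\<Delta> = 6 * real n0 / A ^ 5 + real T * real s"
  have "cp (n0 + a * (T * r)) (k0 + T * (r + s)) < 1 / 2"
  proof (rule cp_upper[OF Tr(2,1)])
    show "real (k0 + T * (r + s)) \<le> K b * Z b + real (T * r) + \<Delta>"
      using k0(1) by (simp add: \<Delta>_def distrib_left)
    show "0 \<le> \<Delta>" by (simp add: \<Delta>_def)
    have u: "0 \<le> real n0 * ln A / A ^ 4" using L5 Ap by simp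
    have t1: "6 * real n0 / A ^ 5 \<le> 1 / 100 * (real n0 * ln A / A ^ 4)"
    proof -
      have "6 * real n0 / A ^ 5 = 6 / A * (real n0 / A ^ 4)" using power_Suc[of A 4] by simp
      also have "\<dots> \<le> 1 / 100 * ln A * (real n0 / A ^ 4)"
      proof (intro mult_right_mono)
        have "6 / A \<le> 6 / 100" using A_large by (intro divide_left_mono) auto
        then show "6 / A \<le> 1 / 100 * ln A" using L5 by linarith
      qed simp
      finally show ?thesis by (simp add: mult.commute)
    qed
    have "real T * real s \<le> (11 * w / A) * (sb + 1)" using Tle s(2) w0 Ap by (intro mult_mono) auto
    also have "\<dots> = 385 / 20000 * (real n0 * ln A / A ^ 4) + 11 * w / A"
      unfolding sb_def w2[symmetric] using Ap by (simp add: field_simps eval_nat_numeral)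
    also have "11 * w / A \<le> 1 / 100 * (real n0 * ln A / A ^ 4)"
    proof -
      have "11 * w / A \<le> 11 * w / 1" using w0 A_large by (intro divide_left_mono) auto
      also have "w \<le> real n0 / A ^ 4 / A"
      proof -
        have "w * A ^ 5 \<le> w * w" using wA[of 5] w0 by (intro mult_left_mono) auto
        then have "w \<le> real n0 / A ^ 5" unfolding w2 using Ap by (simp add: pos_le_divide_eq)
        then show ?thesis using power_Suc[of A 4] by (simp add: mult.commute)
      qed
      also have "real n0 / A ^ 4 / A \<le> real n0 / A ^ 4 / 131072" using A_large by (intro divide_left_mono) auto
      finally have "11 * w / A \<le> 11 / 131072 * (real n0 / A ^ 4)" by simp
      also have "\<dots> \<le> 1 / 100 * ln A * (real n0 / A ^ 4)" using L5 by (intro mult_right_mono) auto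
      finally show ?thesis by (simp add: mult.commute)
    qed
    finally show "\<Delta> \<le> 1 / 10 * (real n0 * ln A / A ^ 4)" using t1 u unfolding \<Delta>_def by linarith
  qed
  then show False using half by linarith
qed

end

lemma eventually_large: "eventually (\<lambda>J. large J (2 * J ^ 4)) sequentially"
proof -
  have "eventually (\<lambda>J::nat. 300 * (2 * real J ^ 4) \<le> 2 powr (2 * real J ^ 4 - 1)) sequentially"
    "eventually (\<lambda>J::nat. ln (200 * (2 * real J ^ 4)) + 20 \<le> 48 / 10000 * (2 * real J ^ 4)) sequentially"
    "eventually (\<lambda>J::nat. 4100 * ln (2 * real J ^ 4) \<le> (2 * real J ^ 4)) sequentially"
    "eventually (\<lambda>J::nat. (2 * real J ^ 4) ^ 100 * 2 powr (- (2 * real J ^ 4) / 8) \<le> 1) sequentially"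
    "eventually (\<lambda>J::nat. 30 \<le> ln (2 * real J ^ 4)) sequentially"
    "eventually (\<lambda>J::nat. 2 * real J ^ 4 * 2 powr (- (real J * (real J / 2 - 4))) \<le> 1) sequentially"
    by real_asymp+
  then show ?thesis using eventually_ge_at_top[of "16::nat"]
  proof eventually_elim
    case (elim J)
    show ?case by unfold_locales (use elim in simp_all)
  qed
qed

theorem theorem1:
  shows "\<exists>c::real. c > 0 \<and>
    (\<forall>g :: nat \<Rightarrow> int.
      (\<forall>n. prob_Gn_half n (\<lambda>E. int (chromatic_number n E) - int (cochromatic_number n E) \<le> g n) > 0.999)
      \<longrightarrow> infinite {n. real_of_int (g n) > c * sqrt (real n) * ln (ln (real n)) / (ln (real n)) ^ 3})"
proof (intro exI[of _ "1 / 20000"] conjI allI impI)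
  show "0 < (1 / 20000 :: real)" by simp
  fix g :: "nat \<Rightarrow> int"
  assume g: "\<forall>n. prob_Gn_half n (\<lambda>E. int (chromatic_number n E) - int (cochromatic_number n E) \<le> g n) > 0.999"
  let ?S = "{n. real_of_int (g n) > 1 / 20000 * sqrt (real n) * ln (ln (real n)) / (ln (real n)) ^ 3}"
  show "infinite ?S"
  proof
    assume "finite ?S"
    then obtain N where N: "\<forall>n\<in>?S. n < N" using finite_nat_set_iff_bounded by blast
    \<comment> \<open>Choosing J >= N forces n0 >= N, since n0 is at least 600 times the class size;
      so the assumed smallness of the gap holds at every size from \<open>n0\<close> on.\<close>
    have "eventually (\<lambda>J. large J (2 * J ^ 4) \<and> N \<le> J) sequentially"
      using eventually_large eventually_ge_at_top[of N] by eventually_elim simp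
    then obtain J where J: "large J (2 * J ^ 4)" "N \<le> J"
      using eventually_happens'[OF sequentially_bot] by blast
    interpret large J "2 * J ^ 4" by (rule J(1))
    obtain b where b: "0 \<le> b" "b \<le> 3" "Lam b * jb b = A - 1 + ln (K b / mu)" using exists_tilt by blast
    interpret tilted J "2 * J ^ 4" b by unfold_locales (use b in auto)
    have "real J \<le> real n0" using J_le(1) n0_big(1) A_large by simp
    then have "N \<le> n0" using J(2) by simp
    show False
    proof (rule gap_not_small)
      fix n assume "n0 \<le> n"
      then have "n \<notin> ?S" using N \<open>N \<le> n0\<close> by (meson leD order_trans)
      then show "real_of_int (g n) \<le> 1 / 20000 * sqrt (real n) * ln (ln (real n)) / (ln (real n)) ^ 3" by simp
    qed (use g in blast)
  qed
qed

end
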